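(* Let $k\ge 1$ be an odd integer and let $r\neq -1$ be an odd integer. For every $x>0$, \begin{align*} \sum_{n=1}^{\infty} D_{k,r}(n) e^{-nx}=&-\frac{1}{2}\zeta(-r)+\frac{1}{k}\Gamma\left(\frac{1}{k}\right)\zeta\left(\frac{1}{k}-r\right)x^{-\frac{1}{k}}+R_{1+r}+R+\frac{(-1)^{\frac{2k+r-1}{2}} (2\pi)^{\frac{k+1-2r}{2}}}{x\, k^{\frac{2k-1}{2}}} \\ & \times \sum_{\substack{j=-(k-1)\\ j\equiv k-1 \ (\mathrm{mod}\ 2)}}^{k-1} i^j \sum_{n=1}^{\infty} S_{k,r}(n)\,G_{0,k}^{\,k,0} \!\left( \,\begin{matrix}-\\ r,-\frac{1}{k},\dots ,-\frac{k-1}{k} \end{matrix} \; \Big| X(-j)\right), \end{align*} where $X(j)=\dfrac{e^{-\frac{i\pi j}{2}} (2\pi)^{k+1}n}{k^{k} x}$ (so $X(-j)=\dfrac{e^{\frac{i\pi j}{2}} (2\pi)^{k+1}n}{k^{k} x}$), $$R_{1+r}=\begin{cases} r!\,\zeta(k(1+r))\,x^{-(1+r)}, & r\ge 0,\\[2pt] \dfrac{(-1)^{1+r}}{(-(1+r))!}\,k\,\zeta'(k(1+r))\,x^{-(1+r)}, & r<0,\end{cases}$$ and $$R=\begin{cases} 0, & r\ge 1,\\[2pt] \dfrac{(-1)^{ \frac{1+r}{2} }}{2} \displaystyle\sum_{i=0}^{\frac{-(1+r)}{2}} \frac{(-1)^{i+1} B_{k(2i+1)+1}}{(2i+1)!\,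 (k(2i+1)+1) } \frac{ B_{-2i-1-r}\, (2\pi)^{-r }}{ (-(2i+1+r))!} \left( \frac{x}{2\pi} \right)^{2i+1}, & r\le -3.\end{cases}$$
   Context: $\zeta$ is the Riemann zeta function, $\Gamma$ the gamma function, and $B_n$ the Bernoulli numbers defined by $\frac{z}{e^z-1}=\sum_{n\ge0}B_n\frac{z^n}{n!}$. For $k\in\mathbb{N}$, $r\in\mathbb{Z}$ define $D_{k,r}(n)=\sum_{d\ge1,\ d^k\mid n}\left(\frac{n}{d^k}\right)^r$ and $S_{k,r}(n)=\sum_{d\ge1,\ d^k\mid n}\left(\frac{n}{d^k}\right)^{-r}d^{k-1}$. The sum over $j$ runs over $j=-(k-1),-(k-3),\dots,k-3,k-1$. For complex $b_1,\dots,b_k$ the Meijer $G$-function is $G_{0,k}^{\,k,0}\!\left(\begin{matrix}-\\ b_1,\dots,b_k\end{matrix}\Big| z\right)=\frac{1}{2\pi i}\int_L \prod_{j=1}^k\Gamma(b_j+s)\,z^{-s}\,ds$, where $L$ is a vertical line lying to the right of all poles of the integrand, and $z^{-s}$ uses the principal branch; it converges for $|\arg z|<k\pi/2$.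
   Formalization: In the Meijer G-function at X(-j), z^{-s} is taken with the displayed argument πj/2 (in the sector |arg z| < kπ/2), not reduced to the principal branch; with the principal branch the identity fails for k = 3, where j = -2 and j = 2 would coincide. *)

theory Defs
  imports
    "HOL-Analysis.Analysis"
    "HOL-Computational_Algebra.Formal_Power_Series"
begin

text \<open>The continuation is unique on \<^term>\<open>- {1} :: complex set\<close>; the value at the pole 1
  is unspecified.\<close>

definition zeta :: "complex \<Rightarrow> complex" where
  "zeta = (SOME f. f holomorphic_on - {1} \<and>
     (\<forall>s. Re s > 1 \<longrightarrow> (\<lambda>n. of_nat (Suc n) powr (- s)) sums f s))"

text \<open>The quotient is taken in the ring of formal power series; both operands are divisible by
  the indeterminate, and dividing cancels this common factor.\<close>

definition bernoulli :: "nat \<Rightarrow> real" where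
  "bernoulli n = fact n * fps_nth (fps_X / (fps_exp 1 - 1)) n"

text \<open>For \<open>n = 0\<close> the index sets below are infinite and the sums are 0; only \<open>n \<ge> 1\<close> matters.\<close>

definition D_fun :: "nat \<Rightarrow> int \<Rightarrow> nat \<Rightarrow> real" where
  "D_fun k r n = (\<Sum>d | d \<ge> 1 \<and> d ^ k dvd n. (real n / real (d ^ k)) powi r)"

definition S_fun :: "nat \<Rightarrow> int \<Rightarrow> nat \<Rightarrow> real" where
  "S_fun k r n =
     (\<Sum>d | d \<ge> 1 \<and> d ^ k dvd n. (real n / real (d ^ k)) powi (- r) * real d ^ (k - 1))"

text \<open>
  Abscissa of a vertical line to the right of all poles of \<open>\<Prod>b. \<Gamma>(b + s)\<close>, which are the points
  \<open>s = - b - m\<close> with \<open>m\<close> a natural number. The integral below does not depend on the choice.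
\<close>

definition meijer_abscissa :: "complex list \<Rightarrow> real" where
  "meijer_abscissa bs = (SOME c. \<forall>b\<in>set bs. - Re b < c)"

text \<open>
  The Meijer function \<open>G\<^sub>0\<^sub>,\<^sub>k\<^sup>k\<^sup>,\<^sup>0\<close> with lower parameters \<open>bs\<close> (so \<open>k\<close> is the length of \<open>bs\<close>).
  Since the defining integral converges for \<open>\<bar>arg z\<bar> < k \<pi> / 2\<close>, a range exceeding
  \<open>(-\<pi>, \<pi>]\<close> when \<open>k \<ge> 3\<close>, the function lives on the Riemann surface of the logarithm. Its
  argument \<open>z\<close> is therefore given by its modulus \<open>\<rho> > 0\<close> and its argument \<open>\<theta>\<close>, not reduced
  modulo \<open>2 \<pi>\<close>, and \<open>z\<^sup>-\<^sup>s = exp (- s (ln \<rho> + i \<theta>))\<close>. The line is parametrised by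
  \<open>s = c + i t\<close>, \<open>ds = i dt\<close>.
\<close>

definition meijer_G :: "complex list \<Rightarrow> real \<Rightarrow> real \<Rightarrow> complex" where
  "meijer_G bs \<rho> \<theta> =
     1 / (2 * of_real pi * \<i>) *
     (LINT t|lborel.
        (let s = Complex (meijer_abscissa bs) t
         in (\<Prod>b\<leftarrow>bs. Gamma (b + s)) * exp (- s * (of_real (ln \<rho>) + \<i> * of_real \<theta>)) * \<i>))"

text \<open>For arguments in \<open>(-\<pi>, \<pi>]\<close> this is the principal branch of \<open>z\<^sup>-\<^sup>s\<close>.\<close>

lemma meijer_G_principal:
  assumes "\<rho> > 0" "- pi < \<theta>" "\<theta> \<le> pi"
  shows "meijer_G bs \<rho> \<theta> =
     1 / (2 * of_real pi * \<i>) *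
     (LINT t|lborel.
        (let s = Complex (meijer_abscissa bs) t
         in (\<Prod>b\<leftarrow>bs. Gamma (b + s)) * rcis \<rho> \<theta> powr (- s) * \<i>))"
proof -
  have "rcis \<rho> \<theta> = exp (of_real (ln \<rho>) + \<i> * of_real \<theta>)"
    using assms by (simp add: rcis_def cis_conv_exp exp_add exp_of_real)
  moreover have "Ln (exp (of_real (ln \<rho>) + \<i> * of_real \<theta>)) = of_real (ln \<rho>) + \<i> * of_real \<theta>"
    using assms by (intro Ln_exp) auto
  ultimately show ?thesis
    by (simp add: meijer_G_def powr_def Let_def)
qed

text \<open>
  Modulus and argument of \<open>X(j) = exp (- i \<pi> j / 2) (2 \<pi>)\<^sup>k\<^sup>+\<^sup>1 n / (k\<^sup>k x)\<close>, the argument being the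
  exponent \<open>- \<pi> j / 2\<close> as displayed.
\<close>

definition X_abs :: "nat \<Rightarrow> real \<Rightarrow> nat \<Rightarrow> real" where
  "X_abs k x n = (2 * pi) ^ (k + 1) * real n / (real k ^ k * x)"

definition X_arg :: "int \<Rightarrow> real" where
  "X_arg j = - (pi * of_int j / 2)"

lemma X_rcis:
  "rcis (X_abs k x n) (X_arg j) =
     exp (- (\<i> * of_real pi * of_int j / 2)) * (2 * of_real pi) ^ (k + 1) * of_nat n /
     (of_nat k ^ k * of_real x)"
  by (simp add: rcis_def cis_conv_exp X_abs_def X_arg_def mult.assoc)

definition j_range :: "nat \<Rightarrow> int set" where
  "j_range k = {j. - (int k - 1) \<le> j \<and> j \<le> int k - 1 \<and> j mod 2 = (int k - 1) mod 2}"

definition G_params :: "nat \<Rightarrow> int \<Rightarrow> complex list" where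
  "G_params k r = of_int r # map (\<lambda>m. - (of_nat m / of_nat k)) [1..<k]"

definition R_one_plus :: "nat \<Rightarrow> int \<Rightarrow> real \<Rightarrow> complex" where
  "R_one_plus k r x =
     (if r \<ge> 0
      then fact (nat r) * zeta (of_int (int k * (1 + r))) * of_real (x powi (- (1 + r)))
      else (- 1) powi (1 + r) / fact (nat (- (1 + r))) * of_nat k *
           deriv zeta (of_int (int k * (1 + r))) * of_real (x powi (- (1 + r))))"

text \<open>Meant for odd \<open>r \<noteq> - 1\<close>, so that the second case is \<open>r \<le> - 3\<close>.\<close>

definition R_rest :: "nat \<Rightarrow> int \<Rightarrow> real \<Rightarrow> real" where
  "R_rest k r x =
     (if r \<ge> 1 then 0
      else (- 1) powi ((1 + r) div 2) / 2 *
        (\<Sum>i = 0..nat ((- (1 + r)) div 2).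
           (- 1) ^ (i + 1) * bernoulli (k * (2 * i + 1) + 1) /
             (fact (2 * i + 1) * real (k * (2 * i + 1) + 1)) *
           (bernoulli (nat (- 2 * int i - 1 - r)) * (2 * pi) powi (- r) /
             fact (nat (- (2 * int i + 1 + r)))) *
           (x / (2 * pi)) ^ (2 * i + 1)))"

end

theory Submission
  imports Defs "HOL-Complex_Analysis.Complex_Analysis" "HOL-Real_Asymp.Real_Asymp"
    "HOL-Computational_Algebra.Fundamental_Theorem_Algebra"
begin

text \<open>
  Mellin inversion writes the left-hand side as
  \<open>1 / (2 \<pi> i) \<integral> \<Gamma>(s) \<zeta>(s - r) \<zeta>(k s) x\<^sup>-\<^sup>s ds\<close> over a line far to the right. Moving the line to the left
  of all relevant poles picks up the residues at \<open>1 / k\<close>, \<open>1 + r\<close>, and at the nonpositive integers, where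
  the trivial zeros of \<open>\<zeta>\<close> leave only \<open>0\<close> and finitely many negative odd points. On the new line,
  reflected by \<open>s \<mapsto> 1 - s\<close>, the functional equation turns the zeta factors into the Dirichlet series of
  \<open>S_fun\<close>; Gauss multiplication splits \<open>\<Gamma>(k s)\<close> into the factors of the Meijer integrand, and the
  remaining quotient \<open>cos (k u) / cos u\<close>, a finite exponential sum for odd \<open>k\<close>, gives the sum over \<open>j\<close>.

  The zeta function itself is continued through the Mellin transform of \<open>1 / (e\<^sup>x - 1)\<close>; the partial
  fractions of this kernel give the functional equation.
\<close>

section \<open>Contour shifts between vertical lines\<close>

text \<open>Parity governs poles and signs. As r is odd, k (1 + r) is even and never 1, so the poles
  at 1/k and 1 + r are distinct. For r < -1 both Gamma(s) and zeta(s - r) are singular at 1 + r, but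
  there zeta(k s) has a trivial zero: the pole is simple and the derivative of zeta appears. For r =
  -1 the point would be 0, no zero of zeta, and the pole would be double. The abscissa c = |r| + 5/2
  makes the series of \<open>D_fun\<close> converge absolutely on Re s = c and that of
  \<open>S_fun\<close> on Re (1 - s) = c; as c is half an odd integer, no pole of Gamma lies on
  either line. All coefficients are nonnegative, so convergence at one real point justifies
  exchanging sum and integral on the whole line. Splitting cos (k u) / cos u into exponentials is
  safe because exp (- i j u) grows at most like exp (pi |j| |t| / 2), and |j| <= k - 1 is beaten by
  the decay of k Gamma factors, nearly exp (- k pi |t| / 2). These exponentials rotate the argument
  of X(-j), whose angle must therefore not be reduced modulo 2 pi.\<close>

text \<open>Cauchy's inequality dominates the difference quotients by \<open>g x / R\<close>, so
  dominated convergence along sequences differentiates under the integral. The measure is arbitrary,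
  so that counting measure later yields holomorphy of series.\<close>

lemma holomorphic_integral:
  fixes f :: "complex \<Rightarrow> 'a \<Rightarrow> complex"
  assumes S: "open S"
    and meas: "\<And>z. z \<in> S \<Longrightarrow> f z \<in> borel_measurable M"
    and hol: "\<And>x. x \<in> space M \<Longrightarrow> (\<lambda>z. f z x) holomorphic_on S"
    and bd: "\<And>z. z \<in> S \<Longrightarrow> \<exists>e>0. \<exists>g. integrable M g \<and>
               (\<forall>w\<in>ball z e \<inter> S. \<forall>x\<in>space M. norm (f w x) \<le> g x)"
  shows "(\<lambda>z. \<integral>x. f z x \<partial>M) holomorphic_on S"
proof -
  have "\<exists>D. ((\<lambda>z. \<integral>x. f z x \<partial>M) has_field_derivative D) (at z)" if z: "z \<in> S" for z
  proof -
    obtain e g where e: "e > 0" and g: "integrable M g"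
      and fg: "\<And>w x. w \<in> ball z e \<inter> S \<Longrightarrow> x \<in> space M \<Longrightarrow> norm (f w x) \<le> g x"
      using bd[OF z] by blast
    obtain e2 where e2: "e2 > 0" "ball z e2 \<subseteq> S"
      using S z by (meson open_contains_ball)
    \<comment> \<open>The factor 3 leaves room for a disc of radius \<open>R\<close> about every
      point of \<open>ball z R\<close>, inside both \<open>ball z e\<close> and
      \<open>S\<close>.\<close>
    define R where "R = min e e2 / 3"
    have R: "R > 0" "3 * R \<le> e" "3 * R \<le> e2"
      using e e2 by (auto simp: R_def)
    have sub: "w \<in> ball z e \<inter> S" if "dist z w < 3 * R" for w
      using that R e2 by auto
    have int: "integrable M (f w)" if "dist z w < 3 * R" for w
      by (rule Bochner_Integration.integrable_bound[OF g])
         (use sub[OF that] meas fg in \<open>force intro!: AE_I2\<close>)+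
    have dbd: "norm (deriv (\<lambda>z. f z x) w) \<le> g x / R"
      if w: "w \<in> ball z R" and x: "x \<in> space M" for w x
    proof -
      have s: "cball w R \<subseteq> S"
      proof
        fix y assume "y \<in> cball w R"
        then have "dist z y < 3 * R"
          using w R(1) dist_triangle[of z y w] by (auto simp: dist_commute)
        then show "y \<in> S" using sub by blast
      qed
      have "norm ((deriv ^^ 1) (\<lambda>z. f z x) w) \<le> fact 1 * g x / R ^ 1"
      proof (rule Cauchy_inequality)
        show "(\<lambda>z. f z x) holomorphic_on ball w R"
          using hol[OF x] s by (meson ball_subset_cball holomorphic_on_subset subset_trans)
        show "continuous_on (cball w R) (\<lambda>z. f z x)"
          using hol[OF x] s holomorphic_on_imp_continuous_on holomorphic_on_subset by blast
        fix y assume y: "norm (w - y) = R"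
        have "dist z y < 3 * R"
          using w y R(1) dist_triangle[of z y w] by (auto simp: dist_norm)
        then show "norm (f y x) \<le> g x" using fg sub x by blast
      qed (use R in auto)
      then show ?thesis by simp
    qed
    have quot: "norm ((f w x - f z x) / (w - z)) \<le> g x / R"
      if w: "w \<in> ball z R" "w \<noteq> z" and x: "x \<in> space M" for w x
    proof -
      have "norm (f w x - f z x) \<le> g x / R * norm (w - z)"
      proof (rule field_differentiable_bound[of "ball z R" "\<lambda>z. f z x" "\<lambda>w. deriv (\<lambda>z. f z x) w"])
        fix y assume y: "y \<in> ball z R"
        have "dist z y < 3 * R" using y R(1) by simp
        then have "y \<in> S" using sub by blast
        then show "((\<lambda>z. f z x) has_field_derivative deriv (\<lambda>z. f z x) y) (at y within ball z R)"
          using hol[OF x] S has_field_derivative_at_within holomorphic_derivI by blast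
        show "norm (deriv (\<lambda>z. f z x) y) \<le> g x / R" by (rule dbd[OF y x])
      qed (use w R in auto)
      then show ?thesis using w by (simp add: norm_divide field_simps)
    qed
    have lim: "(\<lambda>i. (f (X i) x - f z x) / (X i - z)) \<longlonglongrightarrow> deriv (\<lambda>z. f z x) z"
      if X: "\<And>i. X i \<noteq> z" "X \<longlonglongrightarrow> z" and x: "x \<in> space M" for X :: "nat \<Rightarrow> complex" and x
    proof -
      have "((\<lambda>z. f z x) has_field_derivative deriv (\<lambda>z. f z x) z) (at z)"
        using hol[OF x] S z holomorphic_derivI by blast
      then have "((\<lambda>w. (f w x - f z x) / (w - z)) \<longlongrightarrow> deriv (\<lambda>z. f z x) z) (at z)"
        by (simp add: has_field_derivative_iff)
      then show ?thesis
        by (rule filterlim_compose) (use X in \<open>auto simp: filterlim_at\<close>)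
    qed
    have measq: "(\<lambda>x. (f w x - f z x) / (w - z)) \<in> borel_measurable M" if "dist z w < 3 * R" for w
      using int[OF that] int[of z] R by (intro borel_measurable_divide) auto
    \<comment> \<open>The derivative is measurable as a pointwise limit of difference quotients
      along z + R / (i + 1).\<close>
    have measd: "(\<lambda>x. deriv (\<lambda>z. f z x) z) \<in> borel_measurable M"
    proof (rule borel_measurable_LIMSEQ_metric)
      let ?X = "\<lambda>i. z + of_real (R / real (Suc i))"
      show "(\<lambda>i. (f (?X i) x - f z x) / (?X i - z)) \<longlonglongrightarrow> deriv (\<lambda>z. f z x) z"
        if "x \<in> space M" for x
      proof (rule lim[OF _ _ that])
        have "(\<lambda>i. z + of_real (R / real (Suc i))) \<longlonglongrightarrow> z + of_real 0"
          by (intro tendsto_intros LIMSEQ_Suc[OF lim_const_over_n])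
        then show "?X \<longlonglongrightarrow> z" by simp
      qed (use R in \<open>auto simp del: of_nat_Suc\<close>)
      fix i
      have "R / real (Suc i) \<le> R" using R(1) by (simp add: field_simps)
      moreover have "dist z (?X i) = R / real (Suc i)" using R(1) by (simp add: dist_norm norm_divide norm_mult del: of_nat_Suc)
      ultimately have "dist z (?X i) < 3 * R" using R(1) by linarith
      then show "(\<lambda>x. (f (?X i) x - f z x) / (?X i - z)) \<in> borel_measurable M" by (rule measq)
    qed
    have "((\<lambda>w. ((\<integral>x. f w x \<partial>M) - (\<integral>x. f z x \<partial>M)) / (w - z)) \<longlongrightarrow>
            (\<integral>x. deriv (\<lambda>z. f z x) z \<partial>M)) (at z)"
      unfolding tendsto_at_iff_sequentially
    proof (intro allI impI)
      fix X :: "nat \<Rightarrow> complex"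
      assume X: "\<forall>i. X i \<in> UNIV - {z}" and Xz: "X \<longlonglongrightarrow> z"
      have "eventually (\<lambda>i. dist (X i) z < R) sequentially"
        using Xz R(1) tendstoD by blast
      then obtain N where N: "\<And>i. i \<ge> N \<Longrightarrow> dist (X i) z < R"
        by (auto simp: eventually_sequentially)
      define Y where "Y i = X (i + N)" for i
      have Y: "Y i \<in> ball z R" "Y i \<noteq> z" "dist z (Y i) < 3 * R" for i
        using N[of "i + N"] X R(1) by (auto simp: Y_def dist_commute)
      have Yz: "Y \<longlonglongrightarrow> z" unfolding Y_def by (rule LIMSEQ_ignore_initial_segment[OF Xz])
      have "(\<lambda>i. \<integral>x. (f (Y i) x - f z x) / (Y i - z) \<partial>M) \<longlonglongrightarrow> (\<integral>x. deriv (\<lambda>z. f z x) z \<partial>M)"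
      proof (rule integral_dominated_convergence[where w = "\<lambda>x. g x / R"])
        show "integrable M (\<lambda>x. g x / R)" using g by simp
        show "AE x in M. (\<lambda>i. (f (Y i) x - f z x) / (Y i - z)) \<longlonglongrightarrow> deriv (\<lambda>z. f z x) z"
          by (intro AE_I2 lim Y Yz)
        show "AE x in M. norm ((f (Y i) x - f z x) / (Y i - z)) \<le> g x / R" for i
          by (intro AE_I2 quot Y)
      qed (use measd measq Y in auto)
      also have "(\<lambda>i. \<integral>x. (f (Y i) x - f z x) / (Y i - z) \<partial>M) =
                 (\<lambda>i. ((\<integral>x. f (Y i) x \<partial>M) - (\<integral>x. f z x \<partial>M)) / (Y i - z))"
        using int[OF Y(3)] int[of z] R(1) by simp
      finally show "((\<lambda>w. ((\<integral>x. f w x \<partial>M) - (\<integral>x. f z x \<partial>M)) / (w - z)) \<circ> X) \<longlonglongrightarrow>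
              (\<integral>x. deriv (\<lambda>z. f z x) z \<partial>M)"
        unfolding Y_def o_def by (rule LIMSEQ_offset)
    qed
    then show ?thesis by (auto simp: has_field_derivative_iff)
  qed
  then show ?thesis
    using S by (auto simp: holomorphic_on_open)
qed


section \<open>Exponential integrals and integrability on vertical lines\<close>

text \<open>Besides providing integrable majorants, these values later produce the terms 1/(s - 1)
  and 1/(2 s) in the continuation of zeta.\<close>

lemma exp_left_halfline:
  fixes a :: complex
  assumes a: "Re a > 0"
  shows "integrable lborel (\<lambda>u::real. indicator {..<0} u *\<^sub>R exp (a * of_real u))"
    and "(\<integral>u. indicator {..<0} u *\<^sub>R exp (a * of_real u) \<partial>lborel) = 1 / a"
proof -
  have ein: "einterval (-\<infinity>) 0 = {..<0}"
    by (auto simp: einterval_def zero_ereal_def)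
  have z: "0 = ereal 0" by simp
  have lim0: "((\<lambda>u. exp (c * u)) \<longlongrightarrow> 0) at_bot" if "c > 0" for c :: real
    using that by real_asymp
  \<comment> \<open>For a nonnegative integrand the fundamental theorem also yields integrability;
    the complex integrand is then dominated by this real one.\<close>
  have R: "set_integrable lborel (einterval (-\<infinity>) 0) (\<lambda>u. exp (Re a * u))"
  proof (rule interval_integral_FTC_nonneg(1)[where F = "\<lambda>u. exp (Re a * u) / Re a" and A = 0 and B = "1 / Re a"])
    show "(((\<lambda>u. exp (Re a * u) / Re a) \<circ> real_of_ereal) \<longlongrightarrow> 0) (at_right (-\<infinity>))"
      unfolding at_right_MInf filterlim_filtermap comp_def
      using tendsto_divide[OF lim0[OF a] tendsto_const[of "Re a"]] a by simp
    have "isCont (\<lambda>u. exp (Re a * u) / Re a) 0" using a by (intro continuous_intros) auto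
    then have "((\<lambda>u. exp (Re a * u) / Re a) \<longlongrightarrow> 1 / Re a) (at_left 0)"
      by (simp add: isCont_def filterlim_at_split)
    then show "(((\<lambda>u. exp (Re a * u) / Re a) \<circ> real_of_ereal) \<longlongrightarrow> 1 / Re a) (at_left 0)"
      unfolding z at_left_ereal filterlim_filtermap comp_def by simp
  qed (use a in \<open>auto intro!: derivative_eq_intros continuous_intros\<close>)
  have I: "set_integrable lborel (einterval (-\<infinity>) 0) (\<lambda>u. exp (a * of_real u))"
    unfolding set_integrable_def
    by (rule Bochner_Integration.integrable_bound[OF R[unfolded set_integrable_def]])
       (auto intro!: AE_I2 borel_measurable_continuous_onI continuous_intros borel_measurable_scaleR simp: norm_exp indicator_def)
  then show "integrable lborel (\<lambda>u::real. indicator {..<0} u *\<^sub>R exp (a * of_real u))"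
    by (simp add: ein set_integrable_def)
  have "(LBINT u=-\<infinity>..0. exp (a * of_real u)) = 1 / a - 0"
  proof (rule interval_integral_FTC_integrable[where F = "\<lambda>u. exp (a * of_real u) / a"])
    show "((\<lambda>u. exp (a * of_real u) / a) has_vector_derivative exp (a * of_real x)) (at x)" for x
      using a by (auto intro!: derivative_eq_intros has_vector_derivative_real_field)
    have "((\<lambda>u. norm (exp (a * of_real u) / a)) \<longlongrightarrow> 0) at_bot"
      using tendsto_divide[OF lim0[OF a] tendsto_const[of "norm a"]] a
      by (cases "a = 0") (auto simp: norm_divide norm_exp)
    then show "(((\<lambda>u. exp (a * of_real u) / a) \<circ> real_of_ereal) \<longlongrightarrow> 0) (at_right (-\<infinity>))"
      unfolding at_right_MInf filterlim_filtermap comp_def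
      using tendsto_norm_zero_cancel by simp
    have "isCont (\<lambda>u::real. exp (a * of_real u) / a) 0" using a by (intro continuous_intros) auto
    then have "((\<lambda>u::real. exp (a * of_real u) / a) \<longlongrightarrow> 1 / a) (at_left 0)"
      by (simp add: isCont_def filterlim_at_split)
    then show "(((\<lambda>u. exp (a * of_real u) / a) \<circ> real_of_ereal) \<longlongrightarrow> 1 / a) (at_left 0)"
      unfolding z at_left_ereal filterlim_filtermap comp_def by simp
  qed (use a I in \<open>auto intro!: continuous_intros\<close>)
  then show "(\<integral>u. indicator {..<0} u *\<^sub>R exp (a * of_real u) \<partial>lborel) = 1 / a"
    by (simp add: interval_lebesgue_integral_def ein set_lebesgue_integral_def)
qed

lemma exp_right_halfline:
  fixes a :: complex
  assumes a: "Re a > 0"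
  shows "integrable lborel (\<lambda>u::real. indicator {0..} u *\<^sub>R exp (- a * of_real u))"
    and "(\<integral>u. indicator {0..} u *\<^sub>R exp (- a * of_real u) \<partial>lborel) = 1 / a"
proof -
  \<comment> \<open>The reflection u -> -u carries \<open>{..<0}\<close> to \<open>{0<..}\<close>;
    the missing endpoint 0 is a null set.\<close>
  have eq: "AE u in lborel. indicator {..<0} (0 + (-1) * u) *\<^sub>R exp (a * of_real (0 + (-1) * u))
      = indicator {0..} u *\<^sub>R exp (- a * of_real u)"
    using AE_lborel_singleton[of "0::real"]
    by eventually_elim (auto simp: indicator_def)
  have m: "(\<lambda>u::real. indicator {0..} u *\<^sub>R exp (- a * of_real u)) \<in> borel_measurable lborel"
          "(\<lambda>u::real. indicator {..<0} (0 + (-1) * u) *\<^sub>R exp (a * of_real (0 + (-1) * u))) \<in> borel_measurable lborel"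
    by measurable
  have "integrable lborel (\<lambda>u. indicator {..<0} (0 + (-1) * u) *\<^sub>R exp (a * of_real (0 + (-1) * u)))"
    by (rule lborel_integrable_real_affine[OF exp_left_halfline(1)[OF a]]) simp
  then show "integrable lborel (\<lambda>u::real. indicator {0..} u *\<^sub>R exp (- a * of_real u))"
    using integrable_cong_AE[OF m(2,1) eq] by simp
  have "(\<integral>u. indicator {..<0} u *\<^sub>R exp (a * of_real u) \<partial>lborel) =
        (\<integral>u. indicator {..<0} (0 + (-1) * u) *\<^sub>R exp (a * of_real (0 + (-1) * u)) \<partial>lborel)"
    by (subst lborel_integral_real_affine[of "-1" _ 0]) auto
  also have "\<dots> = (\<integral>u. indicator {0..} u *\<^sub>R exp (- a * of_real u) \<partial>lborel)"
    by (rule integral_cong_AE[OF m(2,1) eq])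
  finally show "(\<integral>u. indicator {0..} u *\<^sub>R exp (- a * of_real u) \<partial>lborel) = 1 / a"
    using exp_left_halfline(2)[OF a] by simp
qed

lemma integrable_exp_minus_abs:
  fixes \<epsilon> :: real
  assumes "\<epsilon> > 0"
  shows "integrable lborel (\<lambda>t. exp (- \<epsilon> * \<bar>t\<bar>))"
proof -
  have "integrable lborel (\<lambda>t. norm (indicator {..<0} t *\<^sub>R exp (of_real \<epsilon> * complex_of_real t))
      + norm (indicator {0..} t *\<^sub>R exp (- of_real \<epsilon> * complex_of_real t)))"
    using assms by (intro Bochner_Integration.integrable_add integrable_norm exp_left_halfline(1) exp_right_halfline(1)) auto
  also have "(\<lambda>t. norm (indicator {..<0} t *\<^sub>R exp (of_real \<epsilon> * complex_of_real t))
      + norm (indicator {0..} t *\<^sub>R exp (- of_real \<epsilon> * complex_of_real t))) = (\<lambda>t. exp (- \<epsilon> * \<bar>t\<bar>))"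
    by (auto simp: fun_eq_iff indicator_def norm_exp)
  finally show ?thesis .
qed

lemma integrable_vertical_line:
  fixes f :: "complex \<Rightarrow> complex"
  assumes cont: "continuous_on {s. Re s = c} f" and eps: "\<epsilon> > 0"
    and bd: "\<And>t. \<bar>t\<bar> \<ge> T \<Longrightarrow> norm (f (Complex c t)) \<le> C * exp (- \<epsilon> * \<bar>t\<bar>)"
  shows "integrable lborel (\<lambda>t. f (Complex c t))"
proof -
  have cont': "continuous_on A (\<lambda>t. f (Complex c t))" for A
    by (rule continuous_on_compose2[OF cont])
       (auto simp: Complex_eq intro!: continuous_intros)
  have 1: "integrable lborel (\<lambda>t. indicator {-T..T} t *\<^sub>R f (Complex c t))"
    using borel_integrable_compact[of "{-T..T}" "\<lambda>t. f (Complex c t)"] cont' by auto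
  have 2: "integrable lborel (\<lambda>t. indicator (- {-T..T}) t *\<^sub>R f (Complex c t))"
  proof (rule Bochner_Integration.integrable_bound)
    show "integrable lborel (\<lambda>t. \<bar>C\<bar> * exp (- \<epsilon> * \<bar>t\<bar>))"
      using integrable_exp_minus_abs[OF eps] by simp
    show "(\<lambda>t. indicator (- {-T..T}) t *\<^sub>R f (Complex c t)) \<in> borel_measurable lborel"
      using borel_measurable_continuous_onI[OF cont'] by measurable
    have "C * exp (- \<epsilon> * \<bar>t\<bar>) \<le> \<bar>C\<bar> * exp (- \<epsilon> * \<bar>t\<bar>)" for t
      by (intro mult_right_mono) auto
    then show "AE t in lborel. norm (indicator (- {-T..T}) t *\<^sub>R f (Complex c t)) \<le> norm (\<bar>C\<bar> * exp (- \<epsilon> * \<bar>t\<bar>))"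
      using order_trans[OF bd] by (intro AE_I2) (auto simp: indicator_def abs_mult)
  qed
  have "integrable lborel (\<lambda>t. indicator {-T..T} t *\<^sub>R f (Complex c t) + indicator (- {-T..T}) t *\<^sub>R f (Complex c t))"
    using 1 2 by (rule Bochner_Integration.integrable_add)
  then show ?thesis
    by (rule Bochner_Integration.integrable_cong[THEN iffD1, rotated 2]) (auto simp: indicator_def)
qed

text \<open>Links the integrals over [-T, T] that come from finite rectangles with the Lebesgue
  integral over the whole line.\<close>

lemma tendsto_integral_symmetric:
  fixes f :: "real \<Rightarrow> complex"
  assumes "integrable lborel f"
  shows "((\<lambda>T. integral {-T..T} f) \<longlongrightarrow> (\<integral>t. f t \<partial>lborel)) at_top"
proof -
  have "((\<lambda>T. \<integral>t. indicator {-T..T} t *\<^sub>R f t \<partial>lborel) \<longlongrightarrow> (\<integral>t. f t \<partial>lborel)) at_top"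
  proof (rule integral_dominated_convergence_at_top[where w = "\<lambda>t. norm (f t)"])
    show "AE t in lborel. ((\<lambda>T. indicator {-T..T} t *\<^sub>R f t) \<longlongrightarrow> f t) at_top"
    proof (intro AE_I2 tendsto_eventually)
      fix t :: real
      show "\<forall>\<^sub>F T in at_top. indicator {-T..T} t *\<^sub>R f t = f t"
        using eventually_ge_at_top[of "\<bar>t\<bar>"] by eventually_elim (auto simp: indicator_def)
    qed
  qed (use assms in \<open>auto simp: indicator_def\<close>)
  also have "(\<lambda>T. \<integral>t. indicator {-T..T} t *\<^sub>R f t \<partial>lborel) = (\<lambda>T. integral {-T..T} f)"
  proof
    fix T :: real
    have "set_integrable lborel {-T..T} f"
      unfolding set_integrable_def by (rule integrable_mult_indicator) (use assms in auto)
    from set_borel_integral_eq_integral(2)[OF this]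
    show "(\<integral>t. indicator {-T..T} t *\<^sub>R f t \<partial>lborel) = integral {-T..T} f"
      by (simp add: set_lebesgue_integral_def)
  qed
  finally show ?thesis .
qed

text \<open>The residues are given as limits because all poles below are simple.\<close>

theorem vertical_line_shift:
  fixes f r :: "complex \<Rightarrow> complex" and a b a' b' \<epsilon> C B :: real
  assumes ab: "a' < a" "a < b" "b < b'"
    and P: "finite P" "\<And>p. p \<in> P \<Longrightarrow> a < Re p \<and> Re p < b"
    and hol: "f holomorphic_on {s. a' < Re s \<and> Re s < b'} - P"
    and res: "\<And>p. p \<in> P \<Longrightarrow> ((\<lambda>s. f s * (s - p)) \<longlongrightarrow> r p) (at p)"
    and eps: "\<epsilon> > 0"
    and bd: "\<And>s. a \<le> Re s \<Longrightarrow> Re s \<le> b \<Longrightarrow> \<bar>Im s\<bar> \<ge> B \<Longrightarrow> norm (f s) \<le> C * exp (- \<epsilon> * \<bar>Im s\<bar>)"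
  shows "integrable lborel (\<lambda>t. f (Complex a t))" "integrable lborel (\<lambda>t. f (Complex b t))"
    and "(\<integral>t. f (Complex b t) \<partial>lborel) = (\<integral>t. f (Complex a t) \<partial>lborel) + 2 * pi * (\<Sum>p\<in>P. r p)"
proof -
  define S where "S = {s. a' < Re s \<and> Re s < b'}"
  have S: "open S" "connected S"
  proof -
    have eq: "S = {s. a' < Re s} \<inter> {s. Re s < b'}" by (auto simp: S_def)
    show "open S" unfolding eq by (intro open_Int open_halfspace_Re_gt open_halfspace_Re_lt)
    have "convex S" unfolding eq by (intro convex_Int convex_halfspace_Re_gt convex_halfspace_Re_lt)
    then show "connected S" by (rule convex_connected)
  qed
  have contf: "continuous_on (S - P) f"
    using hol unfolding S_def by (rule holomorphic_on_imp_continuous_on)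
  have c: "continuous_on {s. Re s = a} f" "continuous_on {s. Re s = b} f"
    by (rule continuous_on_subset[OF contf]; use ab P in \<open>force simp: S_def\<close>)+
  show ia: "integrable lborel (\<lambda>t. f (Complex a t))"
    using bd[of "Complex a _"] ab by (intro integrable_vertical_line[OF c(1) eps, of B C]) auto
  show ib: "integrable lborel (\<lambda>t. f (Complex b t))"
    using bd[of "Complex b _"] ab by (intro integrable_vertical_line[OF c(2) eps, of B C]) auto
  \<comment> \<open>Deleting the other poles from \<open>S\<close> makes \<open>p\<close> the only
    singularity in an open set, so its residue can be read off the limit.\<close>
  have res': "residue f p = r p" if p: "p \<in> P" for p
  proof (rule residue_simple'[of "S - (P - {p})"])
    show "open (S - (P - {p}))" using S P(1) by (intro open_Diff finite_imp_closed) auto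
    show "p \<in> S - (P - {p})" using P(2)[OF p] ab by (auto simp: S_def)
    show "f holomorphic_on S - (P - {p}) - {p}"
      using hol p unfolding S_def by (rule_tac holomorphic_on_subset[OF hol]) auto
  qed (rule res[OF p])
  obtain T1 where T1: "\<And>p. p \<in> P \<Longrightarrow> \<bar>Im p\<bar> < T1"
  proof -
    have "bounded (Im ` P)" using P(1) by (intro finite_imp_bounded) auto
    then obtain B where "\<And>p. p \<in> P \<Longrightarrow> \<bar>Im p\<bar> \<le> B"
      by (auto simp: bounded_iff)
    then show ?thesis using that[of "B + 1"] by force
  qed
  \<comment> \<open>Beyond height \<open>T2\<close> there are no poles and the decay estimate holds,
    so rectangles of this height enclose all of \<open>P\<close>.\<close>
  define T2 where "T2 = Max {B, T1, 1}"
  have T2: "B \<le> T2" "T1 \<le> T2" "1 \<le> T2" by (auto simp: T2_def)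
  \<comment> \<open>\<open>H y\<close> is the horizontal edge at height \<open>y\<close>; the
    rectangle integral consists of the two vertical integrals and two such edges, which die
    out.\<close>
  define H where "H y = contour_integral (linepath (Complex a y) (Complex b y)) f" for y
  have rect: "\<i> * (integral {-T..T} (\<lambda>t. f (Complex b t)) - integral {-T..T} (\<lambda>t. f (Complex a t)))
      = 2 * pi * \<i> * (\<Sum>p\<in>P. r p) - (H (-T) - H T)" if T: "T \<ge> T2" for T
  proof -
    have T': "T > 0" "T \<ge> B" "T \<ge> T1" using T T2 by auto
    let ?a1 = "Complex a (-T)" and ?a2 = "Complex b (-T)" and ?a3 = "Complex b T" and ?a4 = "Complex a T"
    let ?R = "rectpath ?a1 ?a3"
    have pim: "path_image ?R \<subseteq> S - P"
    proof
      fix z assume z: "z \<in> path_image ?R"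
      have z': "z \<in> cbox ?a1 ?a3" "z \<notin> box ?a1 ?a3"
        using z path_image_rectpath_cbox_minus_box[of ?a1 ?a3] ab T' by auto
      have "z \<in> S" using z' ab by (auto simp: S_def in_cbox_complex_iff)
      moreover have "z \<notin> P"
      proof
        assume zP: "z \<in> P"
        then have "z \<in> box ?a1 ?a3" using P(2)[OF zP] T1[OF zP] T' by (auto simp: in_box_complex_iff)
        with z' show False by simp
      qed
      ultimately show "z \<in> S - P" by blast
    qed
    have "contour_integral ?R f = 2 * pi * \<i> * (\<Sum>p\<in>P. winding_number ?R p * residue f p)"
    proof (rule Residue_theorem[OF S P(1)])
      show "f holomorphic_on S - P" using hol by (simp add: S_def)
      show "\<forall>z. z \<notin> S \<longrightarrow> winding_number ?R z = 0"
      proof (intro allI impI)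
        fix z assume "z \<notin> S"
        then have "z \<notin> cbox ?a1 ?a3" using ab by (auto simp: S_def in_cbox_complex_iff)
        then show "winding_number ?R z = 0" using ab T' by (intro winding_number_rectpath_outside) auto
      qed
    qed (use pim in auto)
    also have "(\<Sum>p\<in>P. winding_number ?R p * residue f p) = (\<Sum>p\<in>P. r p)"
    proof (intro sum.cong refl)
      fix p assume p: "p \<in> P"
      have "p \<in> box ?a1 ?a3" using P(2)[OF p] T1[OF p] T' by (auto simp: in_box_complex_iff)
      then show "winding_number ?R p * residue f p = r p"
        by (simp add: winding_number_rectpath res'[OF p])
    qed
    finally have 1: "contour_integral ?R f = 2 * pi * \<i> * (\<Sum>p\<in>P. r p)" .
    have seg: "closed_segment ?a1 ?a2 \<subseteq> path_image ?R" "closed_segment ?a2 ?a3 \<subseteq> path_image ?R"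
              "closed_segment ?a3 ?a4 \<subseteq> path_image ?R" "closed_segment ?a4 ?a1 \<subseteq> path_image ?R"
      by (auto simp: rectpath_def Let_def path_image_join)
    have ci: "f contour_integrable_on linepath u v" if "closed_segment u v \<subseteq> path_image ?R" for u v
      by (rule contour_integrable_continuous_linepath)
         (use continuous_on_subset[OF contf] pim that in blast)
    have "contour_integral ?R f = contour_integral (linepath ?a1 ?a2) f + contour_integral (linepath ?a2 ?a3) f
       + contour_integral (linepath ?a3 ?a4) f + contour_integral (linepath ?a4 ?a1) f"
      unfolding rectpath_def Let_def complex.sel
      using ci[OF seg(1)] ci[OF seg(2)] ci[OF seg(3)] ci[OF seg(4)]
      by (simp add: contour_integrable_joinI)
    also have "contour_integral (linepath ?a3 ?a4) f = - contour_integral (linepath ?a4 ?a3) f"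
      using contour_integral_reversepath[of "linepath ?a4 ?a3" f] by simp
    also have "contour_integral (linepath ?a4 ?a1) f = - contour_integral (linepath ?a1 ?a4) f"
      using contour_integral_reversepath[of "linepath ?a1 ?a4" f] by simp
    also have "contour_integral (linepath ?a2 ?a3) f = \<i> * integral {-T..T} (\<lambda>t. f (Complex b t))"
      using T' by (intro contour_integral_linepath_same_Re) auto
    also have "contour_integral (linepath ?a1 ?a4) f = \<i> * integral {-T..T} (\<lambda>t. f (Complex a t))"
      using T' by (intro contour_integral_linepath_same_Re) auto
    finally show ?thesis using 1 by (simp add: H_def algebra_simps)
  qed
  have Hb: "norm (H y) \<le> \<bar>C\<bar> * (b - a) * exp (- \<epsilon> * \<bar>y\<bar>)" if y: "\<bar>y\<bar> \<ge> T2" for y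
  proof -
    have "norm (H y) \<le> (\<bar>C\<bar> * exp (- \<epsilon> * \<bar>y\<bar>)) * norm (Complex b y - Complex a y)"
      unfolding H_def
    proof (rule contour_integral_bound_linepath)
      have seg: "a \<le> Re w \<and> Re w \<le> b \<and> Im w = y" if "w \<in> closed_segment (Complex a y) (Complex b y)" for w
        using that ab by (simp add: closed_segment_same_Im closed_segment_eq_real_ivl)
      have "closed_segment (Complex a y) (Complex b y) \<subseteq> S - P"
      proof
        fix w assume w: "w \<in> closed_segment (Complex a y) (Complex b y)"
        show "w \<in> S - P" using seg[OF w] T1[of w] T2 y ab by (auto simp: S_def)
      qed
      then show "f contour_integrable_on linepath (Complex a y) (Complex b y)"
        by (intro contour_integrable_continuous_linepath continuous_on_subset[OF contf])
      fix w assume w: "w \<in> closed_segment (Complex a y) (Complex b y)"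
      have "norm (f w) \<le> C * exp (- \<epsilon> * \<bar>y\<bar>)" using bd[of w] seg[OF w] y T2 by auto
      also have "\<dots> \<le> \<bar>C\<bar> * exp (- \<epsilon> * \<bar>y\<bar>)" by (intro mult_right_mono) auto
      finally show "norm (f w) \<le> \<bar>C\<bar> * exp (- \<epsilon> * \<bar>y\<bar>)" .
    qed auto
    also have "norm (Complex b y - Complex a y) = b - a"
    proof -
      have "Complex b y - Complex a y = of_real (b - a)" by (simp add: complex_eq_iff)
      then show ?thesis using ab by (simp only: norm_of_real)
    qed
    finally show ?thesis by (simp add: mult_ac)
  qed
  have Hl: "((\<lambda>T. H (-T) - H T) \<longlongrightarrow> 0) at_top"
  proof (rule Lim_null_comparison)
    show "\<forall>\<^sub>F T in at_top. norm (H (-T) - H T) \<le> 2 * (\<bar>C\<bar> * (b - a) * exp (- \<epsilon> * T))"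
      using eventually_ge_at_top[of T2]
    proof eventually_elim
      case (elim T)
      then have "\<bar>-T\<bar> \<ge> T2" "\<bar>T\<bar> \<ge> T2" "\<bar>T\<bar> = T" using T2 by auto
      then show ?case using norm_triangle_ineq4[of "H (-T)" "H T"] Hb[of "-T"] Hb[of T] by simp
    qed
    have "((\<lambda>T. exp (- \<epsilon> * T)) \<longlongrightarrow> 0) at_top" using eps by real_asymp
    then show "((\<lambda>T. 2 * (\<bar>C\<bar> * (b - a) * exp (- \<epsilon> * T))) \<longlongrightarrow> 0) at_top"
      by (intro tendsto_mult_right_zero)
  qed
  have L1: "((\<lambda>T. \<i> * (integral {-T..T} (\<lambda>t. f (Complex b t)) - integral {-T..T} (\<lambda>t. f (Complex a t))))
      \<longlongrightarrow> 2 * pi * \<i> * (\<Sum>p\<in>P. r p) - 0) at_top"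
    by (rule Lim_transform_eventually[OF tendsto_diff[OF tendsto_const Hl]])
       (rule eventually_mono[OF eventually_ge_at_top[of T2]], rule rect[symmetric])
  have L2: "((\<lambda>T. \<i> * (integral {-T..T} (\<lambda>t. f (Complex b t)) - integral {-T..T} (\<lambda>t. f (Complex a t))))
      \<longlongrightarrow> \<i> * ((\<integral>t. f (Complex b t) \<partial>lborel) - (\<integral>t. f (Complex a t) \<partial>lborel))) at_top"
    by (intro tendsto_intros tendsto_integral_symmetric ia ib)
  have "\<i> * ((\<integral>t. f (Complex b t) \<partial>lborel) - (\<integral>t. f (Complex a t) \<partial>lborel)) = 2 * pi * \<i> * (\<Sum>p\<in>P. r p) - 0"
    by (rule tendsto_unique[OF _ L2 L1]) simp
  also have "\<dots> = \<i> * (2 * pi * (\<Sum>p\<in>P. r p))" by simp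
  finally show "(\<integral>t. f (Complex b t) \<partial>lborel) = (\<integral>t. f (Complex a t) \<partial>lborel) + 2 * pi * (\<Sum>p\<in>P. r p)"
    by (simp only: mult_cancel_left) (simp add: algebra_simps)
qed

section \<open>The Gamma function on vertical lines\<close>

text \<open>Euler's integral after the substitution t = exp u. Mellin transforms are taken in this
  logarithmic variable throughout, so all of them are Lebesgue integrals over the whole
  line.\<close>

lemma Gamma_exp_integral:
  assumes s: "Re s > 0"
  shows "integrable lborel (\<lambda>u. exp (s * of_real u - of_real (exp u)))"
    and "(\<integral>u. exp (s * of_real u - of_real (exp u)) \<partial>lborel) = Gamma s"
proof -
  let ?f = "\<lambda>t. complex_of_real t powr (s - 1) / of_real (exp t)"
  have rng: "exp ` (UNIV :: real set) = {0<..}" by (auto simp: image_iff intro: exp_ln[symmetric])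
  have eq: "\<bar>exp u\<bar> *\<^sub>R ?f (exp u) = exp (s * of_real u - of_real (exp u))" for u :: real
  proof -
    have "of_real (exp u) powr (s - 1) = exp ((s - 1) * of_real u)"
      by (simp add: powr_def Ln_of_real)
    then show ?thesis
      by (simp add: scaleR_conv_of_real exp_of_real exp_diff exp_add ring_distribs)
  qed
  have i: "?f absolutely_integrable_on {0<..}"
    by (rule absolutely_integrable_Gamma_integral'[OF s])
  have cv: "(UNIV :: real set) \<in> sets lebesgue"
    "\<And>x. x \<in> UNIV \<Longrightarrow> (exp has_field_derivative exp x) (at x within UNIV)" "inj_on exp (UNIV :: real set)"
    by (auto simp: inj_on_def)
  have "(\<lambda>u. \<bar>exp u\<bar> *\<^sub>R ?f (exp u)) absolutely_integrable_on UNIV"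
    using absolutely_integrable_change_of_variables_real[OF cv, of ?f] i by (simp add: rng)
  then have "integrable lebesgue (\<lambda>u. exp (s * of_real u - of_real (exp u)))"
    unfolding eq by (simp add: set_integrable_def)
  moreover have m: "(\<lambda>u. exp (s * of_real u - of_real (exp u))) \<in> borel_measurable lborel"
    by measurable
  ultimately show int: "integrable lborel (\<lambda>u. exp (s * of_real u - of_real (exp u)))"
    by (subst (asm) integrable_completion) auto
  have "integral UNIV (\<lambda>u. \<bar>exp u\<bar> *\<^sub>R ?f (exp u)) = integral (exp ` UNIV) ?f"
    using has_absolute_integral_change_of_variables_real[OF cv, of ?f "integral (exp ` UNIV) ?f"] i rng by simp
  also have "\<dots> = Gamma s"
    unfolding rng using Gamma_integral_complex'[OF s] by (rule integral_unique)
  finally show "(\<integral>u. exp (s * of_real u - of_real (exp u)) \<partial>lborel) = Gamma s"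
    unfolding eq using integral_lborel[OF int] by simp
qed

text \<open>Translating \<open>u\<close> by \<open>ln \<delta>\<close> absorbs the scale factor into
  the previous integral.\<close>

lemma Gamma_exp_integral_scaled_aux:
  assumes s: "Re s > 0" and d: "\<delta> > 0"
  shows "integrable lborel (\<lambda>u. exp (s * of_real u - of_real \<delta> * of_real (exp u)))"
    and "(\<integral>u. exp (s * of_real u - of_real \<delta> * of_real (exp u)) \<partial>lborel) = Gamma s * of_real \<delta> powr (- s)"
proof -
  have eq: "exp (s * of_real (ln \<delta> + 1 * u) - of_real (exp (ln \<delta> + 1 * u))) =
      of_real \<delta> powr s * exp (s * of_real u - of_real \<delta> * of_real (exp u))" for u
    using d by (simp add: powr_def Ln_of_real exp_add ring_distribs exp_diff exp_of_real)
  have nz: "of_real \<delta> powr s \<noteq> 0" using d by simp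
  have "integrable lborel (\<lambda>u. of_real \<delta> powr s * exp (s * of_real u - of_real \<delta> * of_real (exp u)))"
    using lborel_integrable_real_affine[OF Gamma_exp_integral(1)[OF s], of 1 "ln \<delta>"] by (simp only: eq)
  then show "integrable lborel (\<lambda>u. exp (s * of_real u - of_real \<delta> * of_real (exp u)))"
    using integrable_mult_right[of "inverse (of_real \<delta> powr s)" lborel "\<lambda>u. of_real \<delta> powr s * exp (s * of_real u - of_real \<delta> * of_real (exp u))"] nz
    by (simp only: mult.assoc[symmetric] left_inverse[OF nz] mult_1_left)
  have "Gamma s = of_real \<delta> powr s * (\<integral>u. exp (s * of_real u - of_real \<delta> * of_real (exp u)) \<partial>lborel)"
    unfolding Gamma_exp_integral(2)[OF s, symmetric]
    by (subst lborel_integral_real_affine[of 1 _ "ln \<delta>"]) (simp_all only: eq, simp_all)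
  then show "(\<integral>u. exp (s * of_real u - of_real \<delta> * of_real (exp u)) \<partial>lborel) = Gamma s * of_real \<delta> powr (- s)"
    using nz by (simp add: powr_minus field_simps)
qed

lemma Gamma_exp_integral_real:
  assumes s: "\<sigma> > 0" and d: "\<delta> > 0"
  shows "integrable lborel (\<lambda>u. exp (\<sigma> * u - \<delta> * exp u) :: real)"
    and "(\<integral>u. exp (\<sigma> * u - \<delta> * exp u) \<partial>lborel) = Gamma \<sigma> * \<delta> powr (- \<sigma>)"
proof -
  have eq: "exp (of_real \<sigma> * of_real u - of_real \<delta> * of_real (exp u)) = complex_of_real (exp (\<sigma> * u - \<delta> * exp u))" for u
    by (simp flip: exp_of_real)
  have i: "integrable lborel (\<lambda>u. complex_of_real (exp (\<sigma> * u - \<delta> * exp u)))"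
    using Gamma_exp_integral_scaled_aux(1)[of "of_real \<sigma>" \<delta>] s d by (simp only: eq) simp
  then show "integrable lborel (\<lambda>u. exp (\<sigma> * u - \<delta> * exp u) :: real)"
    using complex_of_real_integrable_eq by blast
  have "complex_of_real (\<integral>u. exp (\<sigma> * u - \<delta> * exp u) \<partial>lborel) = of_real (Gamma \<sigma> * \<delta> powr (- \<sigma>))"
    using Gamma_exp_integral_scaled_aux(2)[of "of_real \<sigma>" \<delta>] s d
    by (simp only: eq) (simp add: Gamma_complex_of_real powr_of_real flip: of_real_minus)
  then show "(\<integral>u. exp (\<sigma> * u - \<delta> * exp u) \<partial>lborel) = Gamma \<sigma> * \<delta> powr (- \<sigma>)"
    by (simp only: of_real_eq_iff)
qed

text \<open>For positive real \<open>a\<close> the formula is known; both sides are holomorphic in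
  \<open>a\<close> on the right half-plane, so the identity theorem extends it. Complex
  \<open>a\<close> is what permits rotating the path below.\<close>

lemma Gamma_exp_integral_complex:
  fixes a s :: complex
  assumes s: "Re s > 0" and a: "Re a > 0"
  shows "integrable lborel (\<lambda>u. exp (s * of_real u - a * of_real (exp u)))"
    and "(\<integral>u. exp (s * of_real u - a * of_real (exp u)) \<partial>lborel) = Gamma s * a powr (- s)"
proof -
  show "integrable lborel (\<lambda>u. exp (s * of_real u - a * of_real (exp u)))"
    by (rule Bochner_Integration.integrable_bound[OF Gamma_exp_integral_real(1)[OF s a]])
       (auto intro!: AE_I2 simp: norm_exp)
  let ?H = "{a :: complex. Re a > 0}"
  let ?F = "\<lambda>a. (\<integral>u. exp (s * of_real u - a * of_real (exp u)) \<partial>lborel) - Gamma s * a powr (- s)"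
  have "?F a = 0"
  proof (rule analytic_continuation[of ?F ?H "complex_of_real ` {0<..}" 1])
    show "?F holomorphic_on ?H"
    proof (intro holomorphic_intros holomorphic_integral)
      show "open ?H" by (rule open_halfspace_Re_gt)
      fix z assume z: "z \<in> ?H"
      show "\<exists>e>0. \<exists>g. integrable lborel g \<and> (\<forall>w\<in>ball z e \<inter> ?H. \<forall>u\<in>space lborel.
              norm (exp (s * of_real u - w * of_real (exp u))) \<le> g u)"
      proof (intro exI conjI ballI)
        \<comment> \<open>On a ball of this radius Re w >= Re z / 2, which gives one majorant for
          all \<open>w\<close>.\<close>
        show "Re z / 2 > 0" using z by simp
        show "integrable lborel (\<lambda>u. exp (Re s * u - (Re z / 2) * exp u))"
          using z by (intro Gamma_exp_integral_real s) auto
        fix w u assume w: "w \<in> ball z (Re z / 2) \<inter> ?H"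
        have "\<bar>Re (z - w)\<bar> \<le> norm (z - w)" by (rule abs_Re_le_cmod)
        also have "\<dots> < Re z / 2" using w by (simp add: dist_norm)
        finally have "Re z / 2 \<le> Re w" by (simp add: abs_if split: if_splits)
        then have "Re z / 2 * exp u \<le> Re w * exp u" by (intro mult_right_mono) auto
        then show "norm (exp (s * of_real u - w * of_real (exp u))) \<le> exp (Re s * u - (Re z / 2) * exp u)"
          by (simp add: norm_exp)
      qed
    qed (auto simp: complex_nonpos_Reals_iff)
    show "connected ?H" by (intro convex_connected convex_halfspace_Re_gt)
    show "(1 :: complex) islimpt complex_of_real ` {0<..}"
      unfolding islimpt_approachable
    proof (intro allI impI bexI conjI)
      fix e :: real assume "e > 0"
      then show "complex_of_real (1 + e / 2) \<in> complex_of_real ` {0<..}" by (intro imageI) auto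
      show "complex_of_real (1 + e / 2) \<noteq> 1" using \<open>e > 0\<close>
        by (metis add_cancel_left_right half_gt_zero_iff of_real_eq_1_iff order_less_irrefl)
      have "dist (complex_of_real (1 + e / 2)) 1 = \<bar>(1 + e/2) - 1\<bar>"
        by (metis dist_norm norm_of_real of_real_1 of_real_diff)
      then show "dist (complex_of_real (1 + e / 2)) 1 < e" using \<open>e > 0\<close> by simp
    qed
    fix z assume "z \<in> complex_of_real ` {0<..}"
    then show "?F z = 0" using Gamma_exp_integral_scaled_aux(2)[OF s] by auto
  qed (use a in \<open>auto intro: open_halfspace_Re_gt\<close>)
  then show "(\<integral>u. exp (s * of_real u - a * of_real (exp u)) \<partial>lborel) = Gamma s * a powr (- s)" by simp
qed

text \<open>Rotating the path of integration by an angle \<open>\<theta>\<close> of the sign of \<open>Im s\<close> makes the exponential decay visible.\<close>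

lemma norm_Gamma_le:
  assumes s: "Re s > 0" and th: "0 \<le> \<theta>" "\<theta> < pi / 2"
  shows "norm (Gamma s) \<le> Gamma (Re s) * cos \<theta> powr (- Re s) * exp (- \<theta> * \<bar>Im s\<bar>)"
proof -
  define \<phi> where "\<phi> = (if Im s \<ge> 0 then \<theta> else - \<theta>)"
  have phi: "\<phi> * Im s = \<theta> * \<bar>Im s\<bar>" "cos \<phi> = cos \<theta>" "- pi < \<phi>" "\<phi> \<le> pi" by (auto simp: \<phi>_def) (use th in linarith)+
  have c: "cos \<theta> > 0" using th by (intro cos_gt_zero_pi) auto
  let ?a = "cis \<phi>"
  have a: "Re ?a > 0" using phi c by simp
  have Lna: "Ln ?a = \<i> * of_real \<phi>" using phi by (simp add: cis_conv_exp)
  have na: "norm (?a powr (- s)) = exp (\<theta> * \<bar>Im s\<bar>)"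
    using phi by (simp add: powr_def norm_exp Lna mult.commute)
  have "norm (Gamma s * ?a powr (- s)) \<le> (\<integral>u. norm (exp (s * of_real u - ?a * of_real (exp u))) \<partial>lborel)"
    unfolding Gamma_exp_integral_complex(2)[OF s a, symmetric] by (rule integral_norm_bound)
  also have "\<dots> = (\<integral>u. exp (Re s * u - cos \<theta> * exp u) \<partial>lborel)"
    by (simp add: norm_exp phi)
  also have "\<dots> = Gamma (Re s) * cos \<theta> powr (- Re s)"
    by (rule Gamma_exp_integral_real(2)[OF s c])
  finally have "norm (Gamma s) * exp (\<theta> * \<bar>Im s\<bar>) \<le> Gamma (Re s) * cos \<theta> powr (- Re s)"
    by (simp only: norm_mult na)
  then show ?thesis by (simp add: exp_minus field_simps)
qed

text \<open>The recurrence moves \<open>s\<close> to Re s >= 1, where the rotated integral applies;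
  each factor s + j has modulus at least |Im s| >= 1, so undoing the shift only helps. The rate pi/2
  itself is out of reach of this bound, because cos \<theta> tends to 0 as \<theta> approaches
  pi/2.\<close>

lemma Gamma_decay:
  fixes a b \<epsilon> :: real
  assumes e: "\<epsilon> > 0"
  shows "\<exists>C\<ge>0. \<forall>s. a \<le> Re s \<and> Re s \<le> b \<and> 1 \<le> \<bar>Im s\<bar> \<longrightarrow> norm (Gamma s) \<le> C * exp (- (pi / 2 - \<epsilon>) * \<bar>Im s\<bar>)"
proof -
  \<comment> \<open>The maximum with 0 covers large \<open>\<epsilon>\<close>, for which the claimed
    rate is not positive.\<close>
  define \<theta> where "\<theta> = max 0 (pi / 2 - \<epsilon>)"
  have th: "0 \<le> \<theta>" "\<theta> < pi / 2" "pi / 2 - \<epsilon> \<le> \<theta>" using e pi_gt_zero by (auto simp: \<theta>_def max_def)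
  have c: "cos \<theta> > 0" using th by (intro cos_gt_zero_pi) auto
  define N where "N = nat \<lceil>1 - a\<rceil>"
  have N: "a + real N \<ge> 1" unfolding N_def by linarith
  have cont: "continuous_on {a + real N..b + real N} (\<lambda>\<sigma>. Gamma \<sigma> * cos \<theta> powr (- \<sigma>) :: real)"
  proof (intro continuous_intros continuous_on_Gamma)
    show "{a + real N..b + real N} \<inter> \<int>\<^sub>\<le>\<^sub>0 = {}"
      using N by (auto elim!: nonpos_Ints_cases')
  qed (use c in auto)
  obtain C where C: "\<And>\<sigma>. \<sigma> \<in> {a + real N..b + real N} \<Longrightarrow> \<bar>Gamma \<sigma> * cos \<theta> powr (- \<sigma>)\<bar> \<le> C"
  proof -
    have "bounded ((\<lambda>\<sigma>. Gamma \<sigma> * cos \<theta> powr (- \<sigma>) :: real) ` {a + real N..b + real N})"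
      by (intro compact_imp_bounded compact_continuous_image cont) auto
    then obtain B where "\<forall>\<sigma>\<in>{a + real N..b + real N}. \<bar>Gamma \<sigma> * cos \<theta> powr (- \<sigma>)\<bar> \<le> B"
      by (auto simp: bounded_iff)
    then show ?thesis using that[of B] by blast
  qed
  show ?thesis
  proof (intro exI[of _ "\<bar>C\<bar>"] conjI allI impI)
    fix s assume s: "a \<le> Re s \<and> Re s \<le> b \<and> 1 \<le> \<bar>Im s\<bar>"
    have nz: "s \<notin> \<int>\<^sub>\<le>\<^sub>0" using s by (auto elim!: nonpos_Ints_cases')
    have "pochhammer s N = Gamma (s + of_nat N) / Gamma s" by (rule pochhammer_Gamma[OF nz])
    then have G: "Gamma s * pochhammer s N = Gamma (s + of_nat N)"
      using Gamma_eq_zero_iff[of s] nz by (simp add: field_simps)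
    have "1 = (\<Prod>j<N. 1 :: real)" by simp
    also have "\<dots> \<le> (\<Prod>j<N. norm (s + of_nat j))"
    proof (intro prod_mono conjI)
      fix j
      have "1 \<le> \<bar>Im (s + of_nat j)\<bar>" using s by simp
      also have "\<dots> \<le> norm (s + of_nat j)" by (rule abs_Im_le_cmod)
      finally show "1 \<le> norm (s + of_nat j)" .
    qed auto
    also have "\<dots> = norm (pochhammer s N)" by (simp add: pochhammer_prod prod_norm atLeast0LessThan)
    finally have "norm (Gamma s) * 1 \<le> norm (Gamma s) * norm (pochhammer s N)" by (intro mult_left_mono) auto
    also have "\<dots> = norm (Gamma (s + of_nat N))" by (simp flip: G add: norm_mult)
    also have "\<dots> \<le> Gamma (Re (s + of_nat N)) * cos \<theta> powr (- Re (s + of_nat N)) * exp (- \<theta> * \<bar>Im (s + of_nat N)\<bar>)"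
      using N s th by (intro norm_Gamma_le) auto
    also have "\<dots> \<le> C * exp (- \<theta> * \<bar>Im s\<bar>)"
      using C[of "Re (s + of_nat N)"] s by (simp add: abs_le_iff)
    also have "\<dots> \<le> \<bar>C\<bar> * exp (- (pi / 2 - \<epsilon>) * \<bar>Im s\<bar>)"
    proof (intro mult_mono)
      show "exp (- \<theta> * \<bar>Im s\<bar>) \<le> exp (- (pi / 2 - \<epsilon>) * \<bar>Im s\<bar>)"
        using th(3) mult_right_mono[OF th(3), of "\<bar>Im s\<bar>"] by (simp add: algebra_simps)
    qed auto
    finally show "norm (Gamma s) \<le> \<bar>C\<bar> * exp (- (pi / 2 - \<epsilon>) * \<bar>Im s\<bar>)" by simp
  qed auto
qed

section \<open>Mellin inversion of the exponential function\<close>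

text \<open>Each use of the recurrence divides by a number of modulus at least N + 1/2.
  Half-integral abscissae keep the lines between the poles, and the Pochhammer symbol in the
  denominator outgrows every power y^N in the next proof.\<close>

lemma norm_Gamma_half_minus_nat:
  "norm (Gamma (Complex (1/2 - real N) t)) \<le> norm (Gamma (Complex (1/2) t)) / pochhammer (1/2) N"
proof (induction N)
  case (Suc N)
  let ?z = "Complex (1/2 - real (Suc N)) t"
  have nz: "?z \<notin> \<int>\<^sub>\<le>\<^sub>0"
  proof
    assume "?z \<in> \<int>\<^sub>\<le>\<^sub>0"
    then obtain n where "?z = - of_nat n" by (elim nonpos_Ints_cases')
    then have "1/2 - real (Suc N) = - real n" by (simp add: complex_eq_iff)
    then have "1 = 2 * real (Suc N) - 2 * real n" by simp
    then have "(1::int) = 2 * int (Suc N) - 2 * int n" by linarith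
    then show False by presburger
  qed
  have "Gamma (?z + 1) = ?z * Gamma ?z" by (rule Gamma_plus1[OF nz])
  also have "?z + 1 = Complex (1/2 - real N) t" by (simp add: complex_eq_iff)
  finally have "norm ?z * norm (Gamma ?z) = norm (Gamma (Complex (1/2 - real N) t))" by (simp add: norm_mult)
  moreover have "(1/2 + real N) * norm (Gamma ?z) \<le> norm ?z * norm (Gamma ?z)"
    using abs_Re_le_cmod[of ?z] by (intro mult_right_mono) auto
  ultimately have "(1/2 + real N) * norm (Gamma ?z) \<le> norm (Gamma (Complex (1/2) t)) / pochhammer (1/2) N"
    using Suc by linarith
  then have "norm (Gamma ?z) \<le> norm (Gamma (Complex (1/2) t)) / pochhammer (1/2) N / (1/2 + real N)"
    by (subst pos_le_divide_eq) (auto simp: mult.commute)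
  then show ?case by (simp add: pochhammer_Suc)
qed simp

text \<open>The residue of Gamma at -m is (-1)^m / m!, so pushing the line past the poles 0, ..., -N
  collects a partial sum of the exponential series, while the integral over Re s = 1/2 - (N + 1)
  tends to 0.\<close>

lemma Mellin_inversion_exp:
  fixes c y :: real
  assumes c: "c > 0" and y: "y > 0"
  defines "f \<equiv> (\<lambda>s. Gamma s * exp (- s * of_real (ln y)))"
  shows "integrable lborel (\<lambda>t. f (Complex c t))"
    and "(\<integral>t. f (Complex c t) \<partial>lborel) = 2 * pi * exp (- y)"
proof -
  \<comment> \<open>Residues have to be a function of the pole, so m is recovered from p = -m by the
    floor.\<close>
  define r :: "complex \<Rightarrow> complex" where "r p = (let m = nat \<lfloor>- Re p\<rfloor> in (- of_real y) ^ m / fact m)" for p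
  have shift: "integrable lborel (\<lambda>t. f (Complex (1/2 - real (Suc N)) t)) \<and> integrable lborel (\<lambda>t. f (Complex c t)) \<and>
     (\<integral>t. f (Complex c t) \<partial>lborel) = (\<integral>t. f (Complex (1/2 - real (Suc N)) t) \<partial>lborel)
        + 2 * pi * (\<Sum>p\<in>(\<lambda>m. - of_nat m) ` {..<Suc N}. r p)" for N
  proof -
    let ?a = "1/2 - real (Suc N)" and ?P = "(\<lambda>m. - of_nat m :: complex) ` {..<Suc N}"
    obtain C where C: "C \<ge> 0" "\<And>s. ?a \<le> Re s \<Longrightarrow> Re s \<le> c \<Longrightarrow> 1 \<le> \<bar>Im s\<bar> \<Longrightarrow>
        norm (Gamma s) \<le> C * exp (- (pi / 2 - 1) * \<bar>Im s\<bar>)"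
      using Gamma_decay[of 1 ?a c] by auto
    \<comment> \<open>The left margin 1/4 - (N + 1) still lies to the right of -(N + 1), so the
      strip contains exactly the poles 0, ..., -N.\<close>
    have 1: "1/4 - real (Suc N) < ?a" "?a < c" "c < c + 1" using c by auto
    have hol: "f holomorphic_on {s. 1/4 - real (Suc N) < Re s \<and> Re s < c + 1} - ?P"
    proof -
      have "z \<notin> \<int>\<^sub>\<le>\<^sub>0" if z: "z \<in> {s. 1/4 - real (Suc N) < Re s \<and> Re s < c + 1} - ?P" for z
      proof
        assume "z \<in> \<int>\<^sub>\<le>\<^sub>0"
        then obtain n where n: "z = - of_nat n" by (elim nonpos_Ints_cases')
        then have "n < Suc N" using z by simp
        then show False using n z by auto
      qed
      then have "({s. 1/4 - real (Suc N) < Re s \<and> Re s < c + 1} - ?P) \<inter> \<int>\<^sub>\<le>\<^sub>0 = {}" by blast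
      then show ?thesis
        unfolding f_def by (intro holomorphic_on_mult holomorphic_Gamma) (assumption | intro holomorphic_intros)+
    qed
    have res: "((\<lambda>s. f s * (s - p)) \<longlongrightarrow> r p) (at p)" if p: "p \<in> ?P" for p
    proof -
      obtain m where m: "p = - of_nat m" using p by blast
      have "((\<lambda>s. Gamma s * (s + of_nat m) * exp (- s * of_real (ln y))) \<longlongrightarrow>
          (-1) ^ m / fact m * exp (- (- of_nat m) * of_real (ln y))) (at (- of_nat m))"
        by (intro tendsto_intros Gamma_residues)
      also have "exp (- (- of_nat m) * complex_of_real (ln y)) = of_real y ^ m"
        using y by (simp add: exp_of_nat_mult exp_of_real)
      also have "(-1) ^ m / fact m * of_real y ^ m = r p"
        by (simp add: r_def m power_minus[of "of_real y"])
      finally show ?thesis by (simp add: m f_def mult_ac)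
    qed
    have bd: "norm (f s) \<le> (C * exp (\<bar>ln y\<bar> * (real (Suc N) + c))) * exp (- (pi / 2 - 1) * \<bar>Im s\<bar>)"
      if s: "?a \<le> Re s" "Re s \<le> c" "1 \<le> \<bar>Im s\<bar>" for s
    proof -
      have "norm (f s) = norm (Gamma s) * exp (- (Re s * ln y))" by (simp add: f_def norm_mult norm_exp)
      also have "\<dots> \<le> (C * exp (- (pi / 2 - 1) * \<bar>Im s\<bar>)) * exp (\<bar>ln y\<bar> * (real (Suc N) + c))"
      proof (intro mult_mono C(2) s)
        have "- (Re s * ln y) \<le> \<bar>Re s\<bar> * \<bar>ln y\<bar>" by (metis abs_ge_minus_self abs_mult)
        also have "\<dots> \<le> (real (Suc N) + c) * \<bar>ln y\<bar>" using s c by (intro mult_right_mono) auto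
        finally show "exp (- (Re s * ln y)) \<le> exp (\<bar>ln y\<bar> * (real (Suc N) + c))" by (simp add: mult.commute)
      qed (use C(1) in auto)
      finally show ?thesis by (simp add: mult_ac)
    qed
    have "?a < Re p \<and> Re p < c" if "p \<in> ?P" for p
      using that c by (auto simp: less_Suc_eq_le)
    from vertical_line_shift[OF 1 _ this hol res _ bd] show ?thesis using pi_gt3 by auto
  qed
  show "integrable lborel (\<lambda>t. f (Complex c t))" using shift by blast
  have rsum: "(\<Sum>p\<in>(\<lambda>m. - of_nat m) ` {..<N}. r p) = (\<Sum>m<N. (- of_real y) ^ m / fact m)" for N
    by (subst sum.reindex) (auto simp: inj_on_def r_def)
  have "(\<lambda>N. \<integral>t. f (Complex (1/2 - real (Suc N)) t) \<partial>lborel) \<longlonglongrightarrow> 0"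
  proof (rule Lim_null_comparison)
    let ?K = "\<integral>t. norm (Gamma (Complex (1/2) t)) \<partial>lborel"
    have iG: "integrable lborel (\<lambda>t. Gamma (Complex (1/2) t))"
    proof -
      obtain C where C: "C \<ge> 0" "\<And>s. 1/2 \<le> Re s \<Longrightarrow> Re s \<le> 1/2 \<Longrightarrow> 1 \<le> \<bar>Im s\<bar> \<Longrightarrow>
        norm (Gamma s) \<le> C * exp (- (pi / 2 - 1) * \<bar>Im s\<bar>)"
        using Gamma_decay[of 1 "1/2" "1/2"] by auto
      show ?thesis
      proof (rule integrable_vertical_line)
        show "continuous_on {s. Re s = 1/2} (Gamma :: complex \<Rightarrow> complex)"
          by (intro continuous_on_Gamma) (auto elim!: nonpos_Ints_cases')
        show "pi / 2 - 1 > 0" using pi_gt3 by simp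
        show "norm (Gamma (Complex (1/2) t)) \<le> C * exp (- (pi / 2 - 1) * \<bar>t\<bar>)" if "1 \<le> \<bar>t\<bar>" for t
          using C(2)[of "Complex (1/2) t"] that by simp
      qed
    qed
    \<comment> \<open>On this line |y^(-s)| is y^(N+1) / sqrt y, so the integral is controlled by a
      term of a convergent series.\<close>
    have nf: "norm (f (Complex (1/2 - real (Suc N)) t)) \<le> norm (Gamma (Complex (1/2) t)) * (y powr (-1/2) * (y ^ Suc N / pochhammer (1/2) (Suc N)))" for N t
    proof -
      have "exp (- ((1/2 - real (Suc N)) * ln y)) = y powr (- (1/2) + real (Suc N))"
        using y by (simp add: powr_def algebra_simps)
      also have "\<dots> = y powr (-1/2) * y ^ Suc N" by (simp only: powr_add powr_realpow[OF y] minus_divide_left)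
      finally have "norm (f (Complex (1/2 - real (Suc N)) t)) = norm (Gamma (Complex (1/2 - real (Suc N)) t)) * (y powr (-1/2) * y ^ Suc N)"
        by (simp add: f_def norm_mult norm_exp del: of_nat_Suc power_Suc)
      also have "\<dots> \<le> (norm (Gamma (Complex (1/2) t)) / pochhammer (1/2) (Suc N)) * (y powr (-1/2) * y ^ Suc N)"
        using y by (intro mult_right_mono norm_Gamma_half_minus_nat) auto
      finally show ?thesis by simp
    qed
    show "\<forall>\<^sub>F N in sequentially. norm (\<integral>t. f (Complex (1/2 - real (Suc N)) t) \<partial>lborel) \<le>
            ?K * (y powr (-1/2) * (y ^ Suc N / pochhammer (1/2) (Suc N)))"
    proof (intro always_eventually allI)
      fix N
      have "norm (\<integral>t. f (Complex (1/2 - real (Suc N)) t) \<partial>lborel) \<le> (\<integral>t. norm (f (Complex (1/2 - real (Suc N)) t)) \<partial>lborel)"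
        by (rule integral_norm_bound)
      also have "\<dots> \<le> (\<integral>t. norm (Gamma (Complex (1/2) t)) * (y powr (-1/2) * (y ^ Suc N / pochhammer (1/2) (Suc N))) \<partial>lborel)"
        using shift[of N] nf by (intro integral_mono integrable_norm integrable_mult_left iG) auto
      finally show "norm (\<integral>t. f (Complex (1/2 - real (Suc N)) t) \<partial>lborel) \<le>
            ?K * (y powr (-1/2) * (y ^ Suc N / pochhammer (1/2) (Suc N)))" by simp
    qed
    \<comment> \<open>Successive terms have ratio y / (n + 1/2), which is at most 1/2 once n >= 2
      y.\<close>
    have "summable (\<lambda>N. y ^ N / pochhammer (1/2) N :: real)"
    proof (rule summable_ratio_test[of "1/2" "nat \<lceil>2 * y\<rceil>"])
      fix n assume "nat \<lceil>2 * y\<rceil> \<le> n"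
      then have "2 * y \<le> real n" by linarith
      then have "y / (1/2 + real n) \<le> 1/2" by (simp add: field_simps)
      then have "(y ^ n / pochhammer (1/2) n) * (y / (1/2 + real n)) \<le> (y ^ n / pochhammer (1/2) n) * (1/2)"
        using y by (intro mult_left_mono) (auto intro!: divide_nonneg_nonneg pochhammer_nonneg)
      moreover have "pochhammer (1/2) n > (0::real)" by (intro pochhammer_pos) auto
      ultimately show "norm (y ^ Suc n / pochhammer (1/2) (Suc n)) \<le> 1/2 * norm (y ^ n / pochhammer (1/2) n)"
        using y by (simp add: pochhammer_Suc abs_mult mult_ac)
    qed auto
    then have "(\<lambda>N. y ^ N / pochhammer (1/2) N :: real) \<longlonglongrightarrow> 0" by (rule summable_LIMSEQ_zero)
    then have "(\<lambda>N. y ^ Suc N / pochhammer (1/2) (Suc N) :: real) \<longlonglongrightarrow> 0" by (rule LIMSEQ_Suc)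
    then show "(\<lambda>N. ?K * (y powr (-1/2) * (y ^ Suc N / pochhammer (1/2) (Suc N)))) \<longlonglongrightarrow> 0"
      by (intro tendsto_mult_right_zero)
  qed
  moreover have "(\<lambda>N. \<Sum>m<Suc N. (- complex_of_real y) ^ m / fact m) \<longlonglongrightarrow> exp (- of_real y)"
    using exp_converges[of "- complex_of_real y"]
    by (intro LIMSEQ_Suc) (simp add: sums_def scaleR_conv_of_real divide_inverse mult.commute)
  ultimately have "(\<lambda>N. (\<integral>t. f (Complex (1/2 - real (Suc N)) t) \<partial>lborel) + 2 * pi * (\<Sum>m<Suc N. (- complex_of_real y) ^ m / fact m))
      \<longlonglongrightarrow> 0 + 2 * pi * exp (- complex_of_real y)"
    by (intro tendsto_intros)
  moreover have "(\<lambda>N. (\<integral>t. f (Complex (1/2 - real (Suc N)) t) \<partial>lborel) + 2 * pi * (\<Sum>m<Suc N. (- complex_of_real y) ^ m / fact m))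
      = (\<lambda>N. \<integral>t. f (Complex c t) \<partial>lborel)"
    using shift by (simp only: rsum)
  ultimately show "(\<integral>t. f (Complex c t) \<partial>lborel) = 2 * pi * exp (- y)"
    by (simp add: LIMSEQ_const_iff flip: exp_of_real)
qed

section \<open>Gauss multiplication for the Gamma function\<close>

text \<open>The quotient (X^k - 1)/(X - 1) takes the value k at 1, and it is the product of X - z
  over the roots of unity z other than 1; the moduli |1 - z| are the factors 2 sin (pi j / k). This
  supplies the constant in the multiplication formula.\<close>

lemma prod_sin_pi_over_nat:
  assumes k: "k > 0"
  shows "(\<Prod>j=1..<k. 2 * sin (pi * real j / real k)) = real k"
proof -
  let ?p = "monom 1 k - 1 :: complex poly"
  have pz: "poly ?p z = 0 \<longleftrightarrow> z ^ k = 1" for z by (simp add: poly_monom)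
  have deg: "degree ?p = k"
    using k by (subst degree_add_eq_left[of "- 1" "monom 1 k", simplified]) (auto simp: degree_monom_eq)
  have lc: "lead_coeff ?p = 1" using k unfolding deg by simp
  \<comment> \<open>All roots are simple, so the factorisation runs over the set of roots without
    multiplicities.\<close>
  have sq: "rsquarefree ?p"
    unfolding rsquarefree_roots
  proof (intro allI notI)
    fix a assume a: "poly ?p a = 0 \<and> poly (pderiv ?p) a = 0"
    then have "a ^ k = 1" "a = 0"
      using k by (auto simp: pz pderiv_diff pderiv_monom poly_monom)
    then show False using k by (simp add: power_0_left)
  qed
  let ?R = "{z :: complex. z ^ k = 1}"
  have fin: "finite ?R" using k by (intro finite_roots_unity) auto
  have "?p = (\<Prod>z\<in>?R. [:- z, 1:])"
    using complex_poly_decompose_rsquarefree[OF sq] unfolding lc pz smult_1_left by (rule sym)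
  also have "\<dots> = [:-1, 1:] * (\<Prod>z\<in>?R - {1}. [:- z, 1:])"
    using fin by (subst prod.remove[of _ 1]) auto
  finally have 1: "?p = [:-1, 1:] * (\<Prod>z\<in>?R - {1}. [:- z, 1:])" .
  have "?p = [:-1, 1:] * (\<Sum>i<k. monom 1 i)"
  proof (rule poly_ext)
    fix x :: complex
    show "poly ?p x = poly ([:-1, 1:] * (\<Sum>i<k. monom 1 i)) x"
      using power_diff_1_eq[of x k] by (simp add: poly_monom poly_sum algebra_simps)
  qed
  with 1 have "[:-1, 1:] * (\<Sum>i<k. monom 1 i) = [:-1, 1:] * (\<Prod>z\<in>?R - {1}. [:- z, 1:])" by simp
  then have "(\<Sum>i<k. monom 1 i) = (\<Prod>z\<in>?R - {1}. [:- z, 1 :: complex:])"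
    by (subst (asm) mult_cancel_left) auto
  then have "poly (\<Sum>i<k. monom 1 i) 1 = poly (\<Prod>z\<in>?R - {1}. [:- z, 1 :: complex:]) 1" by simp
  then have "of_nat k = (\<Prod>z\<in>?R - {1}. 1 - z)"
    by (simp add: poly_sum poly_monom poly_prod)
  then have 2: "real k = (\<Prod>z\<in>?R - {1}. norm (1 - z))"
    using arg_cong[of _ _ norm] by (simp only: prod_norm[symmetric] norm_of_nat[symmetric, where 'a=complex])
  let ?c = "\<lambda>j. cis (2 * pi * real j / real k)"
  have bij: "bij_betw ?c {..<k} ?R" by (rule Complex.bij_betw_roots_unity[OF k])
  have "bij_betw ?c ({..<k} - {0}) (?R - {?c 0})"
    by (rule bij_betw_DiffI[OF bij]) (use k in auto)
  moreover have "{..<k} - {0} = {1..<k}" "?c 0 = 1" by auto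
  ultimately have bij': "bij_betw ?c {1..<k} (?R - {1})" by (simp only:)
  have "real k = (\<Prod>j=1..<k. norm (1 - ?c j))"
    by (rule trans[OF 2 prod.reindex_bij_betw[OF bij', of "\<lambda>z. norm (1 - z)", symmetric]])
  also have "\<dots> = (\<Prod>j=1..<k. 2 * sin (pi * real j / real k))"
  proof (intro prod.cong refl)
    fix j assume j: "j \<in> {1..<k}"
    define x where "x = pi * real j / real k"
    have x: "0 < x" "x < pi" using j by (auto simp: x_def field_simps)
    have "1 - cis (2 * x) = - 2 * \<i> * of_real (sin x) * cis x"
      by (simp add: complex_eq_iff sin_double cos_double_sin power2_eq_square)
    then have "norm (1 - cis (2 * x)) = 2 * sin x"
      using sin_gt_zero[OF x] by (simp add: norm_mult)
    then show "norm (1 - ?c j) = 2 * sin (pi * real j / real k)" by (simp add: x_def mult.assoc)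
  qed
  finally show ?thesis ..
qed

text \<open>The numbers k z, k z + 1, ..., k z + k n - 1 split into residue classes modulo k, one
  for each j.\<close>

lemma prod_pochhammer_multiplication:
  fixes z :: complex
  assumes k: "k > 0"
  shows "(\<Prod>j<k. pochhammer (z + of_nat j / of_nat k) n) = pochhammer (of_nat k * z) (k * n) / of_nat k ^ (k * n)"
proof (induction n)
  case (Suc n)
  have "(\<Prod>j<k. pochhammer (z + of_nat j / of_nat k) (Suc n)) =
      pochhammer (of_nat k * z) (k * n) / of_nat k ^ (k * n) * (\<Prod>j<k. z + of_nat j / of_nat k + of_nat n)"
    by (simp add: pochhammer_Suc prod.distrib Suc)
  also have "(\<Prod>j<k. z + of_nat j / of_nat k + of_nat n) = (\<Prod>j<k. (of_nat k * z + of_nat (k * n) + of_nat j) / of_nat k)"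
    using k by (intro prod.cong) (auto simp: field_simps)
  also have "\<dots> = pochhammer (of_nat k * z + of_nat (k * n)) k / of_nat k ^ k"
    by (simp add: prod_dividef pochhammer_prod atLeast0LessThan)
  finally show ?case
    using pochhammer_product'[of "of_nat k * z" "k * n" k] by (simp add: power_add algebra_simps)
qed simp

text \<open>In Gauss' limit for Gamma the two sides differ by a factor tending to k powr (- k z) and
  by \<open>c n\<close>, which does not depend on z. The limit of \<open>c n\<close> is therefore
  found at the single point z = 1/k, where k z = 1.\<close>

theorem Gamma_multiplication_complex:
  fixes z :: complex
  assumes k: "k > 0" and z: "Re z > 0"
  shows "(\<Prod>j<k. Gamma (z + of_nat j / of_nat k)) =
     of_real (sqrt (real k * (2 * pi) ^ (k - 1))) * of_nat k powr (- of_nat k * z) * Gamma (of_nat k * z)"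
proof -
  \<comment> \<open>Chosen so that k Pochhammer symbols of length n + 1 combine into one of length N
    + 1 = k (n + 1).\<close>
  define N where "N n = k * Suc n - 1" for n
  define c :: "nat \<Rightarrow> complex" where
    "c n = exp (of_real (ln (real n)) * (\<Sum>j<k. of_nat j / of_nat k)) * fact n ^ k * of_nat k ^ (k * Suc n) / fact (N n)" for n
  have SN: "Suc (N n) = k * Suc n" for n using k by (simp add: N_def)
  have id: "(\<Prod>j<k. Gamma_series (w + of_nat j / of_nat k) n) =
      c n * exp (of_nat k * w * of_real (ln (real n) - ln (real (N n)))) * Gamma_series (of_nat k * w) (N n)" for w n
  proof -
    have "(\<Prod>j<k. Gamma_series (w + of_nat j / of_nat k) n) =
        fact n ^ k * (\<Prod>j<k. exp ((w + of_nat j / of_nat k) * of_real (ln (real n)))) /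
        (\<Prod>j<k. pochhammer (w + of_nat j / of_nat k) (Suc n))"
      by (simp add: Gamma_series_def prod_dividef prod.distrib del: pochhammer_Suc)
    also have "(\<Prod>j<k. exp ((w + of_nat j / of_nat k) * of_real (ln (real n)))) =
        exp (of_nat k * w * of_real (ln (real n))) * exp (of_real (ln (real n)) * (\<Sum>j<k. of_nat j / of_nat k))"
      by (subst exp_sum[symmetric])
         (auto simp: exp_add[symmetric] sum.distrib sum_distrib_left sum_distrib_right algebra_simps)
    also have "(\<Prod>j<k. pochhammer (w + of_nat j / of_nat k) (Suc n)) =
        pochhammer (of_nat k * w) (Suc (N n)) / of_nat k ^ (k * Suc n)"
      by (simp only: prod_pochhammer_multiplication[OF k] SN)
    also have "exp (of_nat k * w * of_real (ln (real n))) =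
        exp (of_nat k * w * of_real (ln (real n) - ln (real (N n)))) * exp (of_nat k * w * of_real (ln (real (N n))))"
      by (simp flip: exp_add add: algebra_simps)
    finally show ?thesis
      by (simp add: c_def Gamma_series_def del: pochhammer_Suc)
  qed
  have Nlim: "filterlim N at_top sequentially"
  proof (rule filterlim_at_top_mono[OF filterlim_ident])
    show "\<forall>\<^sub>F n in sequentially. n \<le> N n"
    proof (intro always_eventually allI)
      fix n
      have "Suc n \<le> k * Suc n" using mult_le_mono1[of 1 k "Suc n"] k by simp
      then show "n \<le> N n" unfolding N_def by linarith
    qed
  qed
  have lnlim: "(\<lambda>n. ln (real n) - ln (real (N n))) \<longlonglongrightarrow> - ln (real k)"
  proof -
    have "(\<lambda>n. real n / (real k * (real n + 1) - 1)) \<longlonglongrightarrow> inverse (real k)"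
      using k by real_asymp
    then have "(\<lambda>n. ln (real n / (real k * (real n + 1) - 1))) \<longlonglongrightarrow> ln (inverse (real k))"
      using k by (intro tendsto_ln) auto
    moreover have "\<forall>\<^sub>F n in sequentially. ln (real n / (real k * (real n + 1) - 1)) = ln (real n) - ln (real (N n))"
      using eventually_gt_at_top[of 0]
    proof eventually_elim
      case (elim n)
      have "real (Suc (N n)) = real (k * Suc n)" by (simp only: SN)
      then have N: "real k * (real n + 1) - 1 = real (N n)" by (simp add: algebra_simps)
      have "1 < Suc n" using elim by simp
      also have "Suc n \<le> Suc (N n)" unfolding SN using k by (cases k) auto
      finally have "N n > 0" by simp
      then show ?case unfolding N using elim by (simp add: ln_div)
    qed
    ultimately show ?thesis using k by (simp add: ln_inverse tendsto_cong)
  qed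
  have limE: "(\<lambda>n. exp (of_nat k * w * of_real (ln (real n) - ln (real (N n))))) \<longlonglongrightarrow> of_nat k powr (- of_nat k * w)" for w :: complex
  proof -
    have "(\<lambda>n. exp (of_nat k * w * of_real (ln (real n) - ln (real (N n))))) \<longlonglongrightarrow> exp (of_nat k * w * of_real (- ln (real k)))"
      by (intro tendsto_intros lnlim)
    also have "exp (of_nat k * w * of_real (- ln (real k))) = of_nat k powr (- of_nat k * w)"
      using k by (simp add: powr_def mult_ac flip: Ln_of_nat)
    finally show ?thesis .
  qed
  have limP: "(\<lambda>n. \<Prod>j<k. Gamma_series (w + of_nat j / of_nat k) n) \<longlonglongrightarrow> (\<Prod>j<k. Gamma (w + of_nat j / of_nat k))" for w :: complex
    by (intro tendsto_prod Gamma_series_LIMSEQ)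
  have limQ: "(\<lambda>n. Gamma_series w (N n)) \<longlonglongrightarrow> Gamma w" for w :: complex
    by (rule filterlim_compose[OF Gamma_series_LIMSEQ Nlim])
  define G where "G = (\<Prod>j<k. Gamma (1 / of_nat k + of_nat j / of_nat k :: complex))"
  have k1: "of_nat k * (1 / of_nat k) = (1 :: complex)" using k by simp
  have climit: "c \<longlonglongrightarrow> G * of_nat k"
  proof -
    have "(\<lambda>n. c n * exp (of_nat k * (1 / of_nat k) * of_real (ln (real n) - ln (real (N n)))) * Gamma_series (of_nat k * (1 / of_nat k)) (N n)) \<longlonglongrightarrow> G"
      using limP[of "1 / of_nat k"] unfolding id G_def by simp
    then have "(\<lambda>n. c n * exp (of_real (ln (real n) - ln (real (N n)))) * Gamma_series 1 (N n)) \<longlonglongrightarrow> G"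
      unfolding k1 by simp
    moreover have e: "(\<lambda>n. exp (complex_of_real (ln (real n) - ln (real (N n)))) * Gamma_series 1 (N n)) \<longlonglongrightarrow> of_nat k powr (- 1) * Gamma 1"
      using tendsto_mult[OF limE[of "1 / of_nat k"] limQ[of 1]] k1 k by simp
    ultimately have "(\<lambda>n. c n * exp (of_real (ln (real n) - ln (real (N n)))) * Gamma_series 1 (N n) /
        (exp (complex_of_real (ln (real n) - ln (real (N n)))) * Gamma_series 1 (N n))) \<longlonglongrightarrow> G / (of_nat k powr (- 1) * Gamma 1)"
      using k by (intro tendsto_divide) auto
    \<comment> \<open>The finite Gauss products at 1 never vanish, so \<open>c n\<close> is
      recovered by exact division for every n.\<close>
    moreover have gnz: "Gamma_series (1 :: complex) m \<noteq> 0" for m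
      using of_nat_neq_0[of m, where 'a = complex]
      by (simp add: Gamma_series_def pochhammer_fact[symmetric] del: pochhammer_Suc)
    moreover have "(\<lambda>n. c n * exp (of_real (ln (real n) - ln (real (N n)))) * Gamma_series 1 (N n) /
        (exp (complex_of_real (ln (real n) - ln (real (N n)))) * Gamma_series 1 (N n))) = c"
      using gnz by (intro ext) (simp only: mult.assoc nonzero_mult_div_cancel_right mult_eq_0_iff exp_not_eq_zero simp_thms)
    ultimately show ?thesis using k by (simp add: powr_minus divide_inverse)
  qed
  have main: "(\<Prod>j<k. Gamma (z + of_nat j / of_nat k)) = G * of_nat k * of_nat k powr (- of_nat k * z) * Gamma (of_nat k * z)"
  proof (rule LIMSEQ_unique[OF limP])
    show "(\<lambda>n. \<Prod>j<k. Gamma_series (z + of_nat j / of_nat k) n) \<longlonglongrightarrow> G * of_nat k * of_nat k powr (- of_nat k * z) * Gamma (of_nat k * z)"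
      unfolding id by (intro tendsto_mult climit limE limQ)
  qed
  \<comment> \<open>Squaring the product of Gamma(j/k) over 0 < j < k and pairing j with k - j turns
    it, by reflection, into the product of sines.\<close>
  have "G * of_nat k = of_real (sqrt (real k * (2 * pi) ^ (k - 1)))"
  proof -
    define g where "g = (\<Prod>j=1..<k. Gamma (real j / real k))"
    have g: "g > 0" unfolding g_def by (intro prod_pos) auto
    have "G = (\<Prod>j<k. Gamma (of_nat (Suc j) / of_nat k))"
      by (simp add: G_def add_divide_distrib add.commute)
    also have "\<dots> = (\<Prod>j=1..<Suc k. Gamma (of_nat j / of_nat k))"
      by (rule prod.reindex_bij_witness[of _ "\<lambda>j. j - 1" Suc]) auto
    also have "\<dots> = of_real g"
      using k by (simp add: g_def prod.atLeastLessThan_Suc Gamma_complex_of_real[symmetric])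
    finally have G: "G = of_real g" .
    have "of_real g * of_real g = (\<Prod>j=1..<k. Gamma (of_nat j / of_nat k :: complex)) * (\<Prod>j=1..<k. Gamma (of_nat (k - j) / of_nat k))"
    proof -
      have "(\<Prod>j=1..<k. Gamma (of_nat j / of_nat k :: complex)) = (\<Prod>j=1..<k. Gamma (of_nat (k - j) / of_nat k))"
        by (rule prod.reindex_bij_witness[of _ "\<lambda>j. k - j" "\<lambda>j. k - j"]) auto
      then show ?thesis by (simp add: g_def Gamma_complex_of_real[symmetric])
    qed
    also have "\<dots> = (\<Prod>j=1..<k. Gamma (of_nat j / of_nat k) * Gamma (1 - of_nat j / of_nat k))"
      unfolding prod.distrib[symmetric] using k
      by (intro prod.cong refl) (auto simp: of_nat_diff diff_divide_distrib)
    also have "\<dots> = (\<Prod>j=1..<k. of_real (2 * pi / (2 * sin (pi * real j / real k))))"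
      by (intro prod.cong refl) (simp add: Gamma_reflection_complex sin_of_real[symmetric] del: sin_of_real)
    also have "\<dots> = of_real ((2 * pi) ^ (k - 1) / real k)"
      unfolding of_real_prod[symmetric] prod_dividef prod_sin_pi_over_nat[OF k] by simp
    finally have "g * g = (2 * pi) ^ (k - 1) / real k"
      by (simp only: of_real_mult[symmetric] of_real_eq_iff)
    then have "(g * real k)\<^sup>2 = real k * (2 * pi) ^ (k - 1)"
      using k by (simp add: power2_eq_square field_simps)
    then have "g * real k = sqrt (real k * (2 * pi) ^ (k - 1))"
      using g k by (intro real_sqrt_unique[symmetric]) auto
    moreover have "G * of_nat k = of_real (g * real k)" by (simp add: G)
    ultimately show ?thesis by (simp only:)
  qed
  then show ?thesis using main by simp
qed

section \<open>The Riemann zeta function\<close>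

text \<open>The logarithmic derivative of the reflection formula expresses pi cot (pi z) as
  Digamma(1 - z) - Digamma(z); the limit formula for Digamma then becomes the series.\<close>

lemma cot_partial_fractions:
  fixes z :: complex
  assumes z: "z \<notin> \<int>"
  shows "(\<lambda>n. 2 * z / (z ^ 2 - of_nat (Suc n) ^ 2)) sums (of_real pi * cos (of_real pi * z) / sin (of_real pi * z) - 1 / z)"
proof -
  have z0: "z \<noteq> 0" and z1: "1 - z \<noteq> 0" using z by auto
  have n1: "z \<notin> \<int>\<^sub>\<le>\<^sub>0" using z nonpos_Ints_Int by blast
  have n2: "1 - z \<notin> \<int>\<^sub>\<le>\<^sub>0"
  proof
    assume "1 - z \<in> \<int>\<^sub>\<le>\<^sub>0"
    then have "1 - (1 - z) \<in> \<int>" by (intro Ints_diff nonpos_Ints_Int Ints_1)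
    then show False using z by simp
  qed
  have sz: "sin (of_real pi * w) \<noteq> 0" if "w \<notin> \<int>" for w :: complex
  proof
    assume "sin (of_real pi * w) = 0"
    then obtain n where "of_real pi * w = of_real (real_of_int n * pi)"
      unfolding sin_eq_0 by (auto simp: mult.commute)
    then have "w = of_int n" by simp
    then show False using that by simp
  qed
  have d1: "((\<lambda>w. Gamma w * Gamma (1 - w)) has_field_derivative
          Gamma z * Gamma (1 - z) * (Digamma z - Digamma (1 - z))) (at z)"
    using n1 n2 by (auto intro!: derivative_eq_intros simp: algebra_simps)
  have d2: "((\<lambda>w. of_real pi / sin (of_real pi * w)) has_field_derivative
          - (of_real pi * (of_real pi * cos (of_real pi * z))) / (sin (of_real pi * z))^2) (at z)"
    using sz[OF z] by (auto intro!: derivative_eq_intros simp: power2_eq_square)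
  have eqd: "Gamma z * Gamma (1 - z) * (Digamma z - Digamma (1 - z)) =
        - (of_real pi * (of_real pi * cos (of_real pi * z))) / (sin (of_real pi * z))^2"
    using DERIV_unique[OF d1] d2 by (simp add: Gamma_reflection_complex)
  have aux: "b - a = p * C / S"
    if "p / S * (a - b) = - (p * (p * C)) / S ^ 2" "S \<noteq> 0" "p \<noteq> 0" for p S C a b :: complex
  proof -
    have "p * (b - a) = - S * (p / S * (a - b))" using that(2) by (simp add: field_simps)
    also have "\<dots> = p * (p * C / S)" unfolding that(1) using that(2) by (simp add: power2_eq_square)
    finally show ?thesis by (rule mult_left_cancel[OF that(3), THEN iffD1])
  qed
  have psi: "Digamma (1 - z) - Digamma z = of_real pi * cos (of_real pi * z) / sin (of_real pi * z)"
    by (rule aux[OF eqd[unfolded Gamma_reflection_complex] sz[OF z]]) simp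
  have "(\<lambda>m. (of_real (ln (real m)) - (\<Sum>n<m. inverse (1 - z + of_nat n))) -
             (of_real (ln (real m)) - (\<Sum>n<m. inverse (z + of_nat n)))) \<longlonglongrightarrow> Digamma (1 - z) - Digamma z"
    by (intro tendsto_diff Digamma_LIMSEQ z0 z1)
  \<comment> \<open>This null term and the subtracted 1/z shift one of the two sums by one index, so
    that z + (n + 1) is paired with (n + 1) - z.\<close>
  moreover have "(\<lambda>m. inverse (z + of_nat m)) \<longlonglongrightarrow> 0"
    by (rule filterlim_compose[OF tendsto_inverse_0 tendsto_add_filterlim_at_infinity[OF tendsto_const tendsto_of_nat]])
  ultimately have "(\<lambda>m. (of_real (ln (real m)) - (\<Sum>n<m. inverse (1 - z + of_nat n))) -
             (of_real (ln (real m)) - (\<Sum>n<m. inverse (z + of_nat n))) + inverse (z + of_nat m) - 1 / z)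
       \<longlonglongrightarrow> Digamma (1 - z) - Digamma z + 0 - 1 / z"
    by (rule tendsto_diff[OF tendsto_add tendsto_const])
  moreover have "(of_real (ln (real m)) - (\<Sum>n<m. inverse (1 - z + of_nat n))) -
             (of_real (ln (real m)) - (\<Sum>n<m. inverse (z + of_nat n))) + inverse (z + of_nat m) - 1 / z =
         (\<Sum>n<m. 2 * z / (z ^ 2 - of_nat (Suc n) ^ 2))" for m
  proof -
    have "(\<Sum>n<m. inverse (z + of_nat n)) + inverse (z + of_nat m) = (\<Sum>n<Suc m. inverse (z + of_nat n))" by simp
    also have "\<dots> = 1 / z + (\<Sum>n<m. inverse (z + of_nat (Suc n)))"
      by (subst sum.lessThan_Suc_shift) (simp add: divide_inverse)
    finally have S: "(\<Sum>n<m. inverse (z + of_nat n)) + inverse (z + of_nat m) = 1 / z + (\<Sum>n<m. inverse (z + of_nat (Suc n)))" .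
    have aux: "(L - B) - (L - A) + u - v = C - B" if "A + u = v + C" for L A B C u v :: complex
    proof -
      have "A = v + C - u" using that by (simp add: eq_diff_eq)
      then show ?thesis by simp
    qed
    have "(of_real (ln (real m)) - (\<Sum>n<m. inverse (1 - z + of_nat n))) -
             (of_real (ln (real m)) - (\<Sum>n<m. inverse (z + of_nat n))) + inverse (z + of_nat m) - 1 / z =
         (\<Sum>n<m. inverse (z + of_nat (Suc n)) - inverse (1 - z + of_nat n))"
      unfolding sum_subtractf by (rule aux[OF S])
    also have "\<dots> = (\<Sum>n<m. 2 * z / (z ^ 2 - of_nat (Suc n) ^ 2))"
    proof (intro sum.cong refl)
      fix n
      have a: "z + of_nat (Suc n) \<noteq> 0"
      proof
        assume "z + of_nat (Suc n) = 0"
        then have "z = - of_nat (Suc n)" by (simp only: eq_neg_iff_add_eq_0)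
        then show False using z by (simp del: of_nat_Suc)
      qed
      have b: "of_nat (Suc n) - z \<noteq> 0"
      proof
        assume "of_nat (Suc n) - z = 0"
        then have "z = of_nat (Suc n)" by (simp only: right_minus_eq)
        then show False using z by (simp del: of_nat_Suc)
      qed
      have "1 - z + of_nat n = of_nat (Suc n) - z" by simp
      moreover have "z ^ 2 - of_nat (Suc n) ^ 2 = - ((z + of_nat (Suc n)) * (of_nat (Suc n) - z))"
        by (simp add: power2_eq_square algebra_simps)
      moreover have "inverse (z + of_nat (Suc n)) - inverse (of_nat (Suc n) - z) = - (2 * z) / ((z + of_nat (Suc n)) * (of_nat (Suc n) - z))"
        using a b by (simp add: field_simps del: of_nat_Suc)
      ultimately show "inverse (z + of_nat (Suc n)) - inverse (1 - z + of_nat n) = 2 * z / (z ^ 2 - of_nat (Suc n) ^ 2)"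
        by (simp only: divide_minus_right divide_minus_left)
    qed
    finally show ?thesis .
  qed
  ultimately show ?thesis unfolding sums_def psi by simp
qed

text \<open>The cotangent series at i z / (2 pi). It feeds both the Mellin transform of
  \<open>bose\<close> and the generating function of the Bernoulli numbers.\<close>

lemma exp_partial_fractions:
  fixes z :: complex
  assumes z: "exp z \<noteq> 1"
  shows "(\<lambda>n. 2 * z / (z ^ 2 + (2 * of_real pi * of_nat (Suc n)) ^ 2)) sums (1 / (exp z - 1) - 1 / z + 1 / 2)"
proof -
  let ?w = "\<i> * z / (2 * of_real pi)"
  have z0: "z \<noteq> 0" using z by auto
  have w: "?w \<notin> \<int>"
  proof
    assume "?w \<in> \<int>"
    then obtain n where "?w = of_int n" by (elim Ints_cases)
    then have "\<i> * z = of_int n * (2 * of_real pi)" by (simp add: field_simps)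
    then have h: "\<i> * z = of_real (of_int n * 2 * pi)" by simp
    have "Re z = 0" "Im z = of_int (2 * (- n)) * pi"
      using arg_cong[OF h, of Im] arg_cong[OF h, of Re] by simp_all
    then have "exp z = 1" unfolding exp_eq_1 by blast
    then show False using z by simp
  qed
  define E where "E = exp (z / 2)"
  have E: "exp z = E * E" "E \<noteq> 0" by (auto simp: E_def simp flip: exp_add)
  have pw: "of_real pi * ?w = \<i> * (z / 2)" by simp
  have c: "cos (of_real pi * ?w) = (inverse E + E) / 2" "sin (of_real pi * ?w) = (inverse E - E) / (2 * \<i>)"
    unfolding pw cos_exp_eq sin_exp_eq by (simp_all add: E_def exp_minus)
  have E1: "E * E \<noteq> 1" using z E by simp
  have "(\<lambda>n. \<i> / (2 * of_real pi) * (2 * ?w / (?w ^ 2 - of_nat (Suc n) ^ 2))) sums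
     (\<i> / (2 * of_real pi) * (of_real pi * cos (of_real pi * ?w) / sin (of_real pi * ?w) - 1 / ?w))"
    by (intro sums_mult cot_partial_fractions w)
  also have "\<i> / (2 * of_real pi) * (of_real pi * cos (of_real pi * ?w) / sin (of_real pi * ?w) - 1 / ?w) =
     1 / (exp z - 1) - 1 / z + 1 / 2"
  proof -
    have "\<i> / (2 * of_real pi) * (1 / ?w) = 1 / z" using z0 by (simp add: field_simps)
    moreover have "\<i> / (2 * of_real pi) * (of_real pi * cos (of_real pi * ?w) / sin (of_real pi * ?w)) = 1 / (exp z - 1) + 1 / 2"
    proof -
      have aux: "\<i> / (2 * p) * (p * (M / 2) / (D / (2 * \<i>))) = - (M / D) / 2" if "D \<noteq> 0" "p \<noteq> 0" for D p M :: complex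
        using that by (simp add: field_simps)
      have "inverse E - E \<noteq> 0" using E E1 by (auto simp: field_simps)
      then have "\<i> / (2 * of_real pi) * (of_real pi * cos (of_real pi * ?w) / sin (of_real pi * ?w)) = - ((inverse E + E) / (inverse E - E)) / 2"
        unfolding c using aux[of "inverse E - E" "of_real pi" "inverse E + E"] by simp
      also have "(inverse E + E) / (inverse E - E) = (1 + E * E) / (1 - E * E)"
        using E E1 by (simp add: divide_simps)
      also have "- ((1 + E * E) / (1 - E * E)) / 2 = 1 / (exp z - 1) + 1 / 2"
        using E1 unfolding E(1) by (simp add: divide_simps) (simp add: algebra_simps)
      finally show ?thesis .
    qed
    ultimately show ?thesis by (simp only: right_diff_distrib) simp
  qed
  also have "(\<lambda>n. \<i> / (2 * of_real pi) * (2 * ?w / (?w ^ 2 - of_nat (Suc n) ^ 2))) =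
     (\<lambda>n. 2 * z / (z ^ 2 + (2 * of_real pi * of_nat (Suc n)) ^ 2))"
  proof
    fix n
    have aux: "\<i> / (2 * p) * (2 * (\<i> * z / (2 * p)) / (- Q / (2 * p) ^ 2)) = 2 * z / Q" if "p \<noteq> 0" for p Q :: complex
      using that by (cases "Q = 0") (auto simp: field_simps power2_eq_square)
    have h: "?w ^ 2 - of_nat (Suc n) ^ 2 = - (z ^ 2 + (2 * of_real pi * of_nat (Suc n)) ^ 2) / (2 * of_real pi) ^ 2"
      by (simp add: field_simps power2_eq_square)
    show "\<i> / (2 * of_real pi) * (2 * ?w / (?w ^ 2 - of_nat (Suc n) ^ 2)) = 2 * z / (z ^ 2 + (2 * of_real pi * of_nat (Suc n)) ^ 2)"
      by (subst h) (rule aux, simp)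
  qed
  finally show ?thesis .
qed

lemma exp_partial_fractions_real:
  fixes x :: real
  assumes "x > 0"
  shows "(\<lambda>n. 2 * x / (x ^ 2 + (2 * pi * real (Suc n)) ^ 2)) sums (1 / (exp x - 1) - 1 / x + 1 / 2)"
proof -
  have "exp (complex_of_real x) \<noteq> 1"
    using assms by (simp only: exp_of_real of_real_eq_1_iff) simp
  then have "(\<lambda>n. complex_of_real (2 * x / (x ^ 2 + (2 * pi * real (Suc n)) ^ 2))) sums
      of_real (1 / (exp x - 1) - 1 / x + 1 / 2)"
    using exp_partial_fractions[of "of_real x"] by (simp add: exp_of_real del: of_nat_Suc)
  then show ?thesis by (simp only: sums_of_real_iff)
qed

section \<open>Continuation of zeta to Re s > -1\<close>

text \<open>The kernel 1/(e^x - 1) without its Laurent terms 1/x and -1/2 at 0. What remains is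
  O(x), which pushes the convergence of the Mellin integral at 0 to Re s > -1.\<close>

definition bose :: "real \<Rightarrow> real" where "bose x = 1 / (exp x - 1) - 1 / x + 1 / 2"

text \<open>Every partial fraction is nonnegative, and dropping x^2 from the denominators bounds the
  sum by (x / (2 pi^2)) (pi^2 / 6) = x / 12.\<close>

lemma bose_bounds:
  assumes "x > 0"
  shows "0 \<le> bose x" "bose x \<le> x"
proof -
  note S = exp_partial_fractions_real[OF assms]
  show "0 \<le> bose x" unfolding bose_def sums_unique[OF S]
    using assms S by (intro suminf_nonneg) (auto simp: sums_iff)
  have T: "(\<lambda>n. x / (2 * pi\<^sup>2) * (1 / real (n + 1) ^ 2)) sums (x / (2 * pi\<^sup>2) * (pi\<^sup>2 / 6))"
    using inverse_squares_sums by (intro sums_mult) (simp add: add.commute)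
  have "bose x \<le> x / (2 * pi\<^sup>2) * (pi\<^sup>2 / 6)"
    unfolding bose_def
  proof (rule sums_le[OF _ S T])
    fix n
    have "2 * x / (x ^ 2 + (2 * pi * real (Suc n)) ^ 2) \<le> 2 * x / ((2 * pi * real (Suc n)) ^ 2)"
      using assms by (intro divide_left_mono) (auto intro!: mult_pos_pos add_nonneg_pos)
    also have "\<dots> = x / (2 * pi\<^sup>2) * (1 / real (n + 1) ^ 2)"
      by (simp add: power_mult_distrib)
    finally show "2 * x / (x ^ 2 + (2 * pi * real (Suc n)) ^ 2) \<le> x / (2 * pi\<^sup>2) * (1 / real (n + 1) ^ 2)" .
  qed
  also have "\<dots> \<le> x" using assms by simp
  finally show "bose x \<le> x" .
qed

lemma inverse_exp_minus_one_le:
  fixes x :: real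
  assumes "x \<ge> 1"
  shows "1 / (exp x - 1) \<le> 2 * exp (- x)" "0 \<le> 1 / (exp x - 1)"
proof -
  have "2 \<le> exp x" using exp_ge_add_one_self[of x] assms by linarith
  have "1 / (exp x - 1) \<le> 1 / (exp x / 2)"
  proof (rule frac_le)
    show "exp x / 2 \<le> exp x - 1" using \<open>2 \<le> exp x\<close> by linarith
  qed simp_all
  also have "1 / (exp x / 2) = 2 * exp (- x)" by (simp add: exp_minus inverse_eq_divide)
  finally show "1 / (exp x - 1) \<le> 2 * exp (- x)" .
  show "0 \<le> 1 / (exp x - 1)" using assms by simp
qed

text \<open>The pole of \<open>1 / (e\<^sup>x - 1)\<close> at \<open>0\<close> is subtracted only for \<open>x = e\<^sup>u < 1\<close>, so that the Mellin
  integral below converges for \<open>Re s > - 1\<close>.\<close>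

definition zeta_kernel :: "complex \<Rightarrow> real \<Rightarrow> complex" where
  "zeta_kernel s u = exp (s * of_real u) * of_real (if u < 0 then bose (exp u) else 1 / (exp (exp u) - 1))"

text \<open>Separate exponents for the two half-lines give one majorant for the whole strip a <= Re
  s <= b. The left part is written as a norm so that the half-line integral applies to it
  directly.\<close>

definition zeta_kernel_bound :: "real \<Rightarrow> real \<Rightarrow> real \<Rightarrow> real" where
  "zeta_kernel_bound a b u = norm (indicator {..<0} u *\<^sub>R exp (of_real (a + 1) * complex_of_real u)) + 2 * exp (b * u - 1 * exp u)"

lemma zeta_kernel_bound:
  assumes "a \<le> Re s" "Re s \<le> b"
  shows "norm (zeta_kernel s u) \<le> zeta_kernel_bound a b u"
proof (cases "u < 0")
  case True
  have "norm (zeta_kernel s u) = exp (Re s * u) * bose (exp u)"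
    using True bose_bounds(1)[of "exp u"] by (simp add: zeta_kernel_def norm_mult norm_exp)
  also have "\<dots> \<le> exp (a * u) * exp u"
    using bose_bounds[of "exp u"] True assms by (intro mult_mono) (auto intro: mult_right_mono_neg)
  also have "\<dots> = norm (indicator {..<0} u *\<^sub>R exp (of_real (a + 1) * complex_of_real u))"
    using True by (simp add: norm_exp ring_distribs flip: exp_add)
  also have "\<dots> \<le> zeta_kernel_bound a b u" by (simp add: zeta_kernel_bound_def)
  finally show ?thesis .
next
  case False
  have 1: "exp u \<ge> 1" using False by simp
  have "norm (zeta_kernel s u) = exp (Re s * u) * (1 / (exp (exp u) - 1))"
    using False inverse_exp_minus_one_le(2)[OF 1] by (simp add: zeta_kernel_def norm_mult norm_exp del: of_real_divide)
  also have "\<dots> \<le> exp (b * u) * (2 * exp (- exp u))"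
    using inverse_exp_minus_one_le[OF 1] False assms by (intro mult_mono) (auto intro: mult_right_mono)
  also have "\<dots> = 2 * exp (b * u - 1 * exp u)" by (simp add: exp_diff exp_minus divide_inverse)
  also have "\<dots> \<le> zeta_kernel_bound a b u" by (simp add: zeta_kernel_bound_def)
  finally show ?thesis .
qed

lemma integrable_zeta_kernel_bound:
  assumes "a > - 1" "b > 0"
  shows "integrable lborel (zeta_kernel_bound a b)"
  unfolding zeta_kernel_bound_def[abs_def] using assms
  by (intro Bochner_Integration.integrable_add integrable_norm integrable_mult_right exp_left_halfline Gamma_exp_integral_real) auto

lemma bose_measurable [measurable]: "bose \<in> borel_measurable borel"
  unfolding bose_def[abs_def] by measurable

lemma zeta_kernel_measurable [measurable]: "zeta_kernel s \<in> borel_measurable borel"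
  unfolding zeta_kernel_def[abs_def] by measurable

lemma integrable_zeta_kernel:
  assumes "Re s > - 1"
  shows "integrable lborel (zeta_kernel s)"
  using assms zeta_kernel_bound[of "Re s" s "max 1 (Re s)"]
  by (intro Bochner_Integration.integrable_bound[OF integrable_zeta_kernel_bound[of "Re s" "max 1 (Re s)"]])
     (auto intro!: AE_I2 order_trans[OF _ abs_ge_self])

text \<open>This is (integral + 1/(s - 1) - 1/(2 s)) / Gamma(s). Writing the last term as 1/(2
  Gamma(s + 1)) makes holomorphy and the value at 0 visible.\<close>

definition zeta_Mellin :: "complex \<Rightarrow> complex" where
  "zeta_Mellin s = rGamma s / (s - 1) - rGamma (s + 1) / 2 + rGamma s * (\<integral>u. zeta_kernel s u \<partial>lborel)"

lemma zeta_Mellin_altdef: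
  assumes "s \<noteq> 0"
  shows "zeta_Mellin s = rGamma s * ((\<integral>u. zeta_kernel s u \<partial>lborel) + 1 / (s - 1) - 1 / (2 * s))"
proof -
  have r: "rGamma (s + 1) = rGamma s / s"
    unfolding rGamma_plus1[of s, symmetric] using assms by simp
  show ?thesis unfolding zeta_Mellin_def r by (simp add: algebra_simps)
qed

lemma holomorphic_zeta_Mellin: "zeta_Mellin holomorphic_on {s. Re s > - 1} - {1}"
proof -
  have "(\<lambda>s. \<integral>u. zeta_kernel s u \<partial>lborel) holomorphic_on {s. Re s > - 1}"
  proof (rule holomorphic_integral)
    show "open {s. Re s > - 1}" by (rule open_halfspace_Re_gt)
    show "(\<lambda>z. zeta_kernel z x) holomorphic_on {s. Re s > - 1}" for x
      unfolding zeta_kernel_def by (intro holomorphic_intros)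
    fix z :: complex assume z: "z \<in> {s. Re s > - 1}"
    \<comment> \<open>Half the distance to the boundary line Re s = -1, so Re w stays above -1
      uniformly on the ball.\<close>
    define e where "e = (Re z + 1) / 2"
    show "\<exists>e>0. \<exists>g. integrable lborel g \<and> (\<forall>w\<in>ball z e \<inter> {s. Re s > - 1}. \<forall>x\<in>space lborel. norm (zeta_kernel w x) \<le> g x)"
    proof (intro exI conjI ballI)
      show e: "e > 0" using z by (simp add: e_def)
      show "integrable lborel (zeta_kernel_bound (Re z - e) (\<bar>Re z\<bar> + e))"
        using z e by (intro integrable_zeta_kernel_bound) (auto simp: e_def field_simps)
      fix w u assume w: "w \<in> ball z e \<inter> {s. Re s > - 1}"
      have "\<bar>Re (z - w)\<bar> \<le> norm (z - w)" by (rule abs_Re_le_cmod)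
      also have "\<dots> < e" using w by (simp add: dist_norm)
      finally have "\<bar>Re z - Re w\<bar> < e" by simp
      then show "norm (zeta_kernel w u) \<le> zeta_kernel_bound (Re z - e) (\<bar>Re z\<bar> + e) u"
        by (intro zeta_kernel_bound) linarith+
    qed
  qed auto
  then have "(\<lambda>s. \<integral>u. zeta_kernel s u \<partial>lborel) holomorphic_on {s. Re s > - 1} - {1}"
    by (rule holomorphic_on_subset) auto
  then show ?thesis
    unfolding zeta_Mellin_def[abs_def] by (intro holomorphic_intros) auto
qed

text \<open>Expanding 1/(e^x - 1) geometrically and integrating term by term gives Gamma(s) times
  the Dirichlet series; the terms 1/x and -1/2 removed on x < 1 integrate to 1/(s - 1) and -1/(2
  s).\<close>

lemma zeta_Mellin_sums:
  assumes s: "Re s > 1"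
  shows "(\<lambda>n. of_nat (Suc n) powr (- s)) sums zeta_Mellin s"
proof -
  define f where "f n u = exp (s * of_real u - of_nat (Suc n) * of_real (exp u))" for n u
  have s0: "Re s > 0" "s \<noteq> 0" "s \<notin> \<int>\<^sub>\<le>\<^sub>0" using s by (auto elim!: nonpos_Ints_cases')
  have pos: "Re (of_nat (Suc n)) > 0" for n by simp
  have int: "integrable lborel (f n)" for n
    unfolding f_def[abs_def] by (rule Gamma_exp_integral_complex(1)[OF s0(1) pos])
  have val: "(\<integral>u. f n u \<partial>lborel) = Gamma s * of_nat (Suc n) powr (- s)" for n
    unfolding f_def by (rule Gamma_exp_integral_complex(2)[OF s0(1) pos])
  have nrm: "norm (f n u) = exp (Re s * u - real (Suc n) * exp u)" for n u
    by (simp add: f_def norm_exp)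
  have nval: "(\<integral>u. norm (f n u) \<partial>lborel) = Gamma (Re s) * real (Suc n) powr (- Re s)" for n
    unfolding nrm by (rule Gamma_exp_integral_real(2)) (use s0 in auto)
  have fsum: "(\<lambda>n. f n u) sums (exp (s * of_real u) * of_real (1 / (exp (exp u) - 1)))" for u
  proof -
    define q where "q = exp (- exp u)"
    have q: "0 < q" "q < 1" by (auto simp: q_def)
    have "f n u = exp (s * of_real u) * of_real q * of_real q ^ n" for n
    proof -
      have "of_real q ^ n = exp (of_nat n * complex_of_real (- exp u))"
        by (simp only: q_def exp_of_real[symmetric] exp_of_nat_mult)
      then show ?thesis
        by (simp add: f_def q_def exp_of_real[symmetric] ring_distribs diff_diff_eq flip: exp_add)
    qed
    moreover have "(\<lambda>n. of_real q ^ n) sums (1 / (1 - complex_of_real q))"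
      using q by (intro geometric_sums) simp
    ultimately have "(\<lambda>n. f n u) sums (exp (s * of_real u) * of_real q * (1 / (1 - of_real q)))"
      by (simp only:) (intro sums_mult)
    also have "exp (s * of_real u) * of_real q * (1 / (1 - of_real q)) = exp (s * of_real u) * of_real (q * (1 / (1 - q)))"
      by simp
    also have "q * (1 / (1 - q)) = 1 / (exp (exp u) - 1)"
      using q by (simp add: q_def exp_minus field_simps)
    finally show ?thesis .
  qed
  have nsum: "summable (\<lambda>n. norm (f n u))" for u
  proof -
    have "norm (f n u) = exp (Re s * u) * exp (- exp u) * exp (- exp u) ^ n" for n
    proof -
      have "exp (- exp u) ^ n = exp (real n * (- exp u))" by (simp only: exp_of_nat_mult)
      then show ?thesis by (simp add: nrm ring_distribs diff_diff_eq flip: exp_add)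
    qed
    moreover have "summable (\<lambda>n. exp (Re s * u) * exp (- exp u) * exp (- exp u) ^ n)"
      by (intro summable_mult summable_geometric) simp
    ultimately show ?thesis by simp
  qed
  have nis: "summable (\<lambda>n. \<integral>u. norm (f n u) \<partial>lborel)"
    unfolding nval using s
    by (intro summable_mult) (subst summable_Suc_iff[of "\<lambda>n. real n powr (- Re s)"], simp add: summable_real_powr_iff)
  have "(\<lambda>n. \<integral>u. f n u \<partial>lborel) sums (\<integral>u. (\<Sum>n. f n u) \<partial>lborel)"
    by (rule sums_integral[OF int _ nis]) (use nsum in auto)
  also have "(\<integral>u. (\<Sum>n. f n u) \<partial>lborel) = (\<integral>u. zeta_kernel s u \<partial>lborel) + 1 / (s - 1) - 1 / (2 * s)"
  proof -
    let ?E = "\<lambda>c u. indicator {..<0} u *\<^sub>R exp (c * complex_of_real u)"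
    have "(\<Sum>n. f n u) = zeta_kernel s u + ?E (s - 1) u - 1 / 2 * ?E s u" for u
    proof -
      have "exp ((s - 1) * of_real u) = exp (s * of_real u) * complex_of_real (1 / exp u)"
        by (simp add: left_diff_distrib exp_diff exp_of_real)
      then show ?thesis
        unfolding sums_unique[OF fsum[of u], symmetric]
        by (cases "u < 0") (simp_all add: zeta_kernel_def bose_def algebra_simps)
    qed
    then have "(\<integral>u. (\<Sum>n. f n u) \<partial>lborel) = (\<integral>u. zeta_kernel s u + ?E (s - 1) u - 1 / 2 * ?E s u \<partial>lborel)"
      by simp
    also have "\<dots> = (\<integral>u. zeta_kernel s u \<partial>lborel) + (\<integral>u. ?E (s - 1) u \<partial>lborel) - 1 / 2 * (\<integral>u. ?E s u \<partial>lborel)"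
    proof -
      have i: "integrable lborel (?E (s - 1))" "integrable lborel (\<lambda>u. 1 / 2 * ?E s u)" "integrable lborel (zeta_kernel s)"
        using s by (intro integrable_mult_right exp_left_halfline(1) integrable_zeta_kernel; simp)+
      show ?thesis
        using Bochner_Integration.integral_diff[OF Bochner_Integration.integrable_add[OF i(3,1)] i(2)]
          Bochner_Integration.integral_add[OF i(3,1)]
        by (simp only: integral_mult_right_zero)
    qed
    finally show ?thesis
      using s exp_left_halfline(2)[of "s - 1"] exp_left_halfline(2)[of s] by simp
  qed
  finally have "(\<lambda>n. rGamma s * (Gamma s * of_nat (Suc n) powr (- s))) sums
      (rGamma s * ((\<integral>u. zeta_kernel s u \<partial>lborel) + 1 / (s - 1) - 1 / (2 * s)))"
    unfolding val by (rule sums_mult)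
  moreover have "rGamma s * (Gamma s * w) = w" for w
    using s0 by (simp add: rGamma_inverse_Gamma Gamma_eq_zero_iff)
  ultimately show ?thesis using zeta_Mellin_altdef[OF s0(2)] by simp
qed

section \<open>The functional equation\<close>

lemma logistic_integral_aux:
  fixes z :: complex
  assumes z: "0 < Re z" "Re z < 1"
  shows "integrable lborel (\<lambda>v. exp (z * of_real v) / of_real (exp v + 1))"
proof (rule Bochner_Integration.integrable_bound)
  let ?g = "\<lambda>v. norm (indicator {..<0} v *\<^sub>R exp (z * complex_of_real v)) + norm (indicator {0..} v *\<^sub>R exp (- (1 - z) * complex_of_real v))"
  show "integrable lborel ?g"
    using z by (intro Bochner_Integration.integrable_add integrable_norm exp_left_halfline exp_right_halfline) auto
  show "AE v in lborel. norm (exp (z * of_real v) / of_real (exp v + 1)) \<le> norm (?g v)"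
  proof (intro AE_I2)
    fix v :: real
    have n: "norm (exp (z * of_real v) / of_real (exp v + 1)) = exp (Re z * v) / (exp v + 1)"
      by (simp add: norm_divide norm_exp add_nonneg_nonneg del: of_real_add)
    show "norm (exp (z * of_real v) / of_real (exp v + 1)) \<le> norm (?g v)"
    proof (cases "v < 0")
      case True
      have "exp (Re z * v) / (exp v + 1) \<le> exp (Re z * v) / 1"
        by (intro divide_left_mono) (auto intro: add_pos_pos)
      then show ?thesis using True unfolding n by (simp add: norm_exp)
    next
      case False
      have "exp (Re z * v) / (exp v + 1) \<le> exp (Re z * v) / exp v"
        by (intro divide_left_mono) (auto intro!: mult_pos_pos add_pos_pos)
      also have "\<dots> = exp (- (1 - Re z) * v)" by (simp add: algebra_simps exp_diff)
      finally show ?thesis using False unfolding n by (simp add: norm_exp)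
    qed
  qed
qed measurable

text \<open>The Beta integral of x^(z-1)/(1 + x) in the variable v = ln x. Writing 1/(e^v + 1) as an
  exponential integral in w and exchanging the order leaves only Gamma integrals.\<close>

lemma logistic_integral:
  fixes z :: complex
  assumes z: "0 < Re z" "Re z < 1"
  shows "(\<integral>v. exp (z * of_real v) / of_real (exp v + 1) \<partial>lborel) = Gamma z * Gamma (1 - z)"
proof -
  define F where "F v w = exp (of_real w - of_real (exp w) + z * of_real v - of_real (exp w) * of_real (exp v))" for v w :: real
  have meas[measurable]: "(\<lambda>x. F (fst x) (snd x)) \<in> borel_measurable (lborel \<Otimes>\<^sub>M lborel)"
    unfolding F_def by measurable
  have Fw: "F v w = exp (z * of_real v) * exp (1 * of_real w - of_real (exp v + 1) * of_real (exp w))" for v w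
    unfolding F_def exp_add[symmetric] by (simp add: algebra_simps)
  have Fv: "F v w = exp (of_real w - of_real (exp w)) * exp (z * of_real v - of_real (exp w) * of_real (exp v))" for v w
    unfolding F_def exp_add[symmetric] by (simp add: algebra_simps)
  have p: "Re (of_real (exp v + 1)) > 0" for v by (simp add: add_pos_pos)
  have inner1: "integrable lborel (F v)" "(\<integral>w. F v w \<partial>lborel) = exp (z * of_real v) / of_real (exp v + 1)" for v
    unfolding Fw[abs_def] using Gamma_exp_integral_complex[of 1 "of_real (exp v + 1)"] p
    by (auto simp: powr_minus divide_inverse)
  have ninner1: "(\<integral>w. norm (F v w) \<partial>lborel) = norm (exp (z * of_real v) / of_real (exp v + 1))" for v
  proof -
    have "norm (F v w) = exp (Re z * v) * exp (1 * w - (exp v + 1) * exp w)" for w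
      unfolding Fw by (simp add: norm_mult norm_exp)
    then have "(\<integral>w. norm (F v w) \<partial>lborel) = exp (Re z * v) * (Gamma 1 * (exp v + 1) powr (- 1))"
      using Gamma_exp_integral_real(2)[of 1 "exp v + 1"] p[of v] by simp
    moreover have "norm (exp (z * of_real v) / of_real (exp v + 1)) = exp (Re z * v) / (exp v + 1)"
      by (simp add: norm_divide norm_exp add_nonneg_nonneg del: of_real_add)
    ultimately show ?thesis by (simp add: powr_minus divide_inverse add_pos_pos)
  qed
  have int: "integrable (lborel \<Otimes>\<^sub>M lborel) (\<lambda>x. F (fst x) (snd x))"
  proof (rule lborel_pair.Fubini_integrable)
    show "AE x in lborel. integrable lborel (\<lambda>y. F (fst (x, y)) (snd (x, y)))"
      using inner1(1) by simp
    show "integrable lborel (\<lambda>x. \<integral>y. norm (F (fst (x, y)) (snd (x, y))) \<partial>lborel)"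
      using ninner1 integrable_norm[OF logistic_integral_aux[OF z]] by simp
  qed measurable
  have "(\<integral>v. exp (z * of_real v) / of_real (exp v + 1) \<partial>lborel) = (\<integral>v. (\<integral>w. F v w \<partial>lborel) \<partial>lborel)"
    by (simp add: inner1)
  also have "\<dots> = (\<integral>w. (\<integral>v. F v w \<partial>lborel) \<partial>lborel)"
    using lborel_pair.Fubini_integral[of F] int by (simp add: case_prod_beta')
  also have "\<dots> = (\<integral>w. Gamma z * exp ((1 - z) * of_real w - of_real (exp w)) \<partial>lborel)"
  proof (intro Bochner_Integration.integral_cong refl)
    fix w
    show "(\<integral>v. F v w \<partial>lborel) = Gamma z * exp ((1 - z) * of_real w - of_real (exp w))"
  proof -
    have "(\<integral>v. F v w \<partial>lborel) = exp (of_real w - of_real (exp w)) * (Gamma z * of_real (exp w) powr (- z))"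
      unfolding Fv using Gamma_exp_integral_complex(2)[of z "of_real (exp w)"] z by simp
    also have "complex_of_real (exp w) powr (- z) = exp (- z * of_real w)"
      by (simp add: powr_def Ln_of_real)
    finally show ?thesis by (simp add: algebra_simps flip: exp_add)
  qed
  qed
  also have "(\<integral>w. Gamma z * exp ((1 - z) * of_real w - of_real (exp w)) \<partial>lborel) = Gamma z * Gamma (1 - z)"
    using Gamma_exp_integral(2)[of "1 - z"] z by simp
  finally show ?thesis .
qed

text \<open>The substitution v = 2 u - 2 ln a reduces each partial fraction to the logistic integral
  with z = (1 + s)/2.\<close>

lemma Mellin_rational_integral:
  fixes s :: complex and a :: real
  assumes s: "- 1 < Re s" "Re s < 1" and a: "a > 0"
  defines "f \<equiv> (\<lambda>u. exp (s * of_real u) * of_real (2 * exp u / (exp u ^ 2 + a ^ 2)))"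
  shows "integrable lborel f"
    and "(\<integral>u. f u \<partial>lborel) = of_real a powr (s - 1) * (Gamma ((1 + s) / 2) * Gamma ((1 - s) / 2))"
proof -
  let ?z = "(1 + s) / 2"
  let ?g = "\<lambda>v. exp (?z * of_real v) / of_real (exp v + 1)"
  have z: "0 < Re ?z" "Re ?z < 1" using s by auto
  have eq: "?g (- 2 * ln a + 2 * u) = 1 / 2 * of_real a powr (1 - s) * f u" for u
  proof -
    have e: "exp (- 2 * ln a + 2 * u) = exp u ^ 2 / a ^ 2"
    proof -
      have "exp (- 2 * ln a + 2 * u) = exp (2 * u) / exp (2 * ln a)" by (simp flip: exp_diff)
      then show ?thesis by (simp only: exp_double exp_ln[OF a])
    qed
    have e2: "exp (?z * of_real (- 2 * ln a + 2 * u)) = of_real a powr (1 - s) * exp (s * of_real u) * of_real (exp u / a ^ 2)"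
    proof -
      have "?z * of_real (- 2 * ln a + 2 * u) = (1 - s) * of_real (ln a) + s * of_real u + of_real (u - 2 * ln a)"
        by (simp add: field_simps)
      moreover have "exp ((1 - s) * of_real (ln a)) = of_real a powr (1 - s)"
        using a by (simp add: powr_def Ln_of_real)
      moreover have "exp (u - 2 * ln a) = exp u / a ^ 2"
        by (simp only: exp_diff exp_double exp_ln[OF a])
      ultimately show ?thesis by (simp only: exp_add exp_of_real)
    qed
    have "?g (- 2 * ln a + 2 * u) = exp (?z * of_real (- 2 * ln a + 2 * u)) * of_real (a ^ 2 / (exp u ^ 2 + a ^ 2))"
      unfolding e using a by (simp add: field_simps)
    also have "\<dots> = of_real a powr (1 - s) * exp (s * of_real u) * of_real (exp u / a ^ 2) * of_real (a ^ 2 / (exp u ^ 2 + a ^ 2))"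
      by (simp only: e2)
    also have "\<dots> = of_real a powr (1 - s) * exp (s * of_real u) * of_real (exp u / a ^ 2 * (a ^ 2 / (exp u ^ 2 + a ^ 2)))"
      by simp
    also have "exp u / a ^ 2 * (a ^ 2 / (exp u ^ 2 + a ^ 2)) = 1 / 2 * (2 * exp u / (exp u ^ 2 + a ^ 2))"
      using a by simp
    finally show ?thesis unfolding f_def of_real_mult[of "1 / 2"] by (simp add: mult_ac)
  qed
  have nz: "of_real a powr (1 - s) \<noteq> 0" using a by simp
  have f_eq: "f = (\<lambda>u. 2 * of_real a powr (s - 1) * ?g (- 2 * ln a + 2 * u))"
    unfolding eq using nz by (simp add: fun_eq_iff powr_diff field_simps)
  show "integrable lborel f"
    unfolding f_eq by (intro integrable_mult_right lborel_integrable_real_affine logistic_integral_aux z) auto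
  have "Gamma ?z * Gamma (1 - ?z) = 2 *\<^sub>R (\<integral>u. ?g (- 2 * ln a + 2 * u) \<partial>lborel)"
    unfolding logistic_integral[OF z, symmetric]
    by (subst lborel_integral_real_affine[of 2 _ "- 2 * ln a"]) auto
  also have "(\<integral>u. ?g (- 2 * ln a + 2 * u) \<partial>lborel) = 1 / 2 * of_real a powr (1 - s) * (\<integral>u. f u \<partial>lborel)"
    unfolding eq by simp
  finally have "of_real a powr (1 - s) * (\<integral>u. f u \<partial>lborel) = Gamma ?z * Gamma (1 - ?z)"
    by (simp add: scaleR_conv_of_real)
  moreover have "1 - ?z = (1 - s) / 2" by (simp add: field_simps)
  ultimately have "of_real a powr (s - 1) * (of_real a powr (1 - s) * (\<integral>u. f u \<partial>lborel)) =
     of_real a powr (s - 1) * (Gamma ((1 + s) / 2) * Gamma ((1 - s) / 2))" by (simp only:)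
  moreover have "of_real a powr (s - 1) * (of_real a powr (1 - s) * w) = w" for w
    using a by (simp add: mult.assoc[symmetric] flip: powr_add)
  ultimately show "(\<integral>u. f u \<partial>lborel) = of_real a powr (s - 1) * (Gamma ((1 + s) / 2) * Gamma ((1 - s) / 2))"
    by (simp only:)
qed

text \<open>The partial fractions are transformed term by term: the numbers 2 pi (n + 1) enter with
  the power s - 1, and their sum is a Dirichlet series at 1 - s, convergent because Re s <
  0.\<close>

lemma bose_Mellin:
  fixes s :: complex
  assumes s: "- 1 < Re s" "Re s < 0"
  shows "(\<integral>u. exp (s * of_real u) * of_real (bose (exp u)) \<partial>lborel) =
      (2 * of_real pi) powr (s - 1) * (Gamma ((1 + s) / 2) * Gamma ((1 - s) / 2)) * zeta_Mellin (1 - s)"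
proof -
  define a where "a n = 2 * pi * real (Suc n)" for n
  have a: "a n > 0" for n by (simp add: a_def)
  define f where "f n u = exp (s * of_real u) * of_real (2 * exp u / (exp u ^ 2 + a n ^ 2))" for n u
  \<comment> \<open>Up to the unimodular factor exp (i u Im s) the terms are positive, so the
    integral of the norm is given by the same formula at the real point
    \<open>\<sigma>\<close>.\<close>
  define \<sigma> where "\<sigma> = complex_of_real (Re s)"
  have sg: "- 1 < Re s" "Re s < 1" "- 1 < Re \<sigma>" "Re \<sigma> < 1" using s by (auto simp: \<sigma>_def)
  have int: "integrable lborel (f n)" for n
    unfolding f_def[abs_def] by (rule Mellin_rational_integral(1)[OF sg(1,2) a])
  have val: "(\<integral>u. f n u \<partial>lborel) = of_real (a n) powr (s - 1) * (Gamma ((1 + s) / 2) * Gamma ((1 - s) / 2))" for n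
    unfolding f_def by (rule Mellin_rational_integral(2)[OF sg(1,2) a])
  have nrm: "norm (f n u) = exp (Re s * u) * (2 * exp u / (exp u ^ 2 + a n ^ 2))" for n u
    using a[of n] by (simp add: f_def norm_mult norm_exp del: of_real_divide of_real_mult of_real_power of_real_add)
  have nval: "(\<integral>u. norm (f n u) \<partial>lborel) = norm (Gamma ((1 + \<sigma>) / 2) * Gamma ((1 - \<sigma>) / 2)) * a n powr (Re s - 1)" for n
  proof -
    have e: "exp (\<sigma> * of_real u) * of_real (2 * exp u / (exp u ^ 2 + a n ^ 2)) = complex_of_real (norm (f n u))" for u
      unfolding nrm by (simp add: \<sigma>_def exp_of_real[symmetric])
    have "complex_of_real (\<integral>u. norm (f n u) \<partial>lborel) = of_real (a n) powr (\<sigma> - 1) * (Gamma ((1 + \<sigma>) / 2) * Gamma ((1 - \<sigma>) / 2))"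
      using Mellin_rational_integral(2)[OF sg(3,4) a[of n]] unfolding e by simp
    then have "norm (complex_of_real (\<integral>u. norm (f n u) \<partial>lborel)) = norm (of_real (a n) powr (\<sigma> - 1) * (Gamma ((1 + \<sigma>) / 2) * Gamma ((1 - \<sigma>) / 2)))"
      by simp
    also have "\<dots> = norm (Gamma ((1 + \<sigma>) / 2) * Gamma ((1 - \<sigma>) / 2)) * a n powr (Re s - 1)"
      using a[of n] by (simp add: norm_mult norm_powr_real_powr \<sigma>_def)
    finally show ?thesis by (simp add: integral_nonneg_AE)
  qed
  have real_sum: "(\<lambda>n. 2 * exp u / (exp u ^ 2 + a n ^ 2)) sums bose (exp u)" for u
    unfolding a_def bose_def by (rule exp_partial_fractions_real) simp
  have fsum: "(\<lambda>n. f n u) sums (exp (s * of_real u) * of_real (bose (exp u)))" for u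
    unfolding f_def by (intro sums_mult) (simp only: sums_of_real_iff real_sum)
  have nsum: "summable (\<lambda>n. norm (f n u))" for u
    unfolding nrm using real_sum[of u] by (intro summable_mult) (auto simp: sums_iff)
  have nis: "summable (\<lambda>n. \<integral>u. norm (f n u) \<partial>lborel)"
  proof -
    have "summable (\<lambda>n. real (Suc n) powr (Re s - 1))"
      using s by (subst summable_Suc_iff[of "\<lambda>n. real n powr (Re s - 1)"]) (simp add: summable_real_powr_iff)
    then have "summable (\<lambda>n. (2 * pi) powr (Re s - 1) * real (Suc n) powr (Re s - 1))" by (rule summable_mult)
    then have "summable (\<lambda>n. a n powr (Re s - 1))" unfolding a_def by (simp add: powr_mult del: of_nat_Suc)
    then show ?thesis unfolding nval by (rule summable_mult)
  qed
  have "(\<lambda>n. \<integral>u. f n u \<partial>lborel) sums (\<integral>u. (\<Sum>n. f n u) \<partial>lborel)"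
    by (rule sums_integral[OF int _ nis]) (use nsum in auto)
  then have "(\<lambda>n. of_real (a n) powr (s - 1) * (Gamma ((1 + s) / 2) * Gamma ((1 - s) / 2))) sums
      (\<integral>u. exp (s * of_real u) * of_real (bose (exp u)) \<partial>lborel)"
    unfolding val sums_unique[OF fsum, symmetric] .
  moreover have "(\<lambda>n. of_real (a n) powr (s - 1) * (Gamma ((1 + s) / 2) * Gamma ((1 - s) / 2))) sums
     ((2 * of_real pi) powr (s - 1) * (Gamma ((1 + s) / 2) * Gamma ((1 - s) / 2)) * zeta_Mellin (1 - s))"
  proof -
    have "of_real (a n) powr (s - 1) = (2 * of_real pi) powr (s - 1) * of_nat (Suc n) powr (- (1 - s))" for n
    proof -
      have "complex_of_real (a n) = of_real (2 * pi) * of_real (real (Suc n))" by (simp add: a_def)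
      also have "\<dots> powr (s - 1) = of_real (2 * pi) powr (s - 1) * of_real (real (Suc n)) powr (s - 1)"
        by (rule powr_times_real) auto
      finally show ?thesis by (simp del: of_nat_Suc)
    qed
    then have e: "of_real (a n) powr (s - 1) * (Gamma ((1 + s) / 2) * Gamma ((1 - s) / 2)) =
       (2 * of_real pi) powr (s - 1) * (Gamma ((1 + s) / 2) * Gamma ((1 - s) / 2)) * of_nat (Suc n) powr (- (1 - s))" for n
      by (simp only: mult_ac)
    show ?thesis unfolding e using s by (intro sums_mult zeta_Mellin_sums) auto
  qed
  ultimately show ?thesis by (rule sums_unique2)
qed

text \<open>For -1 < Re s < 0 the terms 1/x and -1/2 can be removed on x >= 1 as well. The
  correction is again 1/(s - 1) - 1/(2 s), so the bracket in \<open>zeta_Mellin\<close> equals the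
  full integral of \<open>bose\<close>, which the partial fractions evaluate.\<close>

lemma zeta_Mellin_functional_equation:
  fixes s :: complex
  assumes s: "- 1 < Re s" "Re s < 0"
  shows "zeta_Mellin s = 2 * (2 * of_real pi) powr (s - 1) * sin (of_real pi * s / 2) * Gamma (1 - s) * zeta_Mellin (1 - s)"
proof -
  have s0: "s \<noteq> 0" "s \<noteq> 1" using s by auto
  let ?E = "\<lambda>c u. indicator {0..} u *\<^sub>R exp (- c * complex_of_real u)"
  have "exp (s * of_real u) * of_real (bose (exp u)) = zeta_kernel s u - ?E (1 - s) u + 1 / 2 * ?E (- s) u" for u :: real
    by (auto simp: zeta_kernel_def bose_def indicator_def ring_distribs exp_diff exp_of_real field_simps)
  then have "(\<integral>u. exp (s * of_real u) * of_real (bose (exp u)) \<partial>lborel) = (\<integral>u. zeta_kernel s u - ?E (1 - s) u + 1 / 2 * ?E (- s) u \<partial>lborel)"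
    by (simp only:)
  also have "\<dots> = (\<integral>u. zeta_kernel s u \<partial>lborel) - (\<integral>u. ?E (1 - s) u \<partial>lborel) + 1 / 2 * (\<integral>u. ?E (- s) u \<partial>lborel)"
  proof -
    have i: "integrable lborel (?E (1 - s))" "integrable lborel (\<lambda>u. 1 / 2 * ?E (- s) u)" "integrable lborel (zeta_kernel s)"
      using s by (intro integrable_mult_right exp_right_halfline(1) integrable_zeta_kernel; simp)+
    show ?thesis
      using Bochner_Integration.integral_add[OF Bochner_Integration.integrable_diff[OF i(3,1)] i(2)]
        Bochner_Integration.integral_diff[OF i(3,1)]
      by (simp only: integral_mult_right_zero)
  qed
  also have "\<dots> = (\<integral>u. zeta_kernel s u \<partial>lborel) + 1 / (s - 1) - 1 / (2 * s)"
  proof -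
    have "(\<integral>u. ?E (1 - s) u \<partial>lborel) = 1 / (1 - s)" "(\<integral>u. ?E (- s) u \<partial>lborel) = 1 / (- s)"
      using s by (intro exp_right_halfline(2); simp)+
    moreover have "1 / (1 - s) = - (1 / (s - 1))" by (metis minus_diff_eq divide_minus_right)
    ultimately show ?thesis by (simp only:) simp
  qed
  finally have calc: "(\<integral>u. exp (s * of_real u) * of_real (bose (exp u)) \<partial>lborel) = (\<integral>u. zeta_kernel s u \<partial>lborel) + 1 / (s - 1) - 1 / (2 * s)" .
  have key: "zeta_Mellin s = rGamma s * ((2 * of_real pi) powr (s - 1) * (Gamma ((1 + s) / 2) * Gamma ((1 - s) / 2)) * zeta_Mellin (1 - s))"
    by (simp only: zeta_Mellin_altdef[OF s0(1)] calc[symmetric] bose_Mellin[OF s])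
  have G: "Gamma ((1 + s) / 2) * Gamma ((1 - s) / 2) = of_real pi / cos (of_real pi * s / 2)"
  proof -
    have "(1 - s) / 2 = 1 - (1 + s) / 2" by (simp add: field_simps)
    moreover have "sin (of_real pi * ((1 + s) / 2)) = cos (of_real pi * s / 2)"
      by (simp add: ring_distribs add_divide_distrib sin_add)
    ultimately show ?thesis by (simp only: Gamma_reflection_complex)
  qed
  have r: "rGamma s = Gamma (1 - s) * sin (of_real pi * s) / of_real pi"
  proof -
    have "1 - s \<notin> \<int>\<^sub>\<le>\<^sub>0" using s by (auto elim!: nonpos_Ints_cases' simp: complex_eq_iff)
    then have g: "rGamma (1 - s) * Gamma (1 - s) = 1" by (simp add: rGamma_inverse_Gamma Gamma_eq_zero_iff)
    have "rGamma s = rGamma s * rGamma (1 - s) * Gamma (1 - s)" by (simp only: mult.assoc g mult_1_right)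
    then show ?thesis unfolding rGamma_reflection_complex by (simp only: mult_ac divide_inverse)
  qed
  \<comment> \<open>The cosine here cancels the one in \<open>G\<close>, leaving the sine of the
    functional equation.\<close>
  have sn: "sin (of_real pi * s) = 2 * sin (of_real pi * s / 2) * cos (of_real pi * s / 2)"
    using sin_double[of "of_real pi * s / 2"] by simp
  \<comment> \<open>The zeros of this cosine are the odd integers, none of which has real part
    between -1 and 0.\<close>
  have C: "cos (of_real pi * s / 2) \<noteq> 0"
  proof
    assume "cos (of_real pi * s / 2) = 0"
    then obtain n where n: "of_real pi * s / 2 = of_int n * of_real pi + of_real pi / 2"
      unfolding cos_eq_0 by (auto simp: mult.commute)
    have "of_real pi * s = of_real pi * (2 * of_int n + 1)" using n by (simp add: field_simps)
    then have "s = 2 * of_int n + 1" by (subst (asm) mult_cancel_left) simp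
    then have "Re s = of_int (2 * n + 1)" by simp
    then have "- 1 < 2 * n + 1" "2 * n + 1 < 0" using s by linarith+
    then show False by presburger
  qed
  have aux: "(g * (2 * S * C) / p) * (P * (p / C) * Z) = 2 * P * S * g * Z" if "C \<noteq> 0" "p \<noteq> 0" for g S C p P Z :: complex
    using that by simp
  show ?thesis unfolding key G r sn by (rule aux[OF C]) simp
qed

section \<open>Zeta on the whole plane\<close>

lemma connected_halfplane_delete: "connected ({s. Re s > a} - {z})"
  by (intro connected_open_delete open_halfspace_Re_gt convex_connected convex_halfspace_Re_gt) auto

text \<open>The two branches agree for -1 < Re s < 0 and so glue to one function; on Re s < 0 the
  point 1 - s stays clear of the poles of Gamma and of \<open>zeta_Mellin\<close>. Existence is what
  gives the choice in the definition of \<open>zeta\<close> its meaning.\<close>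

lemma zeta_continuation_exists:
  "\<exists>f. f holomorphic_on - {1} \<and> (\<forall>s. Re s > 1 \<longrightarrow> (\<lambda>n. of_nat (Suc n) powr (- s)) sums f s)"
proof -
  define B where "B s = 2 * (2 * of_real pi) powr (s - 1) * sin (of_real pi * s / 2) * Gamma (1 - s) * zeta_Mellin (1 - s)" for s :: complex
  define f where "f s = (if Re s > - 1 then zeta_Mellin s else B s)" for s
  have 1: "f holomorphic_on {s. Re s > - 1} - {1}"
    using holomorphic_zeta_Mellin by (rule holomorphic_transform) (auto simp: f_def)
  have 2: "f holomorphic_on {s. Re s < 0}"
  proof (rule holomorphic_transform)
    have *: "(zeta_Mellin \<circ> (\<lambda>s. 1 - s)) holomorphic_on {s. Re s < 0}"
      by (rule holomorphic_on_compose_gen[OF _ holomorphic_zeta_Mellin]) (auto intro!: holomorphic_intros)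
    have **: "(Gamma \<circ> (\<lambda>s. 1 - s)) holomorphic_on {s. Re s < 0}"
      by (rule holomorphic_on_compose_gen[OF _ holomorphic_Gamma[of "{s. Re s > 0}"]])
         (auto intro!: holomorphic_intros elim!: nonpos_Ints_cases')
    show "B holomorphic_on {s. Re s < 0}"
      unfolding B_def[abs_def] using * ** unfolding o_def
      by (intro holomorphic_on_mult) (assumption | rule holomorphic_on_const | (intro holomorphic_intros; simp))+
    fix s :: complex assume "s \<in> {s. Re s < 0}"
    then show "B s = f s"
      using zeta_Mellin_functional_equation[of s] by (simp add: f_def B_def)
  qed
  have "f holomorphic_on ({s. Re s > - 1} - {1}) \<union> {s. Re s < 0}"
    by (intro holomorphic_on_Un 1 2 open_Diff open_halfspace_Re_gt open_halfspace_Re_lt) auto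
  also have "({s. Re s > - 1} - {1}) \<union> {s. Re s < 0} = - {1}" by auto
  finally have "f holomorphic_on - {1}" .
  moreover have "(\<lambda>n. of_nat (Suc n) powr (- s)) sums f s" if "Re s > 1" for s
    using zeta_Mellin_sums[OF that] that by (simp add: f_def)
  ultimately show ?thesis by blast
qed

lemma holomorphic_zeta: "zeta holomorphic_on - {1}"
  and zeta_sums: "Re s > 1 \<Longrightarrow> (\<lambda>n. of_nat (Suc n) powr (- s)) sums zeta s"
  using someI_ex[OF zeta_continuation_exists] unfolding zeta_def[symmetric] by blast+

lemma holomorphic_zeta' [holomorphic_intros]:
  assumes "f holomorphic_on A" "\<And>z. z \<in> A \<Longrightarrow> f z \<noteq> 1"
  shows "(\<lambda>z. zeta (f z)) holomorphic_on A"
proof -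
  have "f ` A \<subseteq> - {1}" using assms(2) by auto
  from holomorphic_on_compose_gen[OF assms(1) holomorphic_zeta this] show ?thesis by (simp add: o_def)
qed

lemma isCont_zeta: "s \<noteq> 1 \<Longrightarrow> isCont zeta s"
  using holomorphic_on_imp_continuous_on[OF holomorphic_zeta]
  by (simp add: continuous_on_eq_continuous_at open_delete Compl_eq_Diff_UNIV)

text \<open>Both functions are sums of the same series for Re s > 1, and the punctured half-plane is
  connected.\<close>

lemma zeta_eq_zeta_Mellin:
  assumes "Re s > - 1" "s \<noteq> 1"
  shows "zeta s = zeta_Mellin s"
proof (rule analytic_continuation_open[of "{s. Re s > 1}" "{s. Re s > - 1} - {1}" zeta zeta_Mellin s])
  show "{s. Re s > 1} \<noteq> {}" by (rule ex_in_conv[THEN iffD1]) (auto intro!: exI[of _ 2])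
  show "zeta z = zeta_Mellin z" if "z \<in> {s. Re s > 1}" for z
    using zeta_sums[of z] zeta_Mellin_sums[of z] that sums_unique2 by blast
qed (use assms in \<open>auto intro!: open_halfspace_Re_gt open_Diff connected_halfplane_delete holomorphic_zeta_Mellin
       holomorphic_on_subset[OF holomorphic_zeta]\<close>)

text \<open>For 1 < Re u < 2 this is the equation for \<open>zeta_Mellin\<close> at s = 1 - u; the
  identity theorem extends it. The form in u suits the reflection of the left line, where the
  Dirichlet series converge in u.\<close>

lemma zeta_functional_equation:
  assumes "Re u > 0" "u \<noteq> 1"
  shows "zeta (1 - u) = 2 * (2 * of_real pi) powr (- u) * cos (of_real pi * u / 2) * Gamma u * zeta u"
proof (rule analytic_continuation_open[of "{u. 1 < Re u} \<inter> {u. Re u < 2}" "{u. Re u > 0} - {1}"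
      "\<lambda>u. zeta (1 - u)" "\<lambda>u. 2 * (2 * of_real pi) powr (- u) * cos (of_real pi * u / 2) * Gamma u * zeta u" u])
  show "open ({u. 1 < Re u} \<inter> {u. Re u < 2})" by (intro open_Int open_halfspace_Re_gt open_halfspace_Re_lt)
  have "Complex (3/2) 0 \<in> {u. 1 < Re u} \<inter> {u. Re u < 2}" by simp
  then show "{u. 1 < Re u} \<inter> {u. Re u < 2} \<noteq> {}" by blast
  have "z = 0" if "1 - z = 1" for z :: complex using that by simp
  then show "(\<lambda>u. zeta (1 - u)) holomorphic_on {u. Re u > 0} - {1}"
    by (intro holomorphic_intros) auto
  show "(\<lambda>u. 2 * (2 * of_real pi) powr (- u) * cos (of_real pi * u / 2) * Gamma u * zeta u) holomorphic_on {u. Re u > 0} - {1}"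
    by (intro holomorphic_intros holomorphic_Gamma) (auto elim!: nonpos_Ints_cases')
  fix z assume z: "z \<in> {u. 1 < Re u} \<inter> {u. Re u < 2}"
  have "zeta (1 - z) = zeta_Mellin (1 - z)" using z by (intro zeta_eq_zeta_Mellin) auto
  also have "\<dots> = 2 * (2 * of_real pi) powr (1 - z - 1) * sin (of_real pi * (1 - z) / 2) * Gamma (1 - (1 - z)) * zeta_Mellin (1 - (1 - z))"
    using z by (intro zeta_Mellin_functional_equation) auto
  also have "zeta_Mellin (1 - (1 - z)) = zeta z" using z by (subst zeta_eq_zeta_Mellin) auto
  also have "sin (of_real pi * (1 - z) / 2) = cos (of_real pi * z / 2)"
    by (simp add: right_diff_distrib diff_divide_distrib sin_diff)
  finally show "zeta (1 - z) = 2 * (2 * of_real pi) powr (- z) * cos (of_real pi * z / 2) * Gamma z * zeta z"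
    by simp
qed (use assms in \<open>auto intro!: open_halfspace_Re_gt open_Diff connected_halfplane_delete\<close>)

text \<open>At 0 both terms containing rGamma(s) vanish, and - rGamma(1) / 2 remains.\<close>

lemma zeta_0: "zeta 0 = - 1 / 2"
  by (simp add: zeta_eq_zeta_Mellin zeta_Mellin_def)

section \<open>Residue at 1 and growth in vertical strips\<close>

text \<open>With N = n + 1, this is s - 1 times the difference of N^(-s) and the integral of t^(-s)
  over [N, N + 1]. The factor s - 1 keeps the terms entire and removes the pole of zeta.\<close>

definition zeta_term :: "nat \<Rightarrow> complex \<Rightarrow> complex" where
  "zeta_term n s = (s - 1) * of_nat (Suc n) powr (- s) + of_nat (Suc (Suc n)) powr (1 - s) - of_nat (Suc n) powr (1 - s)"

text \<open>A first-order Taylor remainder of x powr (1 - s) on [n + 1, n + 2]; the modulus of the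
  second derivative is largest at the left end.\<close>

lemma norm_zeta_term_le:
  assumes s: "Re s > 0"
  shows "norm (zeta_term n s) \<le> norm s * norm (s - 1) * real (Suc n) powr (- Re s - 1)"
proof -
  let ?w = "of_nat (Suc n) :: complex" and ?z = "of_nat (Suc (Suc n)) :: complex"
  \<comment> \<open>The function x powr (1 - s) followed by its first two derivatives, in the
    indexed form that \<open>complex_Taylor\<close> expects.\<close>
  define f :: "nat \<Rightarrow> complex \<Rightarrow> complex" where
    "f i x = (if i = 0 then x powr (1 - s) else if i = 1 then (1 - s) * x powr (- s) else (1 - s) * (- s) * x powr (- s - 1))" for i x
  let ?B = "norm s * norm (s - 1) * real (Suc n) powr (- Re s - 1)"
  have seg: "\<exists>r. x = of_real r \<and> real (Suc n) \<le> r" if "x \<in> closed_segment ?w ?z" for x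
  proof -
    have "?w = of_real (real (Suc n))" "?z = of_real (real (Suc (Suc n)))" by simp_all
    then show ?thesis using that closed_segment_of_real[of "real (Suc n)" "real (Suc (Suc n))", where 'a = complex]
      by (auto simp: closed_segment_eq_real_ivl simp del: of_nat_Suc)
  qed
  have "norm (f 0 ?z - (\<Sum>i\<le>1. f i ?w * (?z - ?w) ^ i / fact i)) \<le> ?B * norm (?z - ?w) ^ Suc 1 / fact 1"
  proof (rule complex_Taylor[of "closed_segment ?w ?z"])
    fix i :: nat and x assume x: "x \<in> closed_segment ?w ?z" and i: "i \<le> 1"
    obtain r where r: "x = of_real r" "real (Suc n) \<le> r" using seg[OF x] by blast
    have nn: "x \<notin> \<real>\<^sub>\<le>\<^sub>0" using r by auto
    have f: "f 0 = (\<lambda>x. x powr (1 - s))" "f 1 = (\<lambda>x. (1 - s) * x powr (- s))"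
        "f (Suc 1) = (\<lambda>x. (1 - s) * (- s * x powr (- s - 1)))"
      by (simp_all add: f_def fun_eq_iff)
    have "(f 0 has_field_derivative f (Suc 0) x) (at x within closed_segment ?w ?z)"
      using has_field_derivative_at_within[OF has_field_derivative_powr[OF nn, of "1 - s"]] f by simp
    moreover have "(f 1 has_field_derivative f (Suc 1) x) (at x within closed_segment ?w ?z)"
      unfolding f by (rule has_field_derivative_at_within[OF DERIV_cmult[OF has_field_derivative_powr[OF nn]]])
    ultimately show "(f i has_field_derivative f (Suc i) x) (at x within closed_segment ?w ?z)"
      using i by (cases i) auto
  next
    fix x assume x: "x \<in> closed_segment ?w ?z"
    obtain r where r: "x = of_real r" "real (Suc n) \<le> r" using seg[OF x] by blast
    have "norm (f (Suc 1) x) = norm s * norm (s - 1) * r powr (- Re s - 1)"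
      using r by (simp add: f_def norm_mult norm_powr_real_powr norm_minus_commute)
    also have "r powr (- Re s - 1) \<le> real (Suc n) powr (- Re s - 1)"
      using r s by (intro powr_mono2') auto
    finally show "norm (f (Suc 1) x) \<le> ?B" by (simp add: mult_left_mono)
  qed auto
  moreover have "f 0 ?z - (\<Sum>i\<le>1. f i ?w * (?z - ?w) ^ i / fact i) = zeta_term n s"
    by (simp add: f_def zeta_term_def algebra_simps)
  ultimately show ?thesis by simp
qed

lemma summable_Suc_powr: "a < - 1 \<Longrightarrow> summable (\<lambda>n. real (Suc n) powr a)"
  by (subst summable_Suc_iff[of "\<lambda>n. real n powr a"]) (simp add: summable_real_powr_iff)

lemma summable_norm_zeta_term:
  assumes s: "Re s > 0"
  shows "summable (\<lambda>n. norm (zeta_term n s))"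
proof (rule summable_comparison_test[OF _ summable_mult[OF summable_Suc_powr]])
  show "\<exists>N. \<forall>n\<ge>N. norm (norm (zeta_term n s)) \<le> norm s * norm (s - 1) * real (Suc n) powr (- Re s - 1)"
    using norm_zeta_term_le[OF s] by simp
qed (use s in auto)

text \<open>The series is an integral against counting measure, so
  \<open>holomorphic_integral\<close> applies with a summable majorant uniform near each
  point.\<close>

lemma holomorphic_suminf_zeta_term: "(\<lambda>s. \<Sum>n. zeta_term n s) holomorphic_on {s. Re s > 0}"
proof -
  have "(\<lambda>s. \<integral>n. zeta_term n s \<partial>count_space UNIV) holomorphic_on {s. Re s > 0}"
  proof (rule holomorphic_integral)
    show "open {s. Re s > 0}" by (rule open_halfspace_Re_gt)
    show "(\<lambda>z. zeta_term n z) holomorphic_on {s. Re s > 0}" for n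
      unfolding zeta_term_def by (intro holomorphic_intros)
    fix z :: complex assume z: "z \<in> {s. Re s > 0}"
    define e where "e = Re z / 2"
    show "\<exists>e>0. \<exists>g. integrable (count_space UNIV) g \<and> (\<forall>w\<in>ball z e \<inter> {s. Re s > 0}. \<forall>n\<in>space (count_space UNIV). norm (zeta_term n w) \<le> g n)"
    proof (intro exI conjI ballI)
      show e: "e > 0" using z by (simp add: e_def)
      show "integrable (count_space UNIV) (\<lambda>n. (norm z + e) * (norm z + e + 1) * real (Suc n) powr (- e - 1))"
        using e by (simp add: integrable_count_space_nat_iff abs_mult summable_mult summable_Suc_powr del: of_nat_Suc)
      fix w n assume w: "w \<in> ball z e \<inter> {s. Re s > 0}"
      have d: "norm (z - w) < e" using w by (simp add: dist_norm)
      have "\<bar>Re (z - w)\<bar> \<le> norm (z - w)" by (rule abs_Re_le_cmod)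
      with d have re: "e \<le> Re w" by (simp add: e_def)
      have nw: "norm w \<le> norm z + e" using d norm_triangle_ineq2[of w z] by (simp add: norm_minus_commute)
      have "norm (w - 1) \<le> norm w + 1" using norm_triangle_ineq4[of w 1] by simp
      then have nw1: "norm (w - 1) \<le> norm z + e + 1" using nw by simp
      have "norm (zeta_term n w) \<le> norm w * norm (w - 1) * real (Suc n) powr (- Re w - 1)"
        using w by (intro norm_zeta_term_le) auto
      also have "\<dots> \<le> (norm z + e) * (norm z + e + 1) * real (Suc n) powr (- e - 1)"
        using nw nw1 re e by (intro mult_mono powr_mono) auto
      finally show "norm (zeta_term n w) \<le> (norm z + e) * (norm z + e + 1) * real (Suc n) powr (- e - 1)" .
    qed
  qed auto
  then show ?thesis
    by (rule holomorphic_transform)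
       (use summable_norm_zeta_term in \<open>auto intro!: integral_count_space_nat simp: integrable_count_space_nat_iff\<close>)
qed

text \<open>For Re s > 1 the differences telescope to -1; the identity theorem extends the equation
  to Re s > 0, where the series still converges absolutely.\<close>

lemma zeta_eq_suminf_zeta_term:
  assumes s: "Re s > 0" "s \<noteq> 1"
  shows "(s - 1) * zeta s = 1 + (\<Sum>n. zeta_term n s)"
proof (rule analytic_continuation_open[of "{s. Re s > 1}" "{s. Re s > 0} - {1}" "\<lambda>s. (s - 1) * zeta s" "\<lambda>s. 1 + (\<Sum>n. zeta_term n s)" s])
  show "{s. Re s > 1} \<noteq> {}" by (rule ex_in_conv[THEN iffD1]) (auto intro!: exI[of _ 2])
  show "(\<lambda>s. (s - 1) * zeta s) holomorphic_on {s. Re s > 0} - {1}"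
    by (intro holomorphic_intros) auto
  have "(\<lambda>s. \<Sum>n. zeta_term n s) holomorphic_on {s. Re s > 0} - {1}"
    using holomorphic_suminf_zeta_term by (rule holomorphic_on_subset) auto
  then show "(\<lambda>s. 1 + (\<Sum>n. zeta_term n s)) holomorphic_on {s. Re s > 0} - {1}"
    by (intro holomorphic_intros)
  fix z assume "z \<in> {s. Re s > 1}"
  then have z: "Re z > 1" by simp
  have "(\<lambda>n. of_nat (Suc (Suc n)) powr (1 - z) - of_nat (Suc n) powr (1 - z)) sums (0 - of_nat (Suc 0) powr (1 - z))"
  proof (rule telescope_sums)
    have "(\<lambda>n. norm (of_nat (Suc n) powr (1 - z))) \<longlonglongrightarrow> 0"
    proof -
      have "norm (of_nat (Suc n) powr (1 - z)) = real (Suc n) powr (1 - Re z)" for n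
        using norm_powr_real_powr[of "of_nat (Suc n)" "1 - z"] by (simp del: of_nat_Suc)
      moreover have "(\<lambda>n. real (Suc n) powr (1 - Re z)) \<longlonglongrightarrow> 0"
        using z by (intro LIMSEQ_Suc tendsto_neg_powr filterlim_real_sequentially) auto
      ultimately show ?thesis by simp
    qed
    then show "(\<lambda>n. of_nat (Suc n) powr (1 - z)) \<longlonglongrightarrow> 0" by (rule tendsto_norm_zero_cancel)
  qed
  from sums_add[OF sums_mult[OF zeta_sums[OF z], of "z - 1"] this]
  have "(\<lambda>n. zeta_term n z) sums ((z - 1) * zeta z + (0 - 1))"
    by (simp add: zeta_term_def add_diff_eq)
  then show "(z - 1) * zeta z = 1 + (\<Sum>n. zeta_term n z)" by (simp add: sums_iff)
qed (use s in \<open>auto intro!: open_halfspace_Re_gt open_Diff connected_halfplane_delete\<close>)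

text \<open>All \<open>zeta_term n 1\<close> vanish, so the right-hand side of the preceding
  identity is continuous at 1 with value 1.\<close>

lemma zeta_residue: "((\<lambda>s. zeta s * (s - 1)) \<longlongrightarrow> 1) (at 1)"
proof (rule Lim_transform_eventually)
  have zt: "zeta_term n 1 = 0" for n by (simp add: zeta_term_def del: of_nat_Suc)
  have "continuous_on {s. Re s > 0} (\<lambda>s. 1 + (\<Sum>n. zeta_term n s))"
    by (intro continuous_intros holomorphic_on_imp_continuous_on holomorphic_suminf_zeta_term)
  then have "isCont (\<lambda>s. 1 + (\<Sum>n. zeta_term n s)) 1"
    by (simp add: continuous_on_eq_continuous_at open_halfspace_Re_gt)
  then show "((\<lambda>s. 1 + (\<Sum>n. zeta_term n s)) \<longlongrightarrow> 1) (at 1)"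
    using zt by (simp add: isCont_def)
  have "\<forall>\<^sub>F s in at 1. s \<in> {s. Re s > 0} \<and> s \<noteq> (1 :: complex)"
    using open_halfspace_Re_gt[of 0] by (intro eventually_conj eventually_at_in_open' eventually_neq_at_within) auto
  then show "\<forall>\<^sub>F s in at 1. 1 + (\<Sum>n. zeta_term n s) = zeta s * (s - 1)"
    by eventually_elim (simp add: zeta_eq_suminf_zeta_term[symmetric] mult.commute)
qed

text \<open>The terms are at most |s| |s - 1| n^(-3/2); dividing by s - 1 leaves linear growth in
  |Im s|, which any exponential absorbs.\<close>

lemma zeta_growth_right:
  assumes e: "\<epsilon> > 0"
  shows "\<exists>C\<ge>0. \<forall>s. 1/2 \<le> Re s \<and> Re s \<le> b \<and> 1 \<le> \<bar>Im s\<bar> \<longrightarrow> norm (zeta s) \<le> C * exp (\<epsilon> * \<bar>Im s\<bar>)"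
proof -
  define K where "K = (\<Sum>n. real (Suc n) powr (- 3 / 2))"
  have Ksum: "summable (\<lambda>n. real (Suc n) powr (- 3 / 2))" by (rule summable_Suc_powr) simp
  have K: "K \<ge> 0" unfolding K_def by (rule suminf_nonneg[OF Ksum]) simp
  define C where "C = 1 + K * \<bar>b\<bar> + K / \<epsilon>"
  have C: "C \<ge> 0" using K e by (simp add: C_def)
  show ?thesis
  proof (intro exI[of _ C] conjI allI impI C)
    fix s assume s: "1/2 \<le> Re s \<and> Re s \<le> b \<and> 1 \<le> \<bar>Im s\<bar>"
    have s1: "s \<noteq> 1" "Re s > 0" using s by auto
    have n1: "1 \<le> norm (s - 1)" using s abs_Im_le_cmod[of "s - 1"] by simp
    have "norm (\<Sum>n. zeta_term n s) \<le> (\<Sum>n. norm (zeta_term n s))"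
      by (rule summable_norm[OF summable_norm_zeta_term[OF s1(2)]])
    also have "\<dots> \<le> (\<Sum>n. norm s * norm (s - 1) * real (Suc n) powr (- 3 / 2))"
    proof (rule suminf_le[OF _ summable_norm_zeta_term[OF s1(2)] summable_mult[OF Ksum]])
      fix n
      have "norm (zeta_term n s) \<le> norm s * norm (s - 1) * real (Suc n) powr (- Re s - 1)"
        by (rule norm_zeta_term_le[OF s1(2)])
      also have "\<dots> \<le> norm s * norm (s - 1) * real (Suc n) powr (- 3 / 2)"
        using s by (intro mult_left_mono powr_mono) auto
      finally show "norm (zeta_term n s) \<le> norm s * norm (s - 1) * real (Suc n) powr (- 3 / 2)" .
    qed
    also have "\<dots> = norm s * norm (s - 1) * K" unfolding K_def by (rule suminf_mult[OF Ksum])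
    finally have T: "norm (\<Sum>n. zeta_term n s) \<le> norm s * norm (s - 1) * K" .
    have "norm (s - 1) * norm (zeta s) = norm (1 + (\<Sum>n. zeta_term n s))"
      by (simp add: zeta_eq_suminf_zeta_term[OF s1(2,1), symmetric] norm_mult)
    also have "\<dots> \<le> 1 + norm s * norm (s - 1) * K"
      using norm_triangle_ineq[of 1 "\<Sum>n. zeta_term n s"] T by simp
    also have "\<dots> \<le> norm (s - 1) * (1 + K * norm s)"
      using n1 by (simp add: algebra_simps)
    finally have "norm (zeta s) \<le> 1 + K * norm s"
      by (rule mult_left_le_imp_le) (use n1 in linarith)
    also have "norm s \<le> \<bar>b\<bar> + \<bar>Im s\<bar>" using s cmod_le[of s] by simp
    also have "\<bar>Im s\<bar> \<le> exp (\<epsilon> * \<bar>Im s\<bar>) / \<epsilon>"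
    proof -
      have "\<epsilon> * \<bar>Im s\<bar> \<le> exp (\<epsilon> * \<bar>Im s\<bar>)"
        using exp_ge_add_one_self[of "\<epsilon> * \<bar>Im s\<bar>"] by linarith
      then show ?thesis using e by (simp add: pos_le_divide_eq mult.commute)
    qed
    also have "1 + K * (\<bar>b\<bar> + exp (\<epsilon> * \<bar>Im s\<bar>) / \<epsilon>) \<le> C * exp (\<epsilon> * \<bar>Im s\<bar>)"
    proof -
      have "(1 + K * \<bar>b\<bar>) * 1 \<le> (1 + K * \<bar>b\<bar>) * exp (\<epsilon> * \<bar>Im s\<bar>)"
        using K e by (intro mult_left_mono) auto
      then show ?thesis by (simp add: C_def algebra_simps)
    qed
    finally show "norm (zeta s) \<le> C * exp (\<epsilon> * \<bar>Im s\<bar>)" using K by (simp add: mult_left_mono)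
  qed
qed

lemma norm_cos_le: "norm (cos z) \<le> exp \<bar>Im z\<bar>" for z :: complex
proof -
  have "norm (cos z) \<le> (norm (exp (\<i> * z)) + norm (exp (- (\<i> * z)))) / 2"
    unfolding cos_exp_eq norm_divide using norm_triangle_ineq[of "exp (\<i> * z)" "exp (- (\<i> * z))"] by simp
  also have "\<dots> \<le> (exp \<bar>Im z\<bar> + exp \<bar>Im z\<bar>) / 2" by (intro divide_right_mono add_mono) (auto simp: norm_exp)
  finally show ?thesis by simp
qed

text \<open>To the left of Re s = 1/2 the functional equation applies: the growth exp (pi |Im u| /
  2) of the cosine is compensated by the decay of Gamma, and the losses \<epsilon>/2 of Gamma and of
  zeta(u) add up to \<epsilon>.\<close>

theorem zeta_growth:
  fixes a b :: real
  assumes e: "\<epsilon> > 0"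
  shows "\<exists>C\<ge>0. \<forall>s. a \<le> Re s \<and> Re s \<le> b \<and> 1 \<le> \<bar>Im s\<bar> \<longrightarrow> norm (zeta s) \<le> C * exp (\<epsilon> * \<bar>Im s\<bar>)"
proof -
  have e2: "\<epsilon> / 2 > 0" using e by simp
  obtain C1 where C1: "C1 \<ge> 0" "\<And>s. 1/2 \<le> Re s \<Longrightarrow> Re s \<le> b \<Longrightarrow> 1 \<le> \<bar>Im s\<bar> \<Longrightarrow> norm (zeta s) \<le> C1 * exp (\<epsilon> * \<bar>Im s\<bar>)"
    using zeta_growth_right[OF e, of b] by blast
  obtain C2 where C2: "C2 \<ge> 0" "\<And>s. 1/2 \<le> Re s \<Longrightarrow> Re s \<le> 1 - a \<Longrightarrow> 1 \<le> \<bar>Im s\<bar> \<Longrightarrow> norm (zeta s) \<le> C2 * exp (\<epsilon> / 2 * \<bar>Im s\<bar>)"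
    using zeta_growth_right[OF e2, of "1 - a"] by blast
  obtain C3 where C3: "C3 \<ge> 0" "\<And>s. 1/2 \<le> Re s \<Longrightarrow> Re s \<le> 1 - a \<Longrightarrow> 1 \<le> \<bar>Im s\<bar> \<Longrightarrow> norm (Gamma s) \<le> C3 * exp (- (pi / 2 - \<epsilon> / 2) * \<bar>Im s\<bar>)"
    using Gamma_decay[OF e2, of "1/2" "1 - a"] by blast
  define C where "C = C1 + 2 * C3 * C2"
  have C: "C \<ge> 0" "C1 \<le> C" "2 * C3 * C2 \<le> C" using C1 C2 C3 by (auto simp: C_def)
  show ?thesis
  proof (intro exI[of _ C] conjI allI impI C(1))
    fix s assume s: "a \<le> Re s \<and> Re s \<le> b \<and> 1 \<le> \<bar>Im s\<bar>"
    show "norm (zeta s) \<le> C * exp (\<epsilon> * \<bar>Im s\<bar>)"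
    proof (cases "1/2 \<le> Re s")
      case True
      then have "norm (zeta s) \<le> C1 * exp (\<epsilon> * \<bar>Im s\<bar>)" using C1(2) s by blast
      also have "\<dots> \<le> C * exp (\<epsilon> * \<bar>Im s\<bar>)" using C(2) by (intro mult_right_mono) auto
      finally show ?thesis .
    next
      case False
      define u where "u = 1 - s"
      have u: "1/2 \<le> Re u" "Re u \<le> 1 - a" "\<bar>Im u\<bar> = \<bar>Im s\<bar>" "1 \<le> \<bar>Im u\<bar>" using False s by (auto simp: u_def)
      have "u \<noteq> 1" using u(4) by auto
      then have "zeta s = 2 * (2 * of_real pi) powr (- u) * cos (of_real pi * u / 2) * Gamma u * zeta u"
        using zeta_functional_equation[of u] u by (simp add: u_def)
      then have "norm (zeta s) = 2 * (2 * pi) powr (- Re u) * norm (cos (of_real pi * u / 2)) * norm (Gamma u) * norm (zeta u)"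
        using norm_powr_real_powr[of "2 * of_real pi" "- u"] by (simp add: norm_mult)
      also have "\<dots> \<le> 2 * 1 * exp (pi / 2 * \<bar>Im u\<bar>) * (C3 * exp (- (pi / 2 - \<epsilon> / 2) * \<bar>Im u\<bar>)) * (C2 * exp (\<epsilon> / 2 * \<bar>Im u\<bar>))"
      proof -
        have "(2 * pi) powr (- Re u) \<le> (2 * pi) powr 0" using u pi_gt3 by (intro powr_mono) auto
        then have p: "(2 * pi) powr (- Re u) \<le> 1" by simp
        have c: "norm (cos (of_real pi * u / 2)) \<le> exp (pi / 2 * \<bar>Im u\<bar>)"
          using norm_cos_le[of "of_real pi * u / 2"] by (simp add: abs_mult)
        show ?thesis
          by (rule mult_mono[OF mult_mono[OF mult_mono[OF mult_left_mono[OF p] c] C3(2)[OF u(1,2,4)]] C2(2)[OF u(1,2,4)]])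
             (use C2 C3 in auto)
      qed
      also have "\<dots> = 2 * C3 * C2 * exp (\<epsilon> * \<bar>Im s\<bar>)"
        unfolding u(3) by (simp add: field_simps flip: exp_add)
      also have "\<dots> \<le> C * exp (\<epsilon> * \<bar>Im s\<bar>)" using C(3) by (intro mult_right_mono) auto
      finally show ?thesis .
    qed
  qed
qed

section \<open>Values at integers and Bernoulli numbers\<close>

text \<open>Each fraction expands into a geometric series in z^2 / (2 pi (n + 1))^2; exchanging the
  two summations collects zeta at the even numbers.\<close>

lemma even_zeta_power_series:
  fixes z :: complex
  assumes z: "norm z < 1"
  defines "a \<equiv> (\<lambda>n. 2 * of_real pi * of_nat (Suc n) :: complex)"
  shows "(\<lambda>j. 2 * (-1) ^ j * zeta (of_nat (2 * j + 2)) / (2 * of_real pi) ^ (2 * j + 2) * z ^ (2 * j + 2)) sums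
     (\<Sum>n. 2 * z ^ 2 / (z ^ 2 + a n ^ 2))"
proof -
  let ?M = "count_space (UNIV :: nat set)"
  define f where "f j n = 2 * (-1) ^ j * (z ^ 2 / a n ^ 2) ^ Suc j" for j n
  define q where "q = norm z ^ 2 / (2 * pi) ^ 2"
  have q: "0 \<le> q" "q < 1"
  proof -
    show "0 \<le> q" by (simp add: q_def)
    have "norm z ^ 2 < 1" using z by (simp add: power_less_one_iff)
    also have "1 \<le> (2 * pi) ^ 2" using pi_gt3 by (intro one_le_power) auto
    finally show "q < 1" by (simp add: q_def)
  qed
  have na: "norm (z ^ 2 / a n ^ 2) = q / real (Suc n) ^ 2" for n
    by (simp add: a_def q_def norm_divide norm_mult norm_power power_mult_distrib del: of_nat_Suc)
  have qn: "q / real (Suc n) ^ 2 \<le> q" for n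
  proof -
    have "q / real (Suc n) ^ 2 \<le> q / 1" using q by (intro divide_left_mono) auto
    then show ?thesis by simp
  qed
  have nf: "norm (f j n) = 2 * (q / real (Suc n) ^ 2) ^ Suc j" for j n
    by (simp only: f_def norm_mult norm_power na) simp
  \<comment> \<open>The power of \<open>q\<close> makes the majorant summable in j, and one factor
    1/(n + 1)^2 is kept for summability in n.\<close>
  have nf_le: "norm (f j n) \<le> 2 * q ^ Suc j * (1 / real (n + 1) ^ 2)" for j n
  proof -
    have "(1 / real (Suc n) ^ 2) ^ Suc j \<le> (1 / real (Suc n) ^ 2) ^ 1"
      by (intro power_decreasing) (auto simp: field_simps)
    then have "2 * q ^ Suc j * (1 / real (Suc n) ^ 2) ^ Suc j \<le> 2 * q ^ Suc j * (1 / real (Suc n) ^ 2)"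
      using q by (intro mult_left_mono) auto
    moreover have "(q / real (Suc n) ^ 2) ^ Suc j = q ^ Suc j * (1 / real (Suc n) ^ 2) ^ Suc j"
      by (simp only: power_mult_distrib[symmetric]) simp
    ultimately show ?thesis unfolding nf by (simp only: mult.assoc Suc_eq_plus1)
  qed
  have isq: "summable (\<lambda>n. 1 / real (n + 1) ^ 2)" using inverse_squares_sums by (auto simp: sums_iff add.commute)
  have sn: "summable (\<lambda>n. norm (f j n))" for j
    by (rule summable_comparison_test[OF _ summable_mult[OF isq]]) (use nf_le in auto)
  have int: "integrable ?M (f j)" for j using sn by (simp add: integrable_count_space_nat_iff)
  have sj: "summable (\<lambda>j. norm (f j n))" for n
  proof -
    have "norm (q / real (Suc n) ^ 2) = q / real (Suc n) ^ 2" using q by (simp del: of_nat_Suc)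
    also have "\<dots> < 1" using qn[of n] q(2) by (rule order.strict_trans1)
    finally have "norm (q / real (Suc n) ^ 2) < 1" .
    then
    have "summable (\<lambda>j. 2 * (q / real (Suc n) ^ 2) * (q / real (Suc n) ^ 2) ^ j)"
      by (intro summable_mult summable_geometric)
    then show ?thesis unfolding nf by (simp add: mult.assoc)
  qed
  have nint: "summable (\<lambda>j. \<integral>n. norm (f j n) \<partial>?M)"
  proof (rule summable_comparison_test)
    show "summable (\<lambda>j. 2 * q * (\<Sum>n. 1 / real (n + 1) ^ 2) * q ^ j)"
      using q by (intro summable_mult summable_geometric) simp
    show "\<exists>N. \<forall>j\<ge>N. norm (\<integral>n. norm (f j n) \<partial>?M) \<le> 2 * q * (\<Sum>n. 1 / real (n + 1) ^ 2) * q ^ j"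
    proof (intro exI allI impI)
      fix j
      have "(\<integral>n. norm (f j n) \<partial>?M) = (\<Sum>n. norm (f j n))"
        using sn[of j] by (intro integral_count_space_nat) (simp add: integrable_count_space_nat_iff)
      also have "\<dots> \<le> (\<Sum>n. 2 * q ^ Suc j * (1 / real (n + 1) ^ 2))"
        by (intro suminf_le nf_le sn summable_mult isq)
      also have "\<dots> = 2 * q * (\<Sum>n. 1 / real (n + 1) ^ 2) * q ^ j"
        by (subst suminf_mult[OF isq]) simp
      finally show "norm (\<integral>n. norm (f j n) \<partial>?M) \<le> 2 * q * (\<Sum>n. 1 / real (n + 1) ^ 2) * q ^ j"
        by (simp add: integral_nonneg_AE)
    qed
  qed
  have AE: "AE n in ?M. summable (\<lambda>j. norm (f j n))" using sj by simp
  have fsum: "(\<Sum>j. f j n) = 2 * z ^ 2 / (z ^ 2 + a n ^ 2)" for n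
  proof -
    let ?w = "z ^ 2 / a n ^ 2"
    have "norm (- ?w) \<le> q" using na[of n] qn[of n] by (simp only: norm_minus_cancel)
    then have w: "norm (- ?w) < 1" using q(2) by (rule order.strict_trans1)
    have an: "a n ^ 2 \<noteq> 0" by (simp add: a_def del: of_nat_Suc)
    have "(\<lambda>j. 2 * ?w * (- ?w) ^ j) sums (2 * ?w * (1 / (1 - (- ?w))))"
      by (intro sums_mult geometric_sums w)
    moreover have "f j n = 2 * ?w * (- ?w) ^ j" for j
      unfolding f_def power_minus[of ?w j] by simp
    ultimately have "(\<Sum>j. f j n) = 2 * ?w * (1 / (1 - (- ?w)))" by (simp add: sums_iff)
    also have "\<dots> = 2 * z ^ 2 / (z ^ 2 + a n ^ 2)"
    proof -
      have "1 - (- ?w) = (z ^ 2 + a n ^ 2) / a n ^ 2" using an by (simp add: field_simps)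
      then show ?thesis using an by simp
    qed
    finally show ?thesis .
  qed
  have "(\<lambda>j. \<integral>n. f j n \<partial>?M) sums (\<integral>n. (\<Sum>j. f j n) \<partial>?M)"
    by (rule sums_integral[OF int AE nint])
  also have "(\<integral>n. (\<Sum>j. f j n) \<partial>?M) = (\<Sum>n. \<Sum>j. f j n)"
    by (intro integral_count_space_nat integrable_suminf[OF int AE nint])
  also have "\<dots> = (\<Sum>n. 2 * z ^ 2 / (z ^ 2 + a n ^ 2))" by (simp only: fsum)
  also have "(\<lambda>j. \<integral>n. f j n \<partial>?M) =
     (\<lambda>j. 2 * (-1) ^ j * zeta (of_nat (2 * j + 2)) / (2 * of_real pi) ^ (2 * j + 2) * z ^ (2 * j + 2))"
  proof
    fix j
    have "(\<lambda>n. of_nat (Suc n) powr (- of_nat (2 * j + 2))) sums zeta (of_nat (2 * j + 2))"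
      by (rule zeta_sums) simp
    then have "(\<lambda>n. 2 * (-1) ^ j / (2 * of_real pi) ^ (2 * j + 2) * z ^ (2 * j + 2) * of_nat (Suc n) powr (- of_nat (2 * j + 2))) sums
       (2 * (-1) ^ j / (2 * of_real pi) ^ (2 * j + 2) * z ^ (2 * j + 2) * zeta (of_nat (2 * j + 2)))"
      by (rule sums_mult)
    moreover have "2 * (-1) ^ j / (2 * of_real pi) ^ (2 * j + 2) * z ^ (2 * j + 2) * of_nat (Suc n) powr (- of_nat (2 * j + 2)) = f j n" for n
    proof -
      have "complex_of_nat (Suc n) powr (- of_nat (2 * j + 2)) = inverse (of_nat (Suc n) ^ (2 * j + 2))"
        unfolding powr_minus by (subst powr_nat') auto
      moreover have "f j n = 2 * (-1) ^ j * (z ^ (2 * j + 2) / ((2 * of_real pi) ^ (2 * j + 2) * of_nat (Suc n) ^ (2 * j + 2)))"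
        unfolding f_def a_def power_divide power_mult_distrib power_mult[symmetric] by simp
      ultimately show ?thesis by (simp only: divide_inverse inverse_mult_distrib mult_ac)
    qed
    ultimately have "(\<lambda>n. f j n) sums (2 * (-1) ^ j / (2 * of_real pi) ^ (2 * j + 2) * z ^ (2 * j + 2) * zeta (of_nat (2 * j + 2)))"
      by (simp only:)
    then have "(\<Sum>n. f j n) = 2 * (-1) ^ j / (2 * of_real pi) ^ (2 * j + 2) * z ^ (2 * j + 2) * zeta (of_nat (2 * j + 2))"
      by (simp only: sums_iff)
    then show "(\<integral>n. f j n \<partial>?M) = 2 * (-1) ^ j * zeta (of_nat (2 * j + 2)) / (2 * of_real pi) ^ (2 * j + 2) * z ^ (2 * j + 2)"
      unfolding integral_count_space_nat[OF int] by (simp only: divide_inverse mult_ac)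
  qed
  finally show ?thesis .
qed

text \<open>Added to 1 - X/2, this is the expansion of z/(e^z - 1) that its partial fractions
  provide.\<close>

definition zeta_fps :: "complex fps" where
  "zeta_fps = Abs_fps (\<lambda>m. if m > 0 \<and> even m then 2 * (-1) ^ (m div 2 - 1) * zeta (of_nat m) / (2 * of_real pi) ^ m else 0)"

text \<open>The identity holds between analytic functions near 0, and uniqueness of the expansion
  transfers it to formal power series.\<close>

lemma zeta_fps_mult_exp: "(1 - fps_const (1/2) * fps_X + zeta_fps) * (fps_exp 1 - 1) = fps_X"
proof -
  define g where "g z = (\<Sum>n. 2 * z ^ 2 / (z ^ 2 + (2 * of_real pi * of_nat (Suc n)) ^ 2))" for z :: complex
  have ev: "\<forall>\<^sub>F z in nhds 0. norm (z :: complex) < 1"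
    using eventually_nhds_in_open[of "ball 0 1" "0 :: complex"] by simp
  have "g has_fps_expansion zeta_fps"
  proof (rule has_fps_expansionI)
    show "\<forall>\<^sub>F z in nhds 0. (\<lambda>n. fps_nth zeta_fps n * z ^ n) sums g z"
      using ev
    proof eventually_elim
      fix z :: complex assume z: "norm z < 1"
      have mono: "strict_mono (\<lambda>j::nat. 2 * j + 2)" by (auto simp: strict_mono_def)
      have zero: "fps_nth zeta_fps n * z ^ n = 0" if "n \<notin> range (\<lambda>j. 2 * j + 2)" for n
      proof -
        have "\<not> (n > 0 \<and> even n)"
        proof
          assume "n > 0 \<and> even n"
          then have "n = 2 * (n div 2 - 1) + 2" by auto
          then show False using that by blast
        qed
        then show ?thesis by (auto simp: zeta_fps_def)
      qed
      have "(\<lambda>j. fps_nth zeta_fps (2 * j + 2) * z ^ (2 * j + 2)) sums g z"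
        using even_zeta_power_series[OF z] unfolding g_def zeta_fps_def by simp
      then show "(\<lambda>n. fps_nth zeta_fps n * z ^ n) sums g z"
        by (subst sums_mono_reindex[where f = "\<lambda>n. fps_nth zeta_fps n * z ^ n", OF mono zero, symmetric])
    qed
  qed
  then have "(\<lambda>z. (1 - 1/2 * z + g z) * (exp z - 1)) has_fps_expansion (1 - fps_const (1/2) * fps_X + zeta_fps) * (fps_exp 1 - 1)"
    by (intro fps_expansion_intros)
  moreover have "(\<lambda>z. (1 - 1/2 * z + g z) * (exp z - 1)) has_fps_expansion fps_X"
  proof (rule has_fps_expansion_cong[THEN iffD1])
    show "(\<lambda>z :: complex. z) has_fps_expansion fps_X" by (rule has_fps_expansion_fps_X)
    show "\<forall>\<^sub>F z in nhds 0. z = (1 - 1/2 * z + g z) * (exp z - 1)"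
      using ev
    proof eventually_elim
      fix z :: complex assume z: "norm z < 1"
      show "z = (1 - 1/2 * z + g z) * (exp z - 1)"
      proof (cases "z = 0")
        case False
        have e: "exp z \<noteq> 1"
        proof
          assume "exp z = 1"
          then obtain n :: int where n: "Re z = 0" "Im z = of_int (2 * n) * pi" by (auto simp: exp_eq_1)
          have "n \<noteq> 0" using n False by (auto simp: complex_eq_iff)
          then have "1 \<le> \<bar>real_of_int n\<bar>" by linarith
          then have "pi \<le> \<bar>real_of_int n\<bar> * pi" using pi_gt_zero by (metis mult_1 mult_right_mono less_imp_le)
          then have "pi \<le> \<bar>Im z\<bar>" using n by (simp add: abs_mult)
          then show False using z abs_Im_le_cmod[of z] pi_gt3 by linarith
        qed
        from sums_mult[OF exp_partial_fractions[OF e], of z]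
        have "(\<lambda>n. 2 * z ^ 2 / (z ^ 2 + (2 * of_real pi * of_nat (Suc n)) ^ 2)) sums (z * (1 / (exp z - 1) - 1 / z + 1 / 2))"
          by (simp add: power2_eq_square mult_ac del: of_nat_Suc)
        then have "g z = z * (1 / (exp z - 1) - 1 / z + 1 / 2)" unfolding g_def by (simp add: sums_iff)
        also have "\<dots> = z / (exp z - 1) - 1 + z / 2" using False by (simp add: ring_distribs)
        finally have "1 - 1/2 * z + g z = z / (exp z - 1)" by simp
        then show ?thesis using e by simp
      qed simp
    qed
  qed auto
  ultimately show ?thesis by (rule fps_expansion_unique_complex)
qed

text \<open>Both series become X when multiplied by exp - 1. The Bernoulli series is a quotient of
  real series, so divisibility is checked there and the coefficients are embedded into the complex
  numbers before cancelling.\<close>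

lemma bernoulli_fps_eq: "fps_nth (1 - fps_const (1/2) * fps_X + zeta_fps) n = of_real (bernoulli n / fact n)"
proof -
  let ?E = "fps_exp 1 - 1 :: real fps" and ?Ec = "fps_exp 1 - 1 :: complex fps"
  define B where "B = fps_X / ?E"
  have E1: "fps_nth ?E 1 \<noteq> 0" by simp
  then have Enz: "?E \<noteq> 0" by (metis fps_zero_nth)
  have "subdegree ?E \<le> 1" using E1 by (rule subdegree_leI)
  then have "?E dvd fps_X" by (subst fps_dvd_iff[OF Enz]) auto
  then have "B * ?E = fps_X" unfolding B_def by (rule dvd_div_mult_self)
  then have B: "(\<Sum>i=0..n. fps_nth B i * fps_nth ?E (n - i)) = fps_nth fps_X n" for n
    by (simp only: fps_mult_nth[symmetric])
  have "Abs_fps (\<lambda>n. complex_of_real (fps_nth B n)) * ?Ec = fps_X"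
  proof (rule fps_ext)
    fix n
    have "fps_nth (Abs_fps (\<lambda>n. complex_of_real (fps_nth B n)) * ?Ec) n = of_real (\<Sum>i=0..n. fps_nth B i * fps_nth ?E (n - i))"
      by (auto simp add: fps_mult_nth intro!: sum.cong)
    then show "fps_nth (Abs_fps (\<lambda>n. complex_of_real (fps_nth B n)) * ?Ec) n = fps_nth fps_X n"
      unfolding B by simp
  qed
  then have "(1 - fps_const (1/2) * fps_X + zeta_fps) * ?Ec = Abs_fps (\<lambda>n. complex_of_real (fps_nth B n)) * ?Ec"
    by (simp only: zeta_fps_mult_exp)
  moreover have "fps_nth ?Ec 1 \<noteq> 0" by simp
  then have "?Ec \<noteq> 0" by (metis fps_zero_nth)
  ultimately have "1 - fps_const (1/2) * fps_X + zeta_fps = Abs_fps (\<lambda>n. complex_of_real (fps_nth B n))"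
    by (simp only: mult_cancel_right) simp
  then show ?thesis by (simp add: bernoulli_def B_def)
qed

text \<open>Comparison of coefficients in two expansions of z/(e^z - 1). For n = 0 the value zeta(0)
  = -1/2 fits the same formula; that case gives the last term of \<open>R_rest\<close>.\<close>

theorem zeta_even_nat:
  "zeta (of_nat (2 * n)) = (-1) ^ (n + 1) * of_real (bernoulli (2 * n) * (2 * pi) ^ (2 * n) / (2 * fact (2 * n)))"
proof (cases "n = 0")
  case True
  have "bernoulli 0 = 1" using bernoulli_fps_eq[of 0] by (simp add: zeta_fps_def)
  then show ?thesis using True by (simp add: zeta_0)
next
  case False
  then obtain j where j: "n = Suc j" by (cases n) auto
  have "complex_of_real (bernoulli (2 * n) / fact (2 * n)) = 2 * (-1) ^ j * zeta (of_nat (2 * n)) / (2 * of_real pi) ^ (2 * n)"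
    unfolding bernoulli_fps_eq[symmetric] using j by (simp add: zeta_fps_def del: of_nat_mult of_nat_Suc)
  then have "(-1) ^ j * complex_of_real (bernoulli (2 * n) / fact (2 * n)) * (2 * of_real pi) ^ (2 * n) / 2 =
      ((-1) ^ j * (-1) ^ j) * zeta (of_nat (2 * n))"
    by (simp del: of_nat_mult)
  also have "(-1) ^ j * (-1) ^ j = (1 :: complex)" by (simp flip: power_mult_distrib)
  finally have "zeta (of_nat (2 * n)) = (-1) ^ j * of_real (bernoulli (2 * n) / fact (2 * n)) * (2 * of_real pi) ^ (2 * n) / 2"
    by (simp only: mult_1_left)
  moreover have "(-1) ^ (n + 1) = (-1 :: complex) ^ j" by (simp add: j)
  moreover have "(2 * complex_of_real pi) ^ (2 * n) = of_real ((2 * pi) ^ (2 * n))" by simp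
  ultimately show ?thesis by (simp only: of_real_mult of_real_divide of_real_numeral of_real_fact times_divide_eq_right times_divide_eq_left divide_divide_eq_left mult_ac)
qed

text \<open>The functional equation at u = m + 1 = 2 n, where the cosine is (-1)^n, combined with
  Euler's value of zeta(2 n): powers of 2 pi and signs cancel.\<close>

theorem zeta_neg_odd_nat:
  assumes "odd m"
  shows "zeta (- of_nat m) = - of_real (bernoulli (m + 1) / real (m + 1))"
proof -
  obtain n where n: "m + 1 = 2 * n" "n > 0" using assms by (metis Suc_eq_plus1 even_Suc evenE gr0I mult_0_right nat.distinct(1))
  have m: "of_nat m = (of_nat (2 * n) - 1 :: complex)" using n(1) by (metis add_diff_cancel_right' of_nat_1 of_nat_add)
  have fe: "zeta (1 - of_nat (2 * n)) = 2 * (2 * of_real pi) powr (- of_nat (2 * n)) * cos (of_real pi * of_nat (2 * n) / 2) * Gamma (of_nat (2 * n)) * zeta (of_nat (2 * n))"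
  proof (rule zeta_functional_equation)
    show "complex_of_nat (2 * n) \<noteq> 1" unfolding of_nat_eq_1_iff by presburger
  qed (use n in simp)
  have pw: "(2 * complex_of_real pi) powr (- of_nat (2 * n)) = inverse (of_real ((2 * pi) ^ (2 * n)))"
    unfolding powr_minus by (subst powr_nat') (use n in auto)
  have cs: "cos (complex_of_real pi * of_nat (2 * n) / 2) = of_real ((-1) ^ n)"
  proof -
    have "complex_of_real pi * of_nat (2 * n) / 2 = of_real (real n * pi)" by simp
    then show ?thesis by (simp only: cos_of_real cos_npi)
  qed
  have G: "Gamma (of_nat (2 * n)) = complex_of_real (fact (2 * n) / real (2 * n))"
  proof -
    obtain l where l: "2 * n = Suc l" using n by (cases "2 * n") auto
    have "fact (Suc l) / real (Suc l) = fact l" by (simp only: fact_Suc) simp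
    moreover have "Gamma (of_nat (Suc l)) = (fact l :: complex)" using Gamma_fact[of l, where 'a = complex] by simp
    ultimately show ?thesis unfolding l by (simp only: of_real_fact)
  qed
  have z: "zeta (of_nat (2 * n)) = of_real ((-1) ^ (n + 1) * (bernoulli (2 * n) * (2 * pi) ^ (2 * n) / (2 * fact (2 * n))))"
    unfolding zeta_even_nat by simp
  have aux: "2 * inverse P * e * (F / M) * (e * (-1) * (B * P / (2 * F))) = - (B / M)"
    if "P \<noteq> 0" "F \<noteq> 0" "e * e = 1" for P e F M B :: real
  proof -
    have "2 * inverse P * e * (F / M) * (e * (-1) * (B * P / (2 * F))) =
        - ((inverse P * P) * (F * inverse F) * (e * e) * (B / M))"
      by (simp only: divide_inverse inverse_mult_distrib mult_ac) simp
    then show ?thesis using that by simp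
  qed
  have e1: "(-1 :: real) ^ n * (-1) ^ n = 1" by (simp flip: power_mult_distrib)
  have "zeta (- of_nat m) = zeta (1 - of_nat (2 * n))" by (simp add: m)
  also have "\<dots> = of_real (2 * inverse ((2 * pi) ^ (2 * n)) * (-1) ^ n * (fact (2 * n) / real (2 * n)) *
      ((-1) ^ n * (-1) * (bernoulli (2 * n) * (2 * pi) ^ (2 * n) / (2 * fact (2 * n)))))"
    unfolding fe pw cs G z by (simp only: of_real_mult of_real_inverse of_real_numeral power_add power_one_right)
  also have "2 * inverse ((2 * pi) ^ (2 * n)) * (-1) ^ n * (fact (2 * n) / real (2 * n)) *
      ((-1) ^ n * (-1) * (bernoulli (2 * n) * (2 * pi) ^ (2 * n) / (2 * fact (2 * n)))) = - (bernoulli (2 * n) / real (2 * n))"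
    by (rule aux[OF _ _ e1]) simp_all
  finally show ?thesis unfolding n(1) by (simp only: of_real_minus)
qed

text \<open>The trivial zeros: the functional equation at the odd number u = m + 1 has a vanishing
  cosine.\<close>

theorem zeta_neg_even_nat:
  assumes "even m" "m > 0"
  shows "zeta (- of_nat m) = 0"
proof -
  obtain n where n: "m = 2 * n" using assms by blast
  have "zeta (1 - of_nat (m + 1)) = 2 * (2 * of_real pi) powr (- of_nat (m + 1)) * cos (of_real pi * of_nat (m + 1) / 2) * Gamma (of_nat (m + 1)) * zeta (of_nat (m + 1))"
    by (rule zeta_functional_equation) (use assms in \<open>auto simp: complex_eq_iff\<close>)
  moreover have "cos (complex_of_real pi * of_nat (m + 1) / 2) = 0"
  proof -
    have "complex_of_real pi * of_nat (m + 1) / 2 = of_real (real n * pi + pi / 2)" by (simp add: n field_simps)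
    also have "cos \<dots> = of_real (cos (real n * pi + pi / 2))" by (rule cos_of_real)
    also have "cos (real n * pi + pi / 2) = 0" by (simp add: cos_add)
    finally show ?thesis by simp
  qed
  ultimately show ?thesis by simp
qed

section \<open>Dirichlet series of the divisor sums\<close>

lemma of_nat_powr_exp: "n > 0 \<Longrightarrow> of_nat n powr z = exp (z * of_real (ln (real n)))" for z :: complex
  by (simp add: powr_def Ln_of_nat)

text \<open>Absolute convergence allows summation over pairs in any order, as the regrouping by
  divisors requires.\<close>

lemma has_sum_product_nat:
  fixes G H :: "nat \<Rightarrow> complex"
  assumes G: "summable (\<lambda>n. norm (G n))" and H: "summable (\<lambda>n. norm (H n))"
  shows "((\<lambda>(m, d). G m * H d) has_sum (suminf G * suminf H)) (UNIV \<times> UNIV)"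
proof (rule has_sum_SigmaI)
  have hG: "(G has_sum suminf G) UNIV" and hH: "(H has_sum suminf H) UNIV"
    using G H by (auto intro!: norm_summable_imp_has_sum summable_sums summable_norm_cancel)
  show "((\<lambda>y. (\<lambda>(m, d). G m * H d) (x, y)) has_sum G x * suminf H) UNIV" for x
    using hH by (simp add: has_sum_cmult_right)
  show "((\<lambda>x. G x * suminf H) has_sum suminf G * suminf H) UNIV"
    by (rule has_sum_cmult_left[OF hG])
  have nH: "((\<lambda>d. norm (H d)) has_sum (\<Sum>d. norm (H d))) UNIV"
    using H by (intro norm_summable_imp_has_sum) auto
  have "(\<lambda>x. norm ((\<lambda>(m, d). G m * H d) x)) summable_on UNIV \<times> UNIV"
    unfolding Infinite_Sum.abs_summable_on_Sigma_iff
  proof (intro conjI ballI)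
    show "(\<lambda>y. norm ((\<lambda>(m, d). G m * H d) (x, y))) summable_on UNIV" for x
      using has_sum_cmult_right[OF nH, of "norm (G x)"] by (auto simp: norm_mult summable_on_def)
    have "(\<Sum>\<^sub>\<infinity>y\<in>UNIV. norm ((\<lambda>(m, d). G m * H d) (x, y))) = norm (G x) * (\<Sum>d. norm (H d))" for x
      using has_sum_cmult_right[OF nH, of "norm (G x)"] by (auto simp: norm_mult intro: infsumI)
    moreover have "(\<lambda>x. norm (norm (G x) * (\<Sum>d. norm (H d)))) summable_on UNIV"
      using G by (intro norm_summable_imp_summable_on) (auto simp: abs_mult intro: summable_mult2)
    ultimately show "(\<lambda>x. norm (\<Sum>\<^sub>\<infinity>y\<in>UNIV. norm ((\<lambda>(m, d). G m * H d) (x, y)))) summable_on UNIV" by simp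
  qed
  then show "(\<lambda>(m, d). G m * H d) summable_on UNIV \<times> UNIV" by (rule Infinite_Sum.abs_summable_summable)
qed

text \<open>Pairs (m, d) correspond to pairs (n, d) with d^k dividing n through n = m d^k. The
  choice g(m) = m^r, h = 1 gives \<open>D_fun\<close>, and g(m) = m^(-r), h(d) = d^(k-1) gives
  \<open>S_fun\<close>.\<close>

theorem power_divisor_dirichlet_series:
  fixes g h :: "nat \<Rightarrow> complex" and s :: complex and k :: nat
  assumes k: "k \<ge> 1"
    and G: "summable (\<lambda>n. norm (g (Suc n) * of_nat (Suc n) powr (- s)))"
    and H: "summable (\<lambda>n. norm (h (Suc n) * of_nat (Suc n) powr (- (of_nat k * s))))"
  defines "c \<equiv> (\<lambda>n. \<Sum>d | d \<ge> 1 \<and> d ^ k dvd n. g (n div d ^ k) * h d)"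
  shows "(\<lambda>n. c (Suc n) * of_nat (Suc n) powr (- s)) sums
     ((\<Sum>n. g (Suc n) * of_nat (Suc n) powr (- s)) * (\<Sum>n. h (Suc n) * of_nat (Suc n) powr (- (of_nat k * s))))"
    (is "_ sums ?S")
proof -
  define D where "D n = {d. d \<ge> 1 \<and> d ^ k dvd Suc n}" for n
  define F where "F = (\<lambda>(n, d). g (Suc n div d ^ k) * h d * of_nat (Suc n) powr (- s))"
  have finD: "finite (D n)" for n
  proof (rule finite_subset)
    show "D n \<subseteq> {..Suc n}"
    proof
      fix d assume d: "d \<in> D n"
      have "d ^ 1 \<le> d ^ k" using d k by (intro power_increasing) (auto simp: D_def)
      also have "\<dots> \<le> Suc n" using d by (intro dvd_imp_le) (auto simp: D_def)
      finally show "d \<in> {..Suc n}" by simp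
    qed
  qed simp
  have "((\<lambda>(m, d). (g (Suc m) * of_nat (Suc m) powr (- s)) * (h (Suc d) * of_nat (Suc d) powr (- (of_nat k * s)))) has_sum ?S) (UNIV \<times> UNIV)"
    by (rule has_sum_product_nat[OF G H])
  \<comment> \<open>The number n and both series indices are stored shifted down by one; only the
    divisor in \<open>D n\<close> is stored as itself.\<close>
  also have "?this \<longleftrightarrow> (F has_sum ?S) (Sigma UNIV D)"
  proof (rule has_sum_reindex_bij_witness[where i = "\<lambda>x. (Suc (fst x) div snd x ^ k - 1, snd x - 1)" and
        j = "\<lambda>x. (Suc (snd x) ^ k * Suc (fst x) - 1, Suc (snd x))"])
    let ?i = "\<lambda>x. (Suc (fst x) div snd x ^ k - 1, snd x - 1)"
    let ?j = "\<lambda>x. (Suc (snd x) ^ k * Suc (fst x) - 1, Suc (snd x))"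
    fix x :: "nat \<times> nat" assume "x \<in> UNIV \<times> UNIV"
    obtain m d where x: "x = (m, d)" by (cases x)
    have p: "Suc (Suc d ^ k * Suc m - 1) = Suc d ^ k * Suc m" by simp
    show "?i (?j x) = x"
      unfolding x fst_conv snd_conv p by simp
    show "?j x \<in> Sigma UNIV D"
      unfolding x fst_conv snd_conv D_def by (auto simp: p simp del: power_Suc mult_Suc_right)
    have "of_nat (Suc d ^ k * Suc m) powr (- s) = of_nat (Suc d) powr (- (of_nat k * s)) * of_nat (Suc m) powr (- s)"
    proof -
      have "ln (real (Suc d ^ k * Suc m)) = real k * ln (real (Suc d)) + ln (real (Suc m))"
        unfolding of_nat_mult of_nat_power by (subst ln_mult) (auto simp: ln_realpow simp del: of_nat_Suc)
      then have e: "- s * of_real (ln (real (Suc d ^ k * Suc m))) = - (of_nat k * s) * of_real (ln (real (Suc d))) + (- s) * of_real (ln (real (Suc m)))"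
        by (simp only: of_real_add of_real_mult of_real_of_nat_eq ring_distribs) (simp only: mult_ac mult_minus_left mult_minus_right)
      have "Suc d ^ k * Suc m > 0" by simp
      then show ?thesis by (simp only: of_nat_powr_exp zero_less_Suc e exp_add)
    qed
    then show "F (?j x) = (case x of (m, d) \<Rightarrow> g (Suc m) * of_nat (Suc m) powr (- s) * (h (Suc d) * of_nat (Suc d) powr (- (of_nat k * s))))"
      unfolding x fst_conv snd_conv F_def prod.case p by (simp del: of_nat_Suc of_nat_mult)
  next
    let ?i = "\<lambda>x. (Suc (fst x) div snd x ^ k - 1, snd x - 1)"
    let ?j = "\<lambda>x. (Suc (snd x) ^ k * Suc (fst x) - 1, Suc (snd x))"
    fix x assume "x \<in> Sigma UNIV D"
    then obtain n d where x: "x = (n, d)" and d: "d \<in> D n" by (cases x) auto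
    have d1: "d \<ge> 1" "d ^ k dvd Suc n" using d by (auto simp: D_def)
    then obtain m where m: "Suc n = d ^ k * m" by blast
    have "m > 0" using m by (cases m) auto
    have "Suc n div d ^ k = m" using m d1(1) by simp
    then have "Suc (d - 1) ^ k * Suc (Suc n div d ^ k - 1) = Suc n" using \<open>m > 0\<close> d1(1) m by simp
    then show "?j (?i x) = x" using d1(1) by (simp add: x)
    show "?i x \<in> UNIV \<times> UNIV" by simp
  qed auto
  finally have "(F has_sum ?S) (Sigma UNIV D)" .
  then have "((\<lambda>n. c (Suc n) * of_nat (Suc n) powr (- s)) has_sum ?S) UNIV"
  proof (rule has_sum_SigmaD)
    fix n
    have "(\<Sum>d\<in>D n. F (n, d)) = c (Suc n) * of_nat (Suc n) powr (- s)"
      by (simp add: F_def c_def D_def sum_distrib_right del: of_nat_Suc)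
    then show "((\<lambda>d. F (n, d)) has_sum c (Suc n) * of_nat (Suc n) powr (- s)) (D n)"
      using has_sum_finite[OF finD[of n], of "\<lambda>d. F (n, d)"] by simp
  qed
  then show ?thesis by (rule has_sum_imp_sums)
qed

lemma summable_norm_of_nat_powr:
  assumes "Re z > 1"
  shows "summable (\<lambda>n. norm (of_nat (Suc n) powr (- z)))"
proof -
  have "norm (of_nat (Suc n) powr (- z)) = real (Suc n) powr (- Re z)" for n
    using norm_powr_real_powr[of "of_nat (Suc n)" "- z"] by (simp del: of_nat_Suc)
  then show ?thesis using summable_Suc_powr[of "- Re z"] assms by simp
qed

lemma of_nat_powr_mult_powi:
  fixes z :: complex
  assumes "n > 0"
  shows "of_real (real n powi r) * of_nat n powr z = of_nat n powr (z + of_int r)"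
proof -
  have "complex_of_real (real n powi r) = of_nat n powr of_int r"
    using assms by (simp add: complex_powr_of_int) 
  then show ?thesis by (simp add: powr_add mult.commute)
qed

lemma D_fun_dirichlet_series:
  assumes k: "k \<ge> 1" and s: "Re s - of_int r > 1" "real k * Re s > 1"
  shows "(\<lambda>n. of_real (D_fun k r (Suc n)) * of_nat (Suc n) powr (- s)) sums (zeta (s - of_int r) * zeta (of_nat k * s))"
proof -
  let ?g = "\<lambda>m. complex_of_real (real m powi r)"
  have g: "?g (Suc n) * of_nat (Suc n) powr (- s) = of_nat (Suc n) powr (- (s - of_int r))" for n
    by (subst of_nat_powr_mult_powi) auto
  have 1: "summable (\<lambda>n. norm (?g (Suc n) * of_nat (Suc n) powr (- s)))"
    unfolding g using s by (intro summable_norm_of_nat_powr) auto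
  have 2: "summable (\<lambda>n. norm (1 * of_nat (Suc n) powr (- (of_nat k * s))))"
    unfolding mult_1_left using s by (intro summable_norm_of_nat_powr) auto
  have z1: "(\<Sum>n. of_nat (Suc n) powr (- (s - of_int r))) = zeta (s - of_int r)"
    using s zeta_sums[of "s - of_int r"] by (intro sums_unique[symmetric]) auto
  have z2: "(\<Sum>n. 1 * of_nat (Suc n) powr (- (of_nat k * s))) = zeta (of_nat k * s)"
    unfolding mult_1_left using s zeta_sums[of "of_nat k * s"] by (intro sums_unique[symmetric]) auto
  have "complex_of_real (D_fun k r n) = (\<Sum>d | d \<ge> 1 \<and> d ^ k dvd n. ?g (n div d ^ k) * 1)" for n
    unfolding D_fun_def of_real_sum by (intro sum.cong refl) (auto simp: real_of_nat_div)
  then show ?thesis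
    using power_divisor_dirichlet_series[OF k 1 2] unfolding g z1 z2 by (simp only:)
qed

lemma S_fun_dirichlet_series:
  assumes k: "k \<ge> 1" and w: "Re w + of_int r > 1" "real k * Re w - real k > 0"
  shows "(\<lambda>n. of_real (S_fun k r (Suc n)) * of_nat (Suc n) powr (- w)) sums (zeta (w + of_int r) * zeta (of_nat k * w - of_nat k + 1))"
proof -
  let ?g = "\<lambda>m. complex_of_real (real m powi (- r))" and ?h = "\<lambda>d. complex_of_real (real d ^ (k - 1))"
  have g: "?g (Suc n) * of_nat (Suc n) powr (- w) = of_nat (Suc n) powr (- (w + of_int r))" for n
    by (subst of_nat_powr_mult_powi) auto
  have h: "?h (Suc n) * of_nat (Suc n) powr (- (of_nat k * w)) = of_nat (Suc n) powr (- (of_nat k * w - of_nat k + 1))" for n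
  proof -
    have "?h (Suc n) = complex_of_real (real (Suc n) powi (int k - 1))"
      using k by (simp only: power_int_of_nat[symmetric] of_nat_diff) simp
    moreover have "- (of_nat k * w) + of_int (int k - 1) = - (of_nat k * w - of_nat k + 1)" by simp
    ultimately show ?thesis using of_nat_powr_mult_powi[of "Suc n" "int k - 1" "- (of_nat k * w)"] by (simp only: zero_less_Suc)
  qed
  have 1: "summable (\<lambda>n. norm (?g (Suc n) * of_nat (Suc n) powr (- w)))"
    unfolding g using w by (intro summable_norm_of_nat_powr) auto
  have 2: "summable (\<lambda>n. norm (?h (Suc n) * of_nat (Suc n) powr (- (of_nat k * w))))"
    unfolding h using w by (intro summable_norm_of_nat_powr) auto
  have z1: "(\<Sum>n. of_nat (Suc n) powr (- (w + of_int r))) = zeta (w + of_int r)"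
    using w zeta_sums[of "w + of_int r"] by (intro sums_unique[symmetric]) auto
  have z2: "(\<Sum>n. of_nat (Suc n) powr (- (of_nat k * w - of_nat k + 1))) = zeta (of_nat k * w - of_nat k + 1)"
    using w zeta_sums[of "of_nat k * w - of_nat k + 1"] by (intro sums_unique[symmetric]) auto
  have "complex_of_real (S_fun k r n) = (\<Sum>d | d \<ge> 1 \<and> d ^ k dvd n. ?g (n div d ^ k) * ?h d)" for n
    unfolding S_fun_def of_real_sum by (intro sum.cong refl) (auto simp: real_of_nat_div)
  then show ?thesis
    using power_divisor_dirichlet_series[OF k 1 2] unfolding g h z1 z2 by (simp only:)
qed

lemma D_fun_nonneg: "D_fun k r n \<ge> 0" and S_fun_nonneg: "S_fun k r n \<ge> 0"
  by (auto simp: D_fun_def S_fun_def intro!: sum_nonneg mult_nonneg_nonneg)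

text \<open>With nonnegative coefficients, convergence at the real point \<open>\<sigma>\<close> is
  absolute convergence on the whole line Re s = \<sigma>; this form is what the exchanges of sum and
  integral use.\<close>

lemma summable_of_real_dirichlet:
  fixes a :: "nat \<Rightarrow> real"
  assumes "summable (\<lambda>n. complex_of_real (a n) * of_nat (Suc n) powr (- of_real \<sigma>))"
  shows "summable (\<lambda>n. a n * real (Suc n) powr (- \<sigma>))"
proof -
  have "complex_of_real (a n) * of_nat (Suc n) powr (- of_real \<sigma>) = of_real (a n * real (Suc n) powr (- \<sigma>))" for n
    using powr_of_real[of "real (Suc n)" "- \<sigma>"] by (simp del: of_nat_Suc)
  then show ?thesis using assms by (simp only: summable_complex_of_real)
qed

section \<open>The integrand on the left line\<close>

lemma j_range_Suc:
  "j_range (2 * Suc l + 1) = insert (2 * int l + 2) (insert (- (2 * int l + 2)) (j_range (2 * l + 1)))"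
  by (auto simp: j_range_def)

lemma finite_j_range: "finite (j_range k)"
  by (rule finite_subset[of _ "{- (int k - 1)..int k - 1}"]) (auto simp: j_range_def)

lemma ii_powi_even: "\<i> powi (2 * a) = (-1) powi a"
  by (simp add: power_int_mult)

text \<open>Here every j is even, so i^j is a sign. The induction adds the pair j = 2 l + 2 and j =
  - (2 l + 2) and uses cos (a + u) = 2 cos a cos u - cos (a - u). In product form the identity also
  holds at the zeros of cos u.\<close>

lemma cos_odd_multiple:
  fixes u :: complex
  shows "cos (of_nat (2 * l + 1) * u) = cos u * (-1) ^ l * (\<Sum>j\<in>j_range (2 * l + 1). \<i> powi j * exp (- (\<i> * of_int j * u)))"
proof (induction l)
  case 0
  have "j_range 1 = {0}" by (auto simp: j_range_def)
  then show ?case by simp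
next
  case (Suc l)
  let ?T = "\<lambda>l. \<Sum>j\<in>j_range (2 * l + 1). \<i> powi j * exp (- (\<i> * of_int j * u))"
  let ?a = "(2 * of_nat l + 2) * u"
  have p: "\<i> powi (2 * int l + 2) = (-1) ^ Suc l" "\<i> powi (- (2 * int l + 2)) = (-1) ^ Suc l"
  proof -
    have "2 * int l + 2 = 2 * int (Suc l)" "- (2 * int l + 2) = 2 * (- int (Suc l))" by simp_all
    then show "\<i> powi (2 * int l + 2) = (-1) ^ Suc l" "\<i> powi (- (2 * int l + 2)) = (-1) ^ Suc l"
      by (simp_all only: ii_powi_even power_int_of_nat power_int_minus) (simp add: power_inverse[symmetric] del: power_Suc)
  qed
  have n1: "2 * int l + 2 \<notin> insert (- (2 * int l + 2)) (j_range (2 * l + 1))"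
    and n2: "- (2 * int l + 2) \<notin> j_range (2 * l + 1)"
    by (auto simp: j_range_def)
  have "?T (Suc l) = \<i> powi (2 * int l + 2) * exp (- (\<i> * of_int (2 * int l + 2) * u)) +
      (\<i> powi (- (2 * int l + 2)) * exp (- (\<i> * of_int (- (2 * int l + 2)) * u)) + ?T l)"
    unfolding j_range_Suc sum.insert[OF finite.insertI[OF finite_j_range] n1] sum.insert[OF finite_j_range n2] ..
  also have "\<dots> = (-1) ^ Suc l * (exp (- (\<i> * ?a)) + exp (\<i> * ?a)) + ?T l"
    unfolding p by (simp add: algebra_simps)
  also have "exp (- (\<i> * ?a)) + exp (\<i> * ?a) = 2 * cos ?a" by (simp add: cos_exp_eq)
  finally have T: "?T (Suc l) = (-1) ^ Suc l * (2 * cos ?a) + ?T l" .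
  have e1: "(-1 :: complex) ^ Suc l * (-1) ^ Suc l = 1" by (simp flip: power_mult_distrib)
  have "cos u * (-1) ^ Suc l * ?T (Suc l) = ((-1) ^ Suc l * (-1) ^ Suc l) * (2 * cos ?a * cos u) - cos u * (-1) ^ l * ?T l"
    unfolding T by (simp add: algebra_simps)
  also have "\<dots> = 2 * cos ?a * cos u - cos (of_nat (2 * l + 1) * u)"
    unfolding e1 Suc.IH by simp
  also have "of_nat (2 * l + 1) * u = ?a - u" by (simp add: algebra_simps)
  also have "2 * cos ?a * cos u - cos (?a - u) = cos (?a + u)" by (simp add: cos_add cos_diff)
  also have "?a + u = of_nat (2 * Suc l + 1) * u" by (simp add: algebra_simps)
  finally show ?case ..
qed

lemma G_params_prod:
  "(\<Prod>b\<leftarrow>G_params k r. Gamma (b + w)) = Gamma (of_int r + w) * (\<Prod>m=1..<k. Gamma (w - of_nat m / of_nat k))"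
  by (simp add: G_params_def o_def prod.distinct_set_conv_list[symmetric])

text \<open>Gauss' product runs over Gamma(w - m/k) with 0 <= m < k; the Meijer parameters have
  Gamma(w + r) in place of the factor m = 0, which the extra Gamma(w) restores. The base point is z
  = w - (k - 1)/k, so that k z = k w - k + 1.\<close>

lemma G_params_prod_multiplication:
  assumes k: "k \<ge> 1" and w: "Re w > 1"
  shows "(\<Prod>b\<leftarrow>G_params k r. Gamma (b + w)) * Gamma w =
     Gamma (w + of_int r) * (of_real (sqrt (real k * (2 * pi) ^ (k - 1))) * of_nat k powr (- (of_nat k * w - of_nat k + 1)) * Gamma (of_nat k * w - of_nat k + 1))"
proof -
  define z where "z = w - of_nat (k - 1) / of_nat k"
  have k0: "of_nat k \<noteq> (0 :: complex)" using k by simp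
  have kz: "of_nat k * z = of_nat k * w - of_nat k + 1"
  proof -
    have "of_nat k * z = of_nat k * w - of_nat (k - 1)" 
    proof -
      have "a * (w - b / a) = a * w - b" if "a \<noteq> 0" for a b :: complex
        using that by (simp add: right_diff_distrib)
      then show ?thesis unfolding z_def using k0 by blast
    qed
    then show ?thesis using k by (simp add: of_nat_diff)
  qed
  have z: "Re z > 0"
  proof -
    have "real (k - 1) / real k \<le> 1" using k by (simp add: divide_le_eq)
    moreover have "Re (of_nat (k - 1) / of_nat k) = real (k - 1) / real k"
      by (metis Re_complex_of_real of_real_divide of_real_of_nat_eq)
    ultimately show ?thesis using w by (simp add: z_def)
  qed
  have "(\<Prod>m=1..<k. Gamma (w - of_nat m / of_nat k)) * Gamma w = (\<Prod>m<k. Gamma (w - of_nat m / of_nat k))"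
    using k prod.atLeast_Suc_lessThan[of 0 k "\<lambda>m. Gamma (w - of_nat m / of_nat k)"]
    by (simp add: atLeast0LessThan mult.commute)
  also have "\<dots> = (\<Prod>j<k. Gamma (w - of_nat (k - Suc j) / of_nat k))"
    by (rule prod.nat_diff_reindex[symmetric])
  also have "\<dots> = (\<Prod>j<k. Gamma (z + of_nat j / of_nat k))"
  proof (intro prod.cong refl)
    fix j assume "j \<in> {..<k}"
    then have h: "of_nat (k - Suc j) = (of_nat (k - 1) - of_nat j :: complex)"
      by (subst of_nat_diff[symmetric]) auto
    show "Gamma (w - of_nat (k - Suc j) / of_nat k) = Gamma (z + of_nat j / of_nat k)"
      unfolding h z_def diff_divide_distrib by (simp add: algebra_simps)
  qed
  also have "\<dots> = of_real (sqrt (real k * (2 * pi) ^ (k - 1))) * of_nat k powr (- of_nat k * z) * Gamma (of_nat k * z)"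
    using k z by (intro Gamma_multiplication_complex) auto
  also have "- of_nat k * z = - (of_nat k * w - of_nat k + 1)" using kz by simp
  finally show ?thesis unfolding G_params_prod kz by (simp only: mult.assoc add.commute)
qed

definition voronoi_const :: "nat \<Rightarrow> int \<Rightarrow> real \<Rightarrow> complex" where
  "voronoi_const k r x = (- 1) powi ((2 * int k + r - 1) div 2)
     * of_real ((2 * pi) powr ((real k + 1 - 2 * of_int r) / 2) / (x * real k powr ((2 * real k - 1) / 2)))"

text \<open>On the left stand the powers produced by reflection, the two functional equations, the
  multiplication formula and x^(-s); on the right the Gauss constant, the constant of the final
  formula and X^(-w) for n = 1. Written as exponentials in ln (2 pi), ln k and ln x, this is one
  linear identity of exponents.\<close>

lemma voronoi_exponents:
  fixes w :: complex
  assumes k: "k \<ge> 1" and x: "x > 0"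
  shows "2 * of_real pi * (2 * of_real pi) powr (- (w + of_int r)) * (2 * of_real pi) powr (- (of_nat k * w - of_nat k + 1))
     * of_nat k powr (of_nat k * w - of_nat k + 1) * exp (- (1 - w) * of_real (ln x)) =
     of_real (sqrt (real k * (2 * pi) ^ (k - 1))) * of_real ((2 * pi) powr ((real k + 1 - 2 * of_int r) / 2) / (x * real k powr ((2 * real k - 1) / 2)))
     * exp (- w * of_real (ln (X_abs k x 1)))"
proof -
  define L \<kappa> \<xi> where "L = ln (2 * pi)" and "\<kappa> = ln (real k)" and "\<xi> = ln x"
  have p: "(2 * of_real pi) powr z = exp (z * of_real L)" for z :: complex
    using Ln_of_real[of "2 * pi"] by (simp add: powr_def L_def)
  have q: "of_nat k powr z = exp (z * of_real \<kappa>)" for z :: complex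
    using k by (simp add: of_nat_powr_exp \<kappa>_def)
  have l: "ln (X_abs k x 1) = real (k + 1) * L - (real k * \<kappa> + \<xi>)"
  proof -
    have "exp (real (k + 1) * L - (real k * \<kappa> + \<xi>)) = exp L ^ (k + 1) / (exp \<kappa> ^ k * exp \<xi>)"
      by (simp only: exp_diff exp_add exp_of_nat_mult)
    also have "\<dots> = X_abs k x 1" using k x by (simp add: X_abs_def L_def \<kappa>_def \<xi>_def)
    finally show ?thesis by (metis ln_exp)
  qed
  have s: "sqrt (real k * (2 * pi) ^ (k - 1)) = exp ((\<kappa> + real (k - 1) * L) / 2)"
  proof -
    have "exp ((\<kappa> + real (k - 1) * L) / 2) ^ 2 = exp \<kappa> * exp L ^ (k - 1)"
    proof -
      have "exp ((\<kappa> + real (k - 1) * L) / 2) ^ 2 = exp (2 * ((\<kappa> + real (k - 1) * L) / 2))"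
        by (simp only: exp_double)
      also have "2 * ((\<kappa> + real (k - 1) * L) / 2) = \<kappa> + real (k - 1) * L" by simp
      finally show ?thesis by (simp only: exp_add exp_of_nat_mult)
    qed
    also have "\<dots> = real k * (2 * pi) ^ (k - 1)" using k by (simp add: \<kappa>_def L_def)
    finally show ?thesis by (intro real_sqrt_unique) auto
  qed
  have c: "(2 * pi) powr ((real k + 1 - 2 * of_int r) / 2) / (x * real k powr ((2 * real k - 1) / 2)) =
      exp ((real k + 1 - 2 * of_int r) / 2 * L - \<xi> - (2 * real k - 1) / 2 * \<kappa>)"
    using k x by (simp add: powr_def L_def \<kappa>_def \<xi>_def exp_diff)
  have e: "exp L = 2 * pi" by (simp add: L_def)
  have t: "2 * complex_of_real pi = exp (of_real L)" unfolding exp_of_real e by simp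
  have km: "real (k - 1) = real k - 1" using k by (simp add: of_nat_diff)
  have "of_real L + - (w + of_int r) * of_real L + - (of_nat k * w - of_nat k + 1) * of_real L + (of_nat k * w - of_nat k + 1) * of_real \<kappa> + - (1 - w) * of_real \<xi>
     = of_real ((\<kappa> + real (k - 1) * L) / 2) + of_real ((real k + 1 - 2 * of_int r) / 2 * L - \<xi> - (2 * real k - 1) / 2 * \<kappa>)
       + - w * of_real (real (k + 1) * L - (real k * \<kappa> + \<xi>))"
    unfolding km by (simp add: field_simps)
  then show ?thesis
    unfolding p q l s c \<xi>_def[symmetric] unfolding t exp_of_real[symmetric] by (simp only: exp_add[symmetric])
qed

text \<open>Put u = pi w / 2. Reflection of Gamma(1 - w) brings 1/(sin u cos u); as r is odd, the
  first functional equation contributes sin u up to sign, and as k is odd, the second contributes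
  cos (k u) up to sign. The sine cancels, and the exponentials of the remaining quotient are the
  rotations by \<open>X_arg (- j)\<close>.\<close>

lemma transformed_integrand:
  assumes k: "k \<ge> 1" "odd k" and r: "odd r" and x: "x > 0"
    and w: "Re w > 1" "Re w + of_int r > 1" "sin (of_real pi * w) \<noteq> 0"
  shows "Gamma (1 - w) * zeta (1 - w - of_int r) * zeta (of_nat k * (1 - w)) * exp (- (1 - w) * of_real (ln x)) =
     voronoi_const k r x * (\<Sum>j\<in>j_range k. \<i> powi j *
       ((\<Prod>b\<leftarrow>G_params k r. Gamma (b + w)) * exp (- w * (of_real (ln (X_abs k x 1)) + \<i> * of_real (X_arg (- j)))) *
        (zeta (w + of_int r) * zeta (of_nat k * w - of_nat k + 1))))"
proof -
  obtain l where l: "k = 2 * l + 1" using k(2) by (elim oddE)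
  obtain q where q: "r = 2 * q + 1" using r by (elim oddE)
  define u where "u = of_real pi * w / 2"
  define u1 u2 where "u1 = w + of_int r" and "u2 = of_nat k * w - of_nat k + 1"
  define T where "T = (\<Sum>j\<in>j_range k. \<i> powi j * exp (- (\<i> * of_int j * u)))"
  define Pr where "Pr = (\<Prod>b\<leftarrow>G_params k r. Gamma (b + w))"
  define g where "g = complex_of_real (sqrt (real k * (2 * pi) ^ (k - 1)))"
  define K where "K = complex_of_real ((2 * pi) powr ((real k + 1 - 2 * of_int r) / 2) / (x * real k powr ((2 * real k - 1) / 2)))"
  define E where "E = exp (- (1 - w) * of_real (ln x))"
  have re2: "Re u2 > 1"
  proof -
    have "0 < real k * (Re w - 1)" using k w by simp
    then show ?thesis by (simp add: u2_def algebra_simps)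
  qed
  have g0: "g \<noteq> 0" using k by (simp add: g_def)
  have Gw: "Gamma w \<noteq> 0" using w by (auto simp: Gamma_eq_zero_iff elim!: nonpos_Ints_cases')
  have sw: "sin (of_real pi * w) = 2 * sin u * cos u" using sin_double[of u] by (simp add: u_def)
  have su: "sin u \<noteq> 0" "cos u \<noteq> 0" using w(3) unfolding sw by auto
  have A: "Gamma (1 - w) = of_real pi / (2 * sin u * cos u) / Gamma w"
    unfolding nonzero_eq_divide_eq[OF Gw] using Gamma_reflection_complex[of w] unfolding sw
    by (simp only: mult.commute)
  have Z1: "zeta (1 - u1) = 2 * (2 * of_real pi) powr (- u1) * cos (of_real pi * u1 / 2) * Gamma u1 * zeta u1"
    using w by (intro zeta_functional_equation) (auto simp: u1_def complex_eq_iff)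
  have Z2: "zeta (1 - u2) = 2 * (2 * of_real pi) powr (- u2) * cos (of_real pi * u2 / 2) * Gamma u2 * zeta u2"
    using re2 by (intro zeta_functional_equation) auto
  \<comment> \<open>An odd r shifts the argument u by an odd multiple of pi/2, which turns the
    cosine into a sine.\<close>
  have c1: "cos (of_real pi * u1 / 2) = - sin u * (-1) powi q"
  proof -
    have "of_real pi * u1 / 2 = u + of_real (of_int q * pi + pi / 2)"
      by (simp add: u1_def u_def q field_simps)
    also have "cos \<dots> = cos u * of_real (cos (of_int q * pi + pi / 2)) - sin u * of_real (sin (of_int q * pi + pi / 2))"
      by (simp only: cos_add cos_of_real sin_of_real)
    also have "cos (of_int q * pi + pi / 2) = 0"
    proof -
      have "sin (real_of_int q * pi) = 0" unfolding sin_zero_iff_int2 by blast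
      then show ?thesis by (simp add: cos_add)
    qed
    also have "sin (of_int q * pi + pi / 2) = (-1) powi q"
    proof -
      have "cos (real_of_int q * pi) = (-1) powi q"
        using cos_npi_int[of q] by (cases "even q") (simp_all add: mult.commute)
      then show ?thesis by (simp add: sin_add)
    qed
    finally show ?thesis by simp
  qed
  have c2: "cos (of_real pi * u2 / 2) = (-1) ^ l * cos (of_nat k * u)"
  proof -
    have "of_real pi * u2 / 2 = of_nat k * u - of_real (real l * pi)"
      by (simp add: u2_def u_def l field_simps)
    also have "cos \<dots> = cos (of_nat k * u) * of_real (cos (real l * pi)) + sin (of_nat k * u) * of_real (sin (real l * pi))"
      by (simp only: cos_diff cos_of_real sin_of_real)
    finally show ?thesis by (simp add: cos_npi sin_npi)
  qed
  have ck: "cos (of_nat k * u) = cos u * (-1) ^ l * T"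
    unfolding T_def l by (rule cos_odd_multiple)
  have G: "Pr * Gamma w = Gamma u1 * (g * of_nat k powr (- u2) * Gamma u2)"
    unfolding Pr_def g_def u1_def u2_def by (rule G_params_prod_multiplication[OF k(1) w(1)])
  have G': "Gamma u1 * Gamma u2 * g = Pr * Gamma w * of_nat k powr u2"
  proof -
    have "of_nat k powr (- u2) * of_nat k powr u2 = 1" using k by (simp add: powr_minus)
    then have "Pr * Gamma w * of_nat k powr u2 = Gamma u1 * g * Gamma u2 * 1"
      unfolding G by (metis (no_types, lifting) mult.assoc mult.commute)
    then show ?thesis by (simp add: mult_ac)
  qed
  have ex: "2 * of_real pi * (2 * of_real pi) powr (- u1) * (2 * of_real pi) powr (- u2) * of_nat k powr u2 * E =
      g * K * exp (- w * of_real (ln (X_abs k x 1)))"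
    unfolding u1_def u2_def g_def K_def E_def by (rule voronoi_exponents[OF k(1) x])
  \<comment> \<open>The exponent is k + q, and the odd k supplies the minus sign found in
    \<open>c1\<close>.\<close>
  have sgn: "(- 1) powi ((2 * int k + r - 1) div 2) = - ((-1 :: complex) powi q)"
  proof -
    have "(2 * int k + r - 1) div 2 = int k + q" by (simp add: q)
    then show ?thesis using k(2) by (simp add: power_int_add)
  qed
  \<comment> \<open>Here e stands for (-1)^l, which occurs twice, in \<open>c2\<close> and in
    \<open>ck\<close>, and so drops out.\<close>
  have aux: "P / (2 * S * C) / Gw * (2 * L1 * (- S * s) * G1 * Z1) * (2 * L2 * (e * (C * e * T)) * G2 * Z2) * E =
      - s * (2 * P * L1 * L2 * E) * (G1 * G2 / Gw) * T * (Z1 * Z2)"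
    if "S \<noteq> 0" "C \<noteq> 0" "e * e = 1" "Gw \<noteq> 0" for P S C Gw L1 L2 s G1 G2 Z1 Z2 e E T :: complex
  proof -
    have "P / (2 * S * C) / Gw * (2 * L1 * (- S * s) * G1 * Z1) * (2 * L2 * (e * (C * e * T)) * G2 * Z2) * E =
        - (e * e) * (s * (2 * P * L1 * L2 * E) * (G1 * G2 / Gw) * T * (Z1 * Z2))"
      using that(1,2,4) by (simp add: divide_simps)
    then show ?thesis using that(3) by simp
  qed
  have e1: "(-1 :: complex) ^ l * (-1) ^ l = 1" by (simp flip: power_mult_distrib)
  have "Gamma (1 - w) * zeta (1 - u1) * zeta (1 - u2) * E =
      - ((-1) powi q) * (2 * of_real pi * (2 * of_real pi) powr (- u1) * (2 * of_real pi) powr (- u2) * E) * (Gamma u1 * Gamma u2 / Gamma w) * T * (zeta u1 * zeta u2)"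
    unfolding A Z1 Z2 c1 c2 ck by (rule aux[OF su e1 Gw])
  also have "Gamma u1 * Gamma u2 / Gamma w = Pr * of_nat k powr u2 / g"
    using G' g0 Gw by (simp add: field_simps)
  also have "- ((-1) powi q) * (2 * of_real pi * (2 * of_real pi) powr (- u1) * (2 * of_real pi) powr (- u2) * E) * (Pr * of_nat k powr u2 / g) * T * (zeta u1 * zeta u2) =
     - ((-1) powi q) * (2 * of_real pi * (2 * of_real pi) powr (- u1) * (2 * of_real pi) powr (- u2) * of_nat k powr u2 * E) / g * Pr * T * (zeta u1 * zeta u2)"
    by simp
  also have "\<dots> = - ((-1) powi q) * K * (exp (- w * of_real (ln (X_abs k x 1))) * Pr * T * (zeta u1 * zeta u2))"
    unfolding ex using g0 by simp
  also have "- ((-1) powi q) * K = voronoi_const k r x"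
    by (simp only: voronoi_const_def sgn K_def)
  also have "exp (- w * of_real (ln (X_abs k x 1))) * Pr * T * (zeta u1 * zeta u2) =
     (\<Sum>j\<in>j_range k. \<i> powi j * (Pr * exp (- w * (of_real (ln (X_abs k x 1)) + \<i> * of_real (X_arg (- j)))) * (zeta u1 * zeta u2)))"
  proof -
    have "exp (- w * (of_real (ln (X_abs k x 1)) + \<i> * of_real (X_arg (- j)))) =
        exp (- w * of_real (ln (X_abs k x 1))) * exp (- (\<i> * of_int j * u))" for j
      unfolding exp_add[symmetric] by (simp add: X_arg_def u_def algebra_simps)
    then show ?thesis unfolding T_def sum_distrib_left sum_distrib_right
      by (intro sum.cong refl) (simp only: mult_ac)
  qed
  finally have "Gamma (1 - w) * zeta (1 - u1) * zeta (1 - u2) * E = voronoi_const k r x *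
     (\<Sum>j\<in>j_range k. \<i> powi j * (Pr * exp (- w * (of_real (ln (X_abs k x 1)) + \<i> * of_real (X_arg (- j)))) * (zeta u1 * zeta u2)))" .
  moreover have "1 - u1 = 1 - w - of_int r" "1 - u2 = of_nat k * (1 - w)" by (simp_all add: u1_def u2_def algebra_simps)
  ultimately show ?thesis by (simp only: E_def Pr_def u1_def u2_def)
qed

section \<open>Decay and line independence of the Meijer integrand\<close>

text \<open>The parameters are real, so the shifts leave Im s unchanged and the decay rates of the
  factors add.\<close>

lemma Gamma_prod_decay:
  fixes bs :: "complex list" and a b :: real
  assumes e: "\<epsilon> > 0" and bs: "\<And>z. z \<in> set bs \<Longrightarrow> Im z = 0"
  shows "\<exists>C\<ge>0. \<forall>s. a \<le> Re s \<and> Re s \<le> b \<and> 1 \<le> \<bar>Im s\<bar> \<longrightarrow>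
     norm (\<Prod>z\<leftarrow>bs. Gamma (z + s)) \<le> C * exp (- (real (length bs) * (pi / 2 - \<epsilon>)) * \<bar>Im s\<bar>)"
  using bs
proof (induction bs)
  case Nil
  show ?case by (intro exI[of _ 1]) auto
next
  case (Cons z bs)
  then obtain C where C: "C \<ge> 0" "\<And>s. a \<le> Re s \<Longrightarrow> Re s \<le> b \<Longrightarrow> 1 \<le> \<bar>Im s\<bar> \<Longrightarrow>
     norm (\<Prod>z\<leftarrow>bs. Gamma (z + s)) \<le> C * exp (- (real (length bs) * (pi / 2 - \<epsilon>)) * \<bar>Im s\<bar>)"
    by (metis list.set_intros(2))
  obtain D where D: "D \<ge> 0" "\<And>s. Re z + a \<le> Re s \<Longrightarrow> Re s \<le> Re z + b \<Longrightarrow> 1 \<le> \<bar>Im s\<bar> \<Longrightarrow>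
     norm (Gamma s) \<le> D * exp (- (pi / 2 - \<epsilon>) * \<bar>Im s\<bar>)"
    using Gamma_decay[OF e, of "Re z + a" "Re z + b"] by blast
  show ?case
  proof (intro exI[of _ "D * C"] conjI allI impI)
    show "D * C \<ge> 0" using C D by simp
    fix s assume s: "a \<le> Re s \<and> Re s \<le> b \<and> 1 \<le> \<bar>Im s\<bar>"
    have im: "Im (z + s) = Im s" using Cons.prems by simp
    have "norm (Gamma (z + s)) \<le> D * exp (- (pi / 2 - \<epsilon>) * \<bar>Im s\<bar>)"
      using D(2)[of "z + s"] s unfolding im by simp
    moreover have "norm (\<Prod>z\<leftarrow>bs. Gamma (z + s)) \<le> C * exp (- (real (length bs) * (pi / 2 - \<epsilon>)) * \<bar>Im s\<bar>)"
      using C(2) s by blast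
    ultimately have "norm (Gamma (z + s)) * norm (\<Prod>z\<leftarrow>bs. Gamma (z + s)) \<le>
        (D * exp (- (pi / 2 - \<epsilon>) * \<bar>Im s\<bar>)) * (C * exp (- (real (length bs) * (pi / 2 - \<epsilon>)) * \<bar>Im s\<bar>))"
      using D(1) by (intro mult_mono) auto
    also have "\<dots> = D * C * (exp (- (pi / 2 - \<epsilon>) * \<bar>Im s\<bar>) * exp (- (real (length bs) * (pi / 2 - \<epsilon>)) * \<bar>Im s\<bar>))"
      by simp
    also have "exp (- (pi / 2 - \<epsilon>) * \<bar>Im s\<bar>) * exp (- (real (length bs) * (pi / 2 - \<epsilon>)) * \<bar>Im s\<bar>) =
        exp (- (real (length (z # bs)) * (pi / 2 - \<epsilon>)) * \<bar>Im s\<bar>)"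
      unfolding exp_add[symmetric] by (simp add: algebra_simps)
    finally show "norm (\<Prod>z\<leftarrow>z # bs. Gamma (z + s)) \<le> D * C * exp (- (real (length (z # bs)) * (pi / 2 - \<epsilon>)) * \<bar>Im s\<bar>)"
      by (simp only: list.map prod_list.Cons norm_mult)
  qed
qed

text \<open>The integrand of \<open>meijer_G\<close> without the factor i of ds, as a function of
  the complex variable so that the line can be moved.\<close>

definition meijer_integrand :: "complex list \<Rightarrow> real \<Rightarrow> real \<Rightarrow> complex \<Rightarrow> complex" where
  "meijer_integrand bs \<rho> \<theta> s = (\<Prod>b\<leftarrow>bs. Gamma (b + s)) * exp (- s * (of_real (ln \<rho>) + \<i> * of_real \<theta>))"

text \<open>The power z^(-s) grows at most like exp (|\<theta>| |Im s|), while the Gamma product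
  decays at a rate close to length * pi/2. \<open>\<delta>\<close> is half of the gap; the other
  half pays for the loss in the Gamma estimates.\<close>

lemma meijer_integrand_decay:
  fixes a b :: real
  assumes bs: "\<And>z. z \<in> set bs \<Longrightarrow> Im z = 0" and th: "\<bar>\<theta>\<bar> < real (length bs) * (pi / 2)"
  defines "\<delta> \<equiv> (real (length bs) * (pi / 2) - \<bar>\<theta>\<bar>) / 2"
  shows "\<exists>C. \<forall>s. a \<le> Re s \<and> Re s \<le> b \<and> 1 \<le> \<bar>Im s\<bar> \<longrightarrow> norm (meijer_integrand bs \<rho> \<theta> s) \<le> C * exp (- \<delta> * \<bar>Im s\<bar>)"
proof -
  define n where "n = real (length bs)"
  have n: "n > 0"
  proof (rule ccontr)
    assume "\<not> n > 0"
    then have "n = 0" by (simp add: n_def)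
    then show False using th by (simp add: n_def)
  qed
  have d: "\<delta> > 0" using th by (simp add: \<delta>_def)
  then have e: "\<delta> / n > 0" using n by simp
  obtain C where C: "C \<ge> 0" "\<And>s. a \<le> Re s \<Longrightarrow> Re s \<le> b \<Longrightarrow> 1 \<le> \<bar>Im s\<bar> \<Longrightarrow>
     norm (\<Prod>z\<leftarrow>bs. Gamma (z + s)) \<le> C * exp (- (n * (pi / 2 - \<delta> / n)) * \<bar>Im s\<bar>)"
    using Gamma_prod_decay[where a = a and b = b, OF e bs] unfolding n_def by blast
  define M where "M = max \<bar>a\<bar> \<bar>b\<bar> * \<bar>ln \<rho>\<bar>"
  show ?thesis
  proof (intro exI[of _ "C * exp M"] allI impI)
    fix s assume s: "a \<le> Re s \<and> Re s \<le> b \<and> 1 \<le> \<bar>Im s\<bar>"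
    have "norm (exp (- s * (of_real (ln \<rho>) + \<i> * of_real \<theta>))) = exp (Im s * \<theta> - Re s * ln \<rho>)"
      by (simp add: norm_exp algebra_simps)
    also have "\<dots> \<le> exp (\<bar>\<theta>\<bar> * \<bar>Im s\<bar> + M)"
    proof -
      have "Im s * \<theta> \<le> \<bar>\<theta>\<bar> * \<bar>Im s\<bar>" by (metis abs_ge_self abs_mult mult.commute)
      moreover have "- (Re s * ln \<rho>) \<le> \<bar>Re s\<bar> * \<bar>ln \<rho>\<bar>" by (metis abs_ge_minus_self abs_mult)
      moreover have "\<bar>Re s\<bar> * \<bar>ln \<rho>\<bar> \<le> M" unfolding M_def using s by (intro mult_right_mono) auto
      ultimately show ?thesis by simp
    qed
    finally have E: "norm (exp (- s * (of_real (ln \<rho>) + \<i> * of_real \<theta>))) \<le> exp (\<bar>\<theta>\<bar> * \<bar>Im s\<bar> + M)" .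
    have "norm (meijer_integrand bs \<rho> \<theta> s) \<le> (C * exp (- (n * (pi / 2 - \<delta> / n)) * \<bar>Im s\<bar>)) * exp (\<bar>\<theta>\<bar> * \<bar>Im s\<bar> + M)"
      unfolding meijer_integrand_def norm_mult using C s E by (intro mult_mono) auto
    also have "\<dots> = C * (exp (- (n * (pi / 2 - \<delta> / n)) * \<bar>Im s\<bar>) * exp (\<bar>\<theta>\<bar> * \<bar>Im s\<bar> + M))" by simp
    also have "exp (- (n * (pi / 2 - \<delta> / n)) * \<bar>Im s\<bar>) * exp (\<bar>\<theta>\<bar> * \<bar>Im s\<bar> + M) = exp M * exp (- \<delta> * \<bar>Im s\<bar>)"
    proof -
      have "n * (pi / 2 - \<delta> / n) = n * (pi / 2) - \<delta>" using n by (simp add: right_diff_distrib)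
      also have "n * (pi / 2) = 2 * \<delta> + \<bar>\<theta>\<bar>" by (simp add: \<delta>_def n_def field_simps)
      finally have "n * (pi / 2 - \<delta> / n) = 2 * \<delta> + \<bar>\<theta>\<bar> - \<delta>" .
      then show ?thesis unfolding exp_add[symmetric] by (simp add: algebra_simps)
    qed
    finally show "norm (meijer_integrand bs \<rho> \<theta> s) \<le> C * exp M * exp (- \<delta> * \<bar>Im s\<bar>)" by simp
  qed
qed

lemma meijer_integrand_shift:
  assumes bs: "\<And>z. z \<in> set bs \<Longrightarrow> Im z = 0" and th: "\<bar>\<theta>\<bar> < real (length bs) * (pi / 2)"
    and a: "\<And>z. z \<in> set bs \<Longrightarrow> - Re z < a" and ab: "a < b"
  shows "integrable lborel (\<lambda>t. meijer_integrand bs \<rho> \<theta> (Complex a t))"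
    "integrable lborel (\<lambda>t. meijer_integrand bs \<rho> \<theta> (Complex b t))"
    "(\<integral>t. meijer_integrand bs \<rho> \<theta> (Complex b t) \<partial>lborel) = (\<integral>t. meijer_integrand bs \<rho> \<theta> (Complex a t) \<partial>lborel)"
proof -
  \<comment> \<open>At least the abscissa of every pole and yet below \<open>a\<close>, so the open
    strip to the right of \<open>a'\<close> is free of poles.\<close>
  define a' where "a' = Max (insert (a - 1) ((\<lambda>z. - Re z) ` set bs))"
  have a': "a' < a" "\<And>z. z \<in> set bs \<Longrightarrow> - Re z \<le> a'" using a by (auto simp: a'_def)
  define \<delta> where "\<delta> = (real (length bs) * (pi / 2) - \<bar>\<theta>\<bar>) / 2"
  have d: "\<delta> > 0" using th by (simp add: \<delta>_def)
  obtain C where C: "\<And>s. a \<le> Re s \<Longrightarrow> Re s \<le> b \<Longrightarrow> 1 \<le> \<bar>Im s\<bar> \<Longrightarrow> norm (meijer_integrand bs \<rho> \<theta> s) \<le> C * exp (- \<delta> * \<bar>Im s\<bar>)"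
    using meijer_integrand_decay[where a = a and b = b and \<rho> = \<rho>, OF bs th] unfolding \<delta>_def by blast
  have hol: "(\<lambda>s. \<Prod>z\<leftarrow>xs. Gamma (z + s)) holomorphic_on {s. a' < Re s \<and> Re s < b + 1}" if "set xs \<subseteq> set bs" for xs
    using that
  proof (induction xs)
    case (Cons z xs)
    have "(\<lambda>s. Gamma (z + s)) holomorphic_on {s. a' < Re s \<and> Re s < b + 1}"
    proof (rule holomorphic_Gamma')
      fix s assume s: "s \<in> {s. a' < Re s \<and> Re s < b + 1}"
      have "Re (z + s) > 0" using a'(2)[of z] Cons.prems s by auto
      show "z + s \<notin> \<int>\<^sub>\<le>\<^sub>0"
      proof
        assume "z + s \<in> \<int>\<^sub>\<le>\<^sub>0"
        then obtain n where n: "z + s = - of_nat n" by (elim nonpos_Ints_cases')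
        have "Re (z + s) \<le> 0" unfolding n by simp
        with \<open>Re (z + s) > 0\<close> show False by simp
      qed
    qed (intro holomorphic_intros)
    then show ?case using Cons by (auto intro!: holomorphic_intros)
  qed auto
  have holf: "meijer_integrand bs \<rho> \<theta> holomorphic_on {s. a' < Re s \<and> Re s < b + 1} - {}"
    unfolding meijer_integrand_def[abs_def] Diff_empty
    by (rule holomorphic_on_mult[OF hol[OF order_refl]]) (intro holomorphic_intros)
  have bd: "b < b + 1" by simp
  note V = vertical_line_shift[OF a'(1) ab bd finite.emptyI _ holf _ d C, of "\<lambda>_. 0", simplified]
  show "integrable lborel (\<lambda>t. meijer_integrand bs \<rho> \<theta> (Complex a t))"
    "integrable lborel (\<lambda>t. meijer_integrand bs \<rho> \<theta> (Complex b t))"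
    "(\<integral>t. meijer_integrand bs \<rho> \<theta> (Complex b t) \<partial>lborel) = (\<integral>t. meijer_integrand bs \<rho> \<theta> (Complex a t) \<partial>lborel)"
    using V by auto
qed

text \<open>In particular the value does not depend on the unspecified abscissa in the definition.\<close>

lemma meijer_G_eq:
  assumes bs: "\<And>z. z \<in> set bs \<Longrightarrow> Im z = 0" and th: "\<bar>\<theta>\<bar> < real (length bs) * (pi / 2)"
    and c: "\<And>z. z \<in> set bs \<Longrightarrow> - Re z < c"
  shows "integrable lborel (\<lambda>t. meijer_integrand bs \<rho> \<theta> (Complex c t))"
    and "meijer_G bs \<rho> \<theta> = 1 / (2 * of_real pi) * (\<integral>t. meijer_integrand bs \<rho> \<theta> (Complex c t) \<partial>lborel)"
proof -
  define c0 where "c0 = meijer_abscissa bs"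
  have c0: "- Re z < c0" if "z \<in> set bs" for z
  proof -
    have "\<forall>z\<in>set bs. - Re z < c0"
      unfolding c0_def meijer_abscissa_def by (rule someI[of _ c]) (use c in blast)
    then show ?thesis using that by blast
  qed
  show "integrable lborel (\<lambda>t. meijer_integrand bs \<rho> \<theta> (Complex c t))"
    using meijer_integrand_shift(1)[OF bs th c, of "c + 1"] by simp
  have "(\<integral>t. meijer_integrand bs \<rho> \<theta> (Complex c0 t) \<partial>lborel) = (\<integral>t. meijer_integrand bs \<rho> \<theta> (Complex c t) \<partial>lborel)"
    using meijer_integrand_shift(3)[OF bs th c, of c0 \<rho>] meijer_integrand_shift(3)[OF bs th c0, of c \<rho>]
    by (cases c c0 rule: linorder_cases) auto
  moreover have "meijer_G bs \<rho> \<theta> = 1 / (2 * of_real pi * \<i>) * ((\<integral>t. meijer_integrand bs \<rho> \<theta> (Complex c0 t) \<partial>lborel) * \<i>)"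
    by (simp add: meijer_G_def meijer_integrand_def c0_def Let_def)
  ultimately show "meijer_G bs \<rho> \<theta> = 1 / (2 * of_real pi) * (\<integral>t. meijer_integrand bs \<rho> \<theta> (Complex c t) \<partial>lborel)"
    by simp
qed

section \<open>Residues and the summation formula\<close>

lemma tendsto_zeta: "(f \<longlongrightarrow> a) F \<Longrightarrow> a \<noteq> 1 \<Longrightarrow> ((\<lambda>s. zeta (f s)) \<longlongrightarrow> zeta a) F"
  by (rule isCont_tendsto_compose[OF isCont_zeta])

definition Mellin_integrand :: "nat \<Rightarrow> int \<Rightarrow> real \<Rightarrow> complex \<Rightarrow> complex" where
  "Mellin_integrand k r x s = Gamma s * zeta (s - of_int r) * zeta (of_nat k * s) * exp (- s * of_real (ln x))"

text \<open>From the rate pi/2 the Gamma factor and the two zeta factors lose 1/4 each, and pi/2 -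
  3/4 exceeds 1/2. For zeta(k s) the loss is taken as 1/(4 k), because k also multiplies the
  imaginary part.\<close>

lemma Mellin_integrand_decay:
  fixes a b :: real
  assumes k: "k \<ge> 1"
  shows "\<exists>C. \<forall>s. a \<le> Re s \<and> Re s \<le> b \<and> 1 \<le> \<bar>Im s\<bar> \<longrightarrow> norm (Mellin_integrand k r x s) \<le> C * exp (- (1/2) * \<bar>Im s\<bar>)"
proof -
  obtain C1 where C1: "C1 \<ge> 0" "\<And>s. a \<le> Re s \<Longrightarrow> Re s \<le> b \<Longrightarrow> 1 \<le> \<bar>Im s\<bar> \<Longrightarrow>
      norm (Gamma s) \<le> C1 * exp (- (pi / 2 - 1/4) * \<bar>Im s\<bar>)"
    using Gamma_decay[of "1/4" a b] by auto
  obtain C2 where C2: "C2 \<ge> 0" "\<And>s. a - of_int r \<le> Re s \<Longrightarrow> Re s \<le> b - of_int r \<Longrightarrow> 1 \<le> \<bar>Im s\<bar> \<Longrightarrow>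
      norm (zeta s) \<le> C2 * exp (1/4 * \<bar>Im s\<bar>)"
    using zeta_growth[of "1/4" "a - of_int r" "b - of_int r"] by auto
  have k4: "1 / (4 * real k) > 0" using k by simp
  obtain C3 where C3: "C3 \<ge> 0" "\<And>s. real k * a \<le> Re s \<Longrightarrow> Re s \<le> real k * b \<Longrightarrow> 1 \<le> \<bar>Im s\<bar> \<Longrightarrow>
      norm (zeta s) \<le> C3 * exp (1 / (4 * real k) * \<bar>Im s\<bar>)"
    using zeta_growth[OF k4, of "real k * a" "real k * b"] by blast
  define M where "M = max \<bar>a\<bar> \<bar>b\<bar> * \<bar>ln x\<bar>"
  show ?thesis
  proof (intro exI[of _ "C1 * C2 * C3 * exp M"] allI impI)
    fix s assume s: "a \<le> Re s \<and> Re s \<le> b \<and> 1 \<le> \<bar>Im s\<bar>"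
    have 1: "norm (Gamma s) \<le> C1 * exp (- (pi / 2 - 1/4) * \<bar>Im s\<bar>)" using C1(2) s by blast
    have 2: "norm (zeta (s - of_int r)) \<le> C2 * exp (1/4 * \<bar>Im s\<bar>)" using C2(2)[of "s - of_int r"] s by simp
    have 3: "norm (zeta (of_nat k * s)) \<le> C3 * exp (1/4 * \<bar>Im s\<bar>)"
    proof -
      have "1 * 1 \<le> real k * \<bar>Im s\<bar>" using k s by (intro mult_mono) auto
      then have "norm (zeta (of_nat k * s)) \<le> C3 * exp (1 / (4 * real k) * \<bar>Im (of_nat k * s)\<bar>)"
        using s k by (intro C3(2)) (auto simp: abs_mult intro: mult_left_mono)
      also have "1 / (4 * real k) * \<bar>Im (of_nat k * s)\<bar> = 1/4 * \<bar>Im s\<bar>" using k by (simp add: abs_mult)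
      finally show ?thesis .
    qed
    have 4: "norm (exp (- s * of_real (ln x))) \<le> exp M"
    proof -
      have "- (Re s * ln x) \<le> \<bar>Re s\<bar> * \<bar>ln x\<bar>" by (metis abs_ge_minus_self abs_mult)
      also have "\<dots> \<le> M" unfolding M_def using s by (intro mult_right_mono) auto
      finally show ?thesis by (simp add: norm_exp)
    qed
    have "norm (Mellin_integrand k r x s) \<le> (C1 * exp (- (pi / 2 - 1/4) * \<bar>Im s\<bar>)) * (C2 * exp (1/4 * \<bar>Im s\<bar>)) * (C3 * exp (1/4 * \<bar>Im s\<bar>)) * exp M"
      unfolding Mellin_integrand_def norm_mult
      by (rule mult_mono[OF mult_mono[OF mult_mono[OF 1 2] 3] 4]) (use C1(1) C2(1) C3(1) in auto)
    also have "\<dots> = C1 * C2 * C3 * exp M * (exp (- (pi / 2 - 1/4) * \<bar>Im s\<bar>) * exp (1/4 * \<bar>Im s\<bar>) * exp (1/4 * \<bar>Im s\<bar>))"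
      by (simp only: mult_ac)
    also have "\<dots> \<le> C1 * C2 * C3 * exp M * exp (- (1/2) * \<bar>Im s\<bar>)"
    proof (intro mult_left_mono)
      have "3/4 \<le> pi / 2 - 1/2" using pi_gt3 by simp
      then have "(3/4 - pi / 2) * \<bar>Im s\<bar> \<le> - (1/2) * \<bar>Im s\<bar>" by (intro mult_right_mono) auto
      then show "exp (- (pi / 2 - 1/4) * \<bar>Im s\<bar>) * exp (1/4 * \<bar>Im s\<bar>) * exp (1/4 * \<bar>Im s\<bar>) \<le> exp (- (1/2) * \<bar>Im s\<bar>)"
        unfolding exp_add[symmetric] exp_le_cancel_iff by (simp add: algebra_simps)
    qed (use C1(1) C2(1) C3(1) in auto)
    finally show "norm (Mellin_integrand k r x s) \<le> C1 * C2 * C3 * exp M * exp (- (1/2) * \<bar>Im s\<bar>)" .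
  qed
qed

section \<open>Residues of the Mellin integrand\<close>

lemma int_mult_even_neq_1: "even (b :: int) \<Longrightarrow> a * b \<noteq> 1"
  by (metis dvd_mult odd_one)

text \<open>The integer k (1 + r) is even, hence not 1; so zeta(s - r) is regular at the pole 1/k of
  zeta(k s).\<close>

lemma inverse_of_nat_minus_odd_neq_1:
  assumes k: "k \<ge> 1" and r: "odd r"
  shows "1 / of_nat k - of_int r \<noteq> (1 :: complex)"
proof
  assume "1 / of_nat k - of_int r = (1 :: complex)"
  then have "1 = of_nat k * (1 + of_int r :: complex)" using k by (simp add: field_simps)
  then have "of_int 1 = (of_int (int k * (1 + r)) :: complex)" by simp
  then have "1 = int k * (1 + r)" by (simp only: of_int_eq_iff)
  then show False using int_mult_even_neq_1[of "1 + r" "int k"] r by simp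
qed

text \<open>The same parity seen from the other pole: zeta(k s) is regular at s = 1 + r.\<close>

lemma of_nat_mult_even_neq_1:
  assumes "odd r"
  shows "of_nat k * (1 + of_int r) \<noteq> (1 :: complex)"
proof
  assume "of_nat k * (1 + of_int r) = (1 :: complex)"
  then have "of_int (int k * (1 + r)) = (of_int 1 :: complex)" by simp
  then have "int k * (1 + r) = 1" by (simp only: of_int_eq_iff)
  then show False using int_mult_even_neq_1[of "1 + r" "int k"] assms by simp
qed

text \<open>The residue 1 of zeta is rescaled by s - 1/k = (k s - 1)/k, whence the factor
  1/k.\<close>

lemma residue_inverse_of_nat:
  assumes k: "k \<ge> 1" and r: "odd r" and x: "x > 0"
  shows "((\<lambda>s. Mellin_integrand k r x s * (s - 1 / of_nat k)) \<longlongrightarrow>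
     1 / of_nat k * Gamma (1 / of_nat k) * zeta (1 / of_nat k - of_int r) * of_real (x powr (- 1 / real k))) (at (1 / of_nat k))"
proof -
  have k0: "of_nat k \<noteq> (0 :: complex)" using k by simp
  have np: "1 / of_nat k \<notin> (\<int>\<^sub>\<le>\<^sub>0 :: complex set)"
  proof
    assume "1 / of_nat k \<in> (\<int>\<^sub>\<le>\<^sub>0 :: complex set)"
    then obtain n where n: "1 / of_nat k = (- of_nat n :: complex)" by (elim nonpos_Ints_cases')
    have "complex_of_real (1 / real k) = of_real (- real n)" using n by simp
    then have "1 / real k = - real n" by (simp only: of_real_eq_iff)
    moreover have "1 / real k > 0" using k by simp
    ultimately show False by simp
  qed
  have fl: "filterlim (\<lambda>s. of_nat k * s) (at 1) (at (1 / of_nat k :: complex))"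
  proof (rule filterlim_atI)
    have "((\<lambda>s. of_nat k * s) \<longlongrightarrow> of_nat k * (1 / of_nat k)) (at (1 / of_nat k :: complex))" by (intro tendsto_intros)
    then show "((\<lambda>s. of_nat k * s) \<longlongrightarrow> 1) (at (1 / of_nat k :: complex))" using k0 by simp
    show "\<forall>\<^sub>F s in at (1 / of_nat k :: complex). of_nat k * s \<noteq> 1"
      using eventually_neq_at_within[of "1 / of_nat k :: complex" "1 / of_nat k" UNIV]
      by eventually_elim (use k0 in \<open>auto simp: field_simps\<close>)
  qed
  have ex: "exp (- (1 / of_nat k) * of_real (ln x)) = complex_of_real (x powr (- 1 / real k))"
    using x by (simp add: powr_def exp_of_real[symmetric])
  have "((\<lambda>s. 1 / of_nat k * Gamma s * zeta (s - of_int r) * exp (- s * of_real (ln x)) * (zeta (of_nat k * s) * (of_nat k * s - 1))) \<longlongrightarrow>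
     1 / of_nat k * Gamma (1 / of_nat k) * zeta (1 / of_nat k - of_int r) * exp (- (1 / of_nat k) * of_real (ln x)) * 1) (at (1 / of_nat k))"
    using inverse_of_nat_minus_odd_neq_1[OF k r] np
    by (intro tendsto_mult tendsto_Gamma tendsto_zeta tendsto_intros filterlim_compose[OF zeta_residue fl])
  moreover have "1 / of_nat k * Gamma s * zeta (s - of_int r) * exp (- s * of_real (ln x)) * (zeta (of_nat k * s) * (of_nat k * s - 1)) =
      Mellin_integrand k r x s * (s - 1 / of_nat k)" for s
  proof -
    have "s - 1 / of_nat k = (of_nat k * s - 1) / of_nat k" using k0 by (simp add: field_simps)
    then show ?thesis by (simp add: Mellin_integrand_def)
  qed
  ultimately show ?thesis unfolding ex by simp
qed

lemma filterlim_minus_at: "filterlim (\<lambda>s :: complex. s - c) (at (p - c)) (at p)"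
  by (rule filterlim_atI) (auto intro!: tendsto_intros simp: eventually_at_filter)

lemma zeta_shift_residue: "((\<lambda>s. zeta (s - of_int r) * (s - (1 + of_int r))) \<longlongrightarrow> 1) (at (1 + of_int r))"
  using filterlim_compose[OF zeta_residue, of "\<lambda>s. s - of_int r" "at (1 + of_int r)"] filterlim_minus_at[of "of_int r" "1 + of_int r"]
  by (simp add: algebra_simps)

lemma exp_minus_ln_powi:
  assumes "x > 0"
  shows "exp (- (of_int n) * of_real (ln x)) = complex_of_real (x powi (- n))"
proof -
  have "x powi (- n) = exp (of_int (- n) * ln x)"
    using assms powr_real_of_int'[of x "- n"] by (simp add: powr_def)
  then show ?thesis by (simp add: exp_of_real[symmetric])
qed

text \<open>For r >= 0 only zeta(s - r) is singular at 1 + r. For r < 0 the point is -m with m > 0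
  even; Gamma and zeta(s - r) give two factors 1/(s + m), one of which turns zeta(k s) into k times
  its difference quotient at the trivial zero - k m.\<close>

lemma residue_one_plus:
  assumes k: "k \<ge> 1" and r: "odd r" "r \<noteq> - 1" and x: "x > 0"
  shows "((\<lambda>s. Mellin_integrand k r x s * (s - (1 + of_int r))) \<longlongrightarrow> R_one_plus k r x) (at (1 + of_int r))"
proof (cases "r \<ge> 0")
  case True
  have np: "1 + of_int r \<notin> (\<int>\<^sub>\<le>\<^sub>0 :: complex set)"
    using True by (auto elim!: nonpos_Ints_cases' simp: complex_eq_iff)
  have G: "Gamma (1 + of_int r) = (fact (nat r) :: complex)"
    using Gamma_fact[of "nat r", where 'a = complex] True by simp
  have "((\<lambda>s. Gamma s * zeta (of_nat k * s) * exp (- s * of_real (ln x)) * (zeta (s - of_int r) * (s - (1 + of_int r)))) \<longlongrightarrow>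
     Gamma (1 + of_int r) * zeta (of_nat k * (1 + of_int r)) * exp (- (1 + of_int r) * of_real (ln x)) * 1) (at (1 + of_int r))"
    using np of_nat_mult_even_neq_1[OF r(1)]
    by (intro tendsto_mult tendsto_Gamma tendsto_zeta tendsto_intros zeta_shift_residue)
  also have "exp (- (1 + of_int r) * of_real (ln x)) = complex_of_real (x powi (- (1 + r)))"
    using exp_minus_ln_powi[OF x, of "1 + r"] by simp
  also have "Gamma (1 + of_int r) * zeta (of_nat k * (1 + of_int r)) * complex_of_real (x powi (- (1 + r))) * 1 = R_one_plus k r x"
    using True by (simp add: R_one_plus_def G)
  also have "(\<lambda>s. Gamma s * zeta (of_nat k * s) * exp (- s * of_real (ln x)) * (zeta (s - of_int r) * (s - (1 + of_int r)))) =
      (\<lambda>s. Mellin_integrand k r x s * (s - (1 + of_int r)))"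
    by (simp add: Mellin_integrand_def fun_eq_iff mult_ac)
  finally show ?thesis .
next
  case False
  define m where "m = nat (- (1 + r))"
  have m: "m > 0" "even m" "1 + of_int r = (- of_nat m :: complex)" "1 + r = - int m"
  proof -
    show "m > 0" using False r by (simp add: m_def)
    have im: "int m = - (1 + r)" using False by (simp add: m_def)
    then have "even (int m)" using r by simp
    then show "even m" by simp
    show "1 + r = - int m" using im by simp
    then have "of_int (1 + r) = (of_int (- int m) :: complex)" by (simp only:)
    then show "1 + of_int r = (- of_nat m :: complex)" by simp
  qed
  let ?p = "- of_nat m :: complex"
  have z0: "zeta (of_nat k * ?p) = 0"
    using zeta_neg_even_nat[of "k * m"] k m(1,2) by simp
  have "((\<lambda>s. (zeta s - zeta (of_nat k * ?p)) / (s - of_nat k * ?p)) \<longlongrightarrow> deriv zeta (of_nat k * ?p)) (at (of_nat k * ?p))"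
  proof -
    have "of_nat k * ?p \<noteq> 1"
    proof -
      have "Re (of_nat k * ?p) \<le> 0" by simp
      then show ?thesis by (metis one_complex.sel(1) not_one_le_zero)
    qed
    then have "(zeta has_field_derivative deriv zeta (of_nat k * ?p)) (at (of_nat k * ?p))"
      by (intro holomorphic_derivI[OF holomorphic_zeta]) auto
    then show ?thesis by (simp add: has_field_derivative_iff)
  qed
  moreover have "filterlim (\<lambda>s. of_nat k * s) (at (of_nat k * ?p)) (at ?p)"
  proof (rule filterlim_atI)
    show "\<forall>\<^sub>F s in at ?p. of_nat k * s \<noteq> of_nat k * ?p"
      using eventually_neq_at_within[of ?p ?p UNIV]
    proof eventually_elim
      case (elim s)
      then show ?case using k by (simp only: mult_cancel_left of_nat_eq_0_iff) simp
    qed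
  qed (intro tendsto_intros)
  ultimately have dz: "((\<lambda>s. (zeta (of_nat k * s) - zeta (of_nat k * ?p)) / (of_nat k * s - of_nat k * ?p)) \<longlongrightarrow> deriv zeta (of_nat k * ?p)) (at ?p)"
    by (rule filterlim_compose)
  have zs: "((\<lambda>s. zeta (s - of_int r) * (s - ?p)) \<longlongrightarrow> 1) (at ?p)"
    using zeta_shift_residue[of r] unfolding m(3) .
  have ex: "exp (- ?p * of_real (ln x)) = complex_of_real (x powi (- (1 + r)))"
    using exp_minus_ln_powi[OF x, of "1 + r"] m(3) by simp
  have "((\<lambda>s. Gamma s * (s + of_nat m) * (zeta (s - of_int r) * (s - ?p)) * (of_nat k *
       ((zeta (of_nat k * s) - zeta (of_nat k * ?p)) / (of_nat k * s - of_nat k * ?p))) * exp (- s * of_real (ln x))) \<longlongrightarrow>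
      (- 1) ^ m / fact m * 1 * (of_nat k * deriv zeta (of_nat k * ?p)) * exp (- ?p * of_real (ln x))) (at ?p)"
    by (intro tendsto_mult Gamma_residues zs dz tendsto_intros)
  moreover have "\<forall>\<^sub>F s in at ?p. Gamma s * (s + of_nat m) * (zeta (s - of_int r) * (s - ?p)) * (of_nat k *
       ((zeta (of_nat k * s) - zeta (of_nat k * ?p)) / (of_nat k * s - of_nat k * ?p))) * exp (- s * of_real (ln x)) =
      Mellin_integrand k r x s * (s - (1 + of_int r))"
    using eventually_neq_at_within[of ?p ?p UNIV]
  proof eventually_elim
    case (elim s)
    have nz: "s + of_nat m \<noteq> 0" using elim by (simp add: eq_neg_iff_add_eq_0)
    have "of_nat k * s - of_nat k * ?p = of_nat k * (s + of_nat m)" by (simp add: algebra_simps)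
    then have "of_nat k * ((zeta (of_nat k * s) - zeta (of_nat k * ?p)) / (of_nat k * s - of_nat k * ?p)) = zeta (of_nat k * s) / (s + of_nat m)"
      unfolding z0 using k by simp
    then show ?case unfolding m(3) using nz by (simp add: Mellin_integrand_def)
  qed
  ultimately have "((\<lambda>s. Mellin_integrand k r x s * (s - (1 + of_int r))) \<longlongrightarrow>
      (- 1) ^ m / fact m * 1 * (of_nat k * deriv zeta (of_nat k * ?p)) * exp (- ?p * of_real (ln x))) (at ?p)"
    by (rule Lim_transform_eventually)
  also have "(- 1) ^ m / fact m * 1 * (of_nat k * deriv zeta (of_nat k * ?p)) * exp (- ?p * of_real (ln x)) = R_one_plus k r x"
  proof -
    have "of_int (int k * (1 + r)) = of_nat k * ?p" by (simp flip: m(3))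
    moreover have "(-1 :: complex) powi (1 + r) = (- 1) ^ m" unfolding m(4) using m(2) by simp
    ultimately show ?thesis unfolding ex using False by (simp add: R_one_plus_def m_def add.commute)
  qed
  finally show ?thesis unfolding m(3) .
qed

text \<open>The residue at -m as long as -m differs from 1 + r, so that Gamma alone is singular
  there.\<close>

definition neg_residue :: "nat \<Rightarrow> int \<Rightarrow> real \<Rightarrow> nat \<Rightarrow> complex" where
  "neg_residue k r x m = (- 1) ^ m / fact m * zeta (- of_nat m - of_int r) * zeta (- of_nat (k * m)) * of_real (x ^ m)"

lemma residue_neg_nat:
  assumes k: "k \<ge> 1" and m: "int m \<noteq> - (1 + r)" and x: "x > 0"
  shows "((\<lambda>s. Mellin_integrand k r x s * (s - (- of_nat m))) \<longlongrightarrow> neg_residue k r x m) (at (- of_nat m))"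
proof -
  have 1: "- of_nat m - of_int r \<noteq> (1 :: complex)"
  proof
    assume "- of_nat m - of_int r = (1 :: complex)"
    then have "of_int (- int m - r) = (of_int 1 :: complex)" by simp
    then have "- int m - r = 1" by (simp only: of_int_eq_iff)
    then show False using m by simp
  qed
  have 2: "of_nat k * (- of_nat m) \<noteq> (1 :: complex)"
  proof -
    have "Re (of_nat k * (- of_nat m)) \<le> 0" by simp
    then show ?thesis by (metis one_complex.sel(1) not_one_le_zero)
  qed
  have ex: "exp (- (- of_nat m) * of_real (ln x)) = complex_of_real (x ^ m)"
    using x by (simp add: exp_of_nat_mult exp_of_real)
  have "((\<lambda>s. Gamma s * (s + of_nat m) * zeta (s - of_int r) * zeta (of_nat k * s) * exp (- s * of_real (ln x))) \<longlongrightarrow>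
     (- 1) ^ m / fact m * zeta (- of_nat m - of_int r) * zeta (of_nat k * (- of_nat m)) * exp (- (- of_nat m) * of_real (ln x))) (at (- of_nat m))"
    by (intro tendsto_mult Gamma_residues tendsto_zeta 1 2 tendsto_intros)
  also have "(\<lambda>s. Gamma s * (s + of_nat m) * zeta (s - of_int r) * zeta (of_nat k * s) * exp (- s * of_real (ln x))) =
      (\<lambda>s. Mellin_integrand k r x s * (s - (- of_nat m)))"
    by (simp add: Mellin_integrand_def fun_eq_iff mult_ac)
  finally show ?thesis unfolding ex by (simp add: neg_residue_def)
qed

lemma neg_residue_even: "even m \<Longrightarrow> m > 0 \<Longrightarrow> k \<ge> 1 \<Longrightarrow> neg_residue k r x m = 0"
  using zeta_neg_even_nat[of "k * m"] by (simp add: neg_residue_def)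

text \<open>Here m + r is even and positive, so zeta(- m - r) is a trivial zero; this is what leaves
  only finitely many odd m.\<close>

lemma neg_residue_odd:
  assumes "odd m" "odd r" "int m + r > 0"
  shows "neg_residue k r x m = 0"
proof -
  define n where "n = nat (int m + r)"
  have n: "int n = int m + r" using assms by (simp add: n_def)
  have "even (int n)" unfolding n using assms by simp
  then have "even n" by simp
  moreover have "n > 0" using assms(3) n by simp
  ultimately have "zeta (- of_nat n) = 0" by (rule zeta_neg_even_nat)
  moreover have "- of_nat m - of_int r = (- of_nat n :: complex)"
  proof -
    have "of_int (int n) = (of_int (int m + r) :: complex)" by (simp only: n)
    then show ?thesis by simp
  qed
  ultimately show ?thesis by (simp add: neg_residue_def)
qed

text \<open>With m = 2 i + 1 and 2 n = - r - m, the two zeta values are zeta(2 n) and zeta(- k m),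
  both given by Bernoulli numbers; n = 0 occurs when m = - r. The sign comes out because (1 + r)/2 =
  - (n + i).\<close>

lemma neg_residue_R_rest_term:
  assumes k: "odd k" and r: "odd r" "r < 0" and i: "int (2 * i + 1) \<le> - r"
  shows "neg_residue k r x (2 * i + 1) = of_real ((- 1) powi ((1 + r) div 2) / 2 *
     ((- 1) ^ (i + 1) * bernoulli (k * (2 * i + 1) + 1) / (fact (2 * i + 1) * real (k * (2 * i + 1) + 1)) *
           (bernoulli (nat (- 2 * int i - 1 - r)) * (2 * pi) powi (- r) / fact (nat (- (2 * int i + 1 + r)))) *
           (x / (2 * pi)) ^ (2 * i + 1)))"
proof -
  define m where "m = 2 * i + 1"
  obtain q where q: "r = 2 * q + 1" using r by (elim oddE)
  define n where "n = nat (- q - 1 - int i)"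
  have n: "int n = - q - 1 - int i" using i by (simp add: n_def q)
  have nn: "nat (- 2 * int i - 1 - r) = 2 * n" "nat (- (2 * int i + 1 + r)) = 2 * n" using n by (simp_all add: q)
  have rr: "- r = int (2 * n + m)" using n by (simp add: q m_def)
  have "of_int (- r) = (of_int (int (2 * n + m)) :: complex)" by (simp only: rr)
  then have h: "- of_int r = (of_nat (2 * n) + of_nat m :: complex)" by simp
  have "- of_nat m - of_int r = (- of_int r - of_nat m :: complex)" by simp
  then have a1: "- of_nat m - of_int r = (of_nat (2 * n) :: complex)" unfolding h by simp
  have z1: "zeta (- of_nat m - of_int r) = of_real ((-1) ^ (n + 1) * (bernoulli (2 * n) * (2 * pi) ^ (2 * n) / (2 * fact (2 * n))))"
    unfolding a1 zeta_even_nat by simp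
  have z2: "zeta (- of_nat (k * m)) = of_real (- (bernoulli (k * m + 1) / real (k * m + 1)))"
    using zeta_neg_odd_nat[of "k * m"] k by (simp add: m_def del: of_nat_add of_nat_mult)
  have pw: "(2 * pi) powi (- r) * (x / (2 * pi)) ^ m = (2 * pi) ^ (2 * n) * x ^ m"
    unfolding rr power_int_of_nat power_add by (simp add: power_divide)
  have sg: "(- 1) powi ((1 + r) div 2) * (- 1) ^ (i + 1) = ((- 1) ^ (n + 1) :: real)"
  proof -
    have h: "(1 + r) div 2 = - int (n + i)" using n by (simp add: q)
    have "(- 1) powi ((1 + r) div 2) = ((- 1) ^ (n + i) :: real)"
      unfolding h power_int_minus power_int_of_nat by (simp flip: power_inverse)
    then have "(- 1) powi ((1 + r) div 2) * (- 1) ^ (i + 1) = ((- 1) ^ (n + 1) * ((- 1) ^ i * (- 1) ^ i) :: real)"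
      by (simp add: power_add)
    also have "(- 1) ^ i * (- 1) ^ i = (1 :: real)" by (simp flip: power_mult_distrib)
    finally show ?thesis by simp
  qed
  have om: "(- 1) ^ m = (- 1 :: complex)" by (simp add: m_def)
  have aux1: "- 1 / F * (E * (B2 * P / (2 * F2))) * (- (B / M)) * X = E / 2 * (B / (F * M) * (B2 / F2) * (P * X))"
    for F E B2 P F2 B M X :: real
    by (simp only: divide_inverse inverse_mult_distrib mult_minus_left mult_minus_right minus_minus mult_1_left mult_ac)
  have aux2: "sA * sB / 2 * (B / (F * M) * (B2 / F2) * (Q * Y)) = sA / 2 * (sB * B / (F * M) * (B2 * Q / F2) * Y)"
    for sA sB B F M B2 F2 Q Y :: real
    by (simp only: divide_inverse inverse_mult_distrib mult_ac)
  have "neg_residue k r x m = of_real (- 1 / fact m * ((-1) ^ (n + 1) * (bernoulli (2 * n) * (2 * pi) ^ (2 * n) / (2 * fact (2 * n)))) *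
      (- (bernoulli (k * m + 1) / real (k * m + 1))) * x ^ m)"
    unfolding neg_residue_def z1 z2 om
    by (simp only: of_real_mult of_real_divide of_real_minus of_real_1 of_real_fact)
  also have "- 1 / fact m * ((-1) ^ (n + 1) * (bernoulli (2 * n) * (2 * pi) ^ (2 * n) / (2 * fact (2 * n)))) *
      (- (bernoulli (k * m + 1) / real (k * m + 1))) * x ^ m =
      (-1) ^ (n + 1) / 2 * (bernoulli (k * m + 1) / (fact m * real (k * m + 1)) * (bernoulli (2 * n) / fact (2 * n)) * ((2 * pi) ^ (2 * n) * x ^ m))"
    by (rule aux1)
  also have "\<dots> = (- 1) powi ((1 + r) div 2) / 2 *
     ((- 1) ^ (i + 1) * bernoulli (k * m + 1) / (fact m * real (k * m + 1)) *
           (bernoulli (2 * n) * (2 * pi) powi (- r) / fact (2 * n)) * (x / (2 * pi)) ^ m)"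
    unfolding sg[symmetric] pw[symmetric] by (rule aux2)
  finally show ?thesis unfolding nn m_def .
qed

text \<open>The point m = 0 gives - zeta(- r)/2. Trivial zeros remove all positive even m and all
  odd m > - r; the surviving m = 2 i + 1 <= - r are the indices of \<open>R_rest\<close>, and N >=
  |r| ensures that none is cut off.\<close>

lemma sum_neg_residues:
  assumes k: "k \<ge> 1" "odd k" and r: "odd r" "r \<noteq> - 1" and N: "int N \<ge> \<bar>r\<bar>"
  shows "(\<Sum>m | m \<le> N \<and> int m \<noteq> - (1 + r). neg_residue k r x m) = - 1 / 2 * zeta (- of_int r) + of_real (R_rest k r x)"
proof -
  let ?M = "{m. m \<le> N \<and> int m \<noteq> - (1 + r)}"
  have fin: "finite ?M" by simp
  have z: "neg_residue k r x 0 = - 1 / 2 * zeta (- of_int r)" by (simp add: neg_residue_def zeta_0)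
  show ?thesis
  proof (cases "r \<ge> 1")
    case True
    have "(\<Sum>m\<in>?M. neg_residue k r x m) = (\<Sum>m\<in>{0}. neg_residue k r x m)"
    proof (rule sum.mono_neutral_right[OF fin])
      show "{0} \<subseteq> ?M" using True by simp
      show "\<forall>m\<in>?M - {0}. neg_residue k r x m = 0"
      proof
        fix m assume m: "m \<in> ?M - {0}"
        show "neg_residue k r x m = 0"
          using neg_residue_even[of m k r x] neg_residue_odd[of m r k x] m k r True by (cases "even m") auto
      qed
    qed
    then show ?thesis using True by (simp add: z R_rest_def)
  next
    case False
    define I where "I = nat ((- (1 + r)) div 2)"
    obtain q where q: "r = 2 * q + 1" using r by (elim oddE)
    have q1: "q \<le> - 2" using False r q by presburger
    have I: "int I = - q - 1" using q1 by (simp add: I_def q)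
    let ?O = "(\<lambda>i. 2 * i + 1) ` {0..I}"
    have "(\<Sum>m\<in>?M. neg_residue k r x m) = (\<Sum>m\<in>insert 0 ?O. neg_residue k r x m)"
    proof (rule sum.mono_neutral_right[OF fin])
      show "insert 0 ?O \<subseteq> ?M"
      proof
        fix m assume "m \<in> insert 0 ?O"
        then consider "m = 0" | i where "i \<le> I" "m = 2 * i + 1" by auto
        then show "m \<in> ?M"
        proof cases
          case 1
          then show ?thesis using r by simp
        next
          case 2
          have "int m \<le> int N" using 2 I N q by simp
          moreover have "int m \<noteq> - (1 + r)" using 2 q by presburger
          ultimately show ?thesis by simp
        qed
      qed
      show "\<forall>m\<in>?M - insert 0 ?O. neg_residue k r x m = 0"
      proof
        fix m assume m: "m \<in> ?M - insert 0 ?O"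
        show "neg_residue k r x m = 0"
        proof (cases "even m")
          case True
          then show ?thesis using m k by (intro neg_residue_even) auto
        next
          case odd: False
          then obtain i where i: "m = 2 * i + 1" by (elim oddE)
          have "\<not> i \<le> I" using m i by auto
          then have "int m + r > 0" using i I q by simp
          then show ?thesis using odd r by (intro neg_residue_odd) auto
        qed
      qed
    qed
    also have "\<dots> = neg_residue k r x 0 + (\<Sum>m\<in>?O. neg_residue k r x m)"
      by (subst sum.insert) auto
    also have "(\<Sum>m\<in>?O. neg_residue k r x m) = (\<Sum>i=0..I. neg_residue k r x (2 * i + 1))"
      by (subst sum.reindex) (auto simp: inj_on_def)
    also have "\<dots> = of_real (R_rest k r x)"
    proof -
      have t: "neg_residue k r x (2 * i + 1) = of_real ((- 1) powi ((1 + r) div 2) / 2 *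
         ((- 1) ^ (i + 1) * bernoulli (k * (2 * i + 1) + 1) / (fact (2 * i + 1) * real (k * (2 * i + 1) + 1)) *
           (bernoulli (nat (- 2 * int i - 1 - r)) * (2 * pi) powi (- r) / fact (nat (- (2 * int i + 1 + r)))) *
           (x / (2 * pi)) ^ (2 * i + 1)))" if "i \<in> {0..I}" for i
        using that I q q1 k r by (intro neg_residue_R_rest_term) auto
      show ?thesis
        unfolding R_rest_def if_not_P[OF False] I_def[symmetric] sum_distrib_left of_real_sum
        by (rule sum.cong[OF refl t])
    qed
    finally show ?thesis unfolding z .
  qed
qed

section \<open>Term-by-term integration of the two Dirichlet series\<close>

text \<open>Mellin inversion is applied at y = (n + 1) x; the factors (n + 1)^(-s) under the
  integral sum to the Dirichlet series of \<open>D_fun\<close>.\<close>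

lemma D_exp_sums_Mellin:
  assumes k: "k \<ge> 1" and x: "x > 0" and c: "c > 1" "c - of_int r > 1"
  shows "(\<lambda>n. complex_of_real (D_fun k r (Suc n) * exp (- real (Suc n) * x))) sums
     (1 / (2 * of_real pi) * (\<integral>t. Mellin_integrand k r x (Complex c t) \<partial>lborel))"
proof -
  have c0: "c > 0" "real k * c > 1"
  proof -
    show "c > 0" using c by simp
    have "1 * c \<le> real k * c" using k c by (intro mult_right_mono) auto
    then show "real k * c > 1" using c(1) by linarith
  qed
  define f where "f n t = of_real (D_fun k r (Suc n)) * (Gamma (Complex c t) * exp (- Complex c t * of_real (ln (real (Suc n) * x))))" for n t
  have y: "real (Suc n) * x > 0" for n using x by simp
  note MI = Mellin_inversion_exp[OF c0(1) y]
  have int: "integrable lborel (f n)" for n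
    unfolding f_def[abs_def] by (intro integrable_mult_right MI(1))
  have val: "(\<integral>t. f n t \<partial>lborel) = 2 * of_real pi * of_real (D_fun k r (Suc n) * exp (- real (Suc n) * x))" for n
    unfolding f_def integral_mult_right_zero MI(2) by (simp add: algebra_simps)
  have lnx: "ln (real (Suc n) * x) = ln (real (Suc n)) + ln x" for n
    using x by (subst ln_mult) auto
  have fe: "f n t = Gamma (Complex c t) * exp (- Complex c t * of_real (ln x)) *
      (of_real (D_fun k r (Suc n)) * of_nat (Suc n) powr (- Complex c t))" for n t
    unfolding f_def lnx of_nat_powr_exp[OF zero_less_Suc] of_real_add distrib_left exp_add by (simp only: mult_ac)
  have fsum: "(\<lambda>n. f n t) sums Mellin_integrand k r x (Complex c t)" for t
  proof -
    have "(\<lambda>n. f n t) sums (Gamma (Complex c t) * exp (- Complex c t * of_real (ln x)) *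
      (zeta (Complex c t - of_int r) * zeta (of_nat k * Complex c t)))"
      unfolding fe using c c0 by (intro sums_mult D_fun_dirichlet_series k) auto
    then show ?thesis by (simp add: Mellin_integrand_def mult_ac)
  qed
  have Ds: "summable (\<lambda>n. D_fun k r (Suc n) * real (Suc n) powr (- c))"
    using D_fun_dirichlet_series[OF k, of "of_real c" r] c c0
    by (intro summable_of_real_dirichlet) (auto simp: sums_iff)
  \<comment> \<open>The norm splits into a factor in n and a factor in t, so the exchange reduces to
    the convergence of one real series.\<close>
  have nf: "norm (f n t) = D_fun k r (Suc n) * real (Suc n) powr (- c) * norm (Gamma (Complex c t) * exp (- Complex c t * of_real (ln x)))" for n t
  proof -
    have "norm (of_nat (Suc n) powr (- Complex c t)) = real (Suc n) powr (- c)"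
      using norm_powr_real_powr[of "of_nat (Suc n)" "- Complex c t"] by (simp del: of_nat_Suc)
    then show ?thesis unfolding fe norm_mult using D_fun_nonneg[of k r "Suc n"] by simp
  qed
  have ns: "summable (\<lambda>n. norm (f n t))" for t
    unfolding nf by (intro summable_mult2 Ds)
  have nis: "summable (\<lambda>n. \<integral>t. norm (f n t) \<partial>lborel)"
    unfolding nf integral_mult_right_zero by (intro summable_mult2 Ds)
  have "(\<lambda>n. \<integral>t. f n t \<partial>lborel) sums (\<integral>t. (\<Sum>n. f n t) \<partial>lborel)"
    by (rule sums_integral[OF int _ nis]) (use ns in auto)
  then have "(\<lambda>n. 2 * of_real pi * complex_of_real (D_fun k r (Suc n) * exp (- real (Suc n) * x))) sums (\<integral>t. Mellin_integrand k r x (Complex c t) \<partial>lborel)"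
    unfolding val sums_unique[OF fsum, symmetric] .
  from sums_mult[OF this, of "1 / (2 * of_real pi)"] show ?thesis by (simp add: mult.assoc)
qed

text \<open>The modulus X is linear in n, so each integrand is the one for n = 1 times n^(-w), and
  summation over n produces the Dirichlet series of \<open>S_fun\<close> under the integral.\<close>

lemma S_meijer_sums:
  assumes k: "k \<ge> 1" and x: "x > 0" and c: "c > 1" "c + of_int r > 1" and j: "j \<in> j_range k"
  defines "bs \<equiv> G_params k r" and "\<theta> \<equiv> X_arg (- j)"
  defines "h \<equiv> (\<lambda>w. meijer_integrand bs (X_abs k x 1) \<theta> w * (zeta (w + of_int r) * zeta (of_nat k * w - of_nat k + 1)))"
  shows "integrable lborel (\<lambda>t. h (Complex c t))"
    and "(\<lambda>n. of_real (S_fun k r (Suc n)) * meijer_G bs (X_abs k x (Suc n)) \<theta>) sums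
       (1 / (2 * of_real pi) * (\<integral>t. h (Complex c t) \<partial>lborel))"
proof -
  have kc: "real k * c - real k > 0"
  proof -
    have "0 < real k * (c - 1)" using k c by simp
    then show ?thesis by (simp add: algebra_simps)
  qed
  have im: "Im z = 0" if "z \<in> set bs" for z
    using that by (auto simp: bs_def G_params_def)
  have re: "- Re z < c" if "z \<in> set bs" for z
  proof -
    have "z = of_int r \<or> (\<exists>m<k. z = - (of_nat m / of_nat k))"
      using that by (auto simp: bs_def G_params_def)
    then consider "z = of_int r" | m where "m < k" "z = - (of_nat m / of_nat k)" by blast
    then show ?thesis
    proof cases
      case 1
      then show ?thesis using c by simp
    next
      case 2
      have "z = of_real (- (real m / real k))" using 2 by simp
      then have "Re z = - (real m / real k)" by (simp only: Re_complex_of_real)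
      moreover have "real m / real k \<le> 1" using 2 by simp
      ultimately show ?thesis using c by simp
    qed
  qed
  \<comment> \<open>Since |j| <= k - 1, the angle lies strictly inside the range k pi / 2 of
    convergence.\<close>
  have th: "\<bar>\<theta>\<bar> < real (length bs) * (pi / 2)"
  proof -
    have "\<bar>j\<bar> < int k" using j by (auto simp: j_range_def)
    then have "\<bar>real_of_int j\<bar> < real k" by linarith
    then have "\<bar>real_of_int j\<bar> * (pi / 2) < real k * (pi / 2)" by (intro mult_strict_right_mono) auto
    moreover have "length bs = k" using k by (simp add: bs_def G_params_def)
    ultimately show ?thesis by (simp add: \<theta>_def X_arg_def abs_mult mult.commute)
  qed
  define f where "f n t = of_real (S_fun k r (Suc n)) * meijer_integrand bs (X_abs k x (Suc n)) \<theta> (Complex c t)" for n t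
  note MG = meijer_G_eq[OF im th re]
  have int: "integrable lborel (f n)" for n
    unfolding f_def[abs_def] by (intro integrable_mult_right MG(1)) auto
  have val: "(\<integral>t. f n t \<partial>lborel) = 2 * of_real pi * (of_real (S_fun k r (Suc n)) * meijer_G bs (X_abs k x (Suc n)) \<theta>)" for n
    unfolding f_def integral_mult_right_zero by (subst MG(2)) auto
  have lnX: "ln (X_abs k x (Suc n)) = ln (X_abs k x 1) + ln (real (Suc n))" for n
  proof -
    have "X_abs k x (Suc n) = X_abs k x 1 * real (Suc n)" by (simp add: X_abs_def)
    moreover have "X_abs k x 1 > 0" using k x by (simp add: X_abs_def)
    ultimately show ?thesis by (simp only: ln_mult) (simp add: ln_mult)
  qed
  have fe: "f n t = meijer_integrand bs (X_abs k x 1) \<theta> (Complex c t) *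
      (of_real (S_fun k r (Suc n)) * of_nat (Suc n) powr (- Complex c t))" for n t
  proof -
    have "- Complex c t * (of_real (ln (X_abs k x (Suc n))) + \<i> * of_real \<theta>) =
        - Complex c t * (of_real (ln (X_abs k x 1)) + \<i> * of_real \<theta>) + - Complex c t * of_real (ln (real (Suc n)))"
      unfolding lnX by (simp add: algebra_simps)
    then show ?thesis
      unfolding f_def meijer_integrand_def of_nat_powr_exp[OF zero_less_Suc] by (simp only: exp_add mult_ac)
  qed
  have fsum: "(\<lambda>n. f n t) sums h (Complex c t)" for t
    unfolding fe h_def using c kc by (intro sums_mult S_fun_dirichlet_series k) auto
  have Ss: "summable (\<lambda>n. S_fun k r (Suc n) * real (Suc n) powr (- c))"
    using S_fun_dirichlet_series[OF k, of "of_real c" r] c kc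
    by (intro summable_of_real_dirichlet) (auto simp: sums_iff)
  have nf: "norm (f n t) = S_fun k r (Suc n) * real (Suc n) powr (- c) * norm (meijer_integrand bs (X_abs k x 1) \<theta> (Complex c t))" for n t
  proof -
    have "norm (of_nat (Suc n) powr (- Complex c t)) = real (Suc n) powr (- c)"
      using norm_powr_real_powr[of "of_nat (Suc n)" "- Complex c t"] by (simp del: of_nat_Suc)
    then show ?thesis unfolding fe norm_mult using S_fun_nonneg[of k r "Suc n"] by simp
  qed
  have ns: "summable (\<lambda>n. norm (f n t))" for t
    unfolding nf by (intro summable_mult2 Ss)
  have nis: "summable (\<lambda>n. \<integral>t. norm (f n t) \<partial>lborel)"
    unfolding nf integral_mult_right_zero by (intro summable_mult2 Ss)
  have ae: "AE t in lborel. summable (\<lambda>n. norm (f n t))" using ns by auto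
  show "integrable lborel (\<lambda>t. h (Complex c t))"
    using integrable_suminf[OF int ae nis] unfolding sums_unique[OF fsum, symmetric] .
  have "(\<lambda>n. 2 * of_real pi * (of_real (S_fun k r (Suc n)) * meijer_G bs (X_abs k x (Suc n)) \<theta>)) sums (\<integral>t. h (Complex c t) \<partial>lborel)"
    using sums_integral[OF int ae nis] unfolding val sums_unique[OF fsum, symmetric] .
  from sums_mult[OF this, of "1 / (2 * of_real pi)"]
  show "(\<lambda>n. of_real (S_fun k r (Suc n)) * meijer_G bs (X_abs k x (Suc n)) \<theta>) sums
       (1 / (2 * of_real pi) * (\<integral>t. h (Complex c t) \<partial>lborel))" by (simp add: mult.assoc)
qed

section \<open>Moving the line and assembling the formula\<close>

lemma Mellin_integrand_shift:
  assumes k: "k \<ge> 1" "odd k" and r: "odd r" "r \<noteq> - 1" and x: "x > 0"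
  defines "c \<equiv> \<bar>real_of_int r\<bar> + 5/2"
  shows "(\<integral>t. Mellin_integrand k r x (Complex c t) \<partial>lborel) = (\<integral>t. Mellin_integrand k r x (Complex (1 - c) t) \<partial>lborel) +
     2 * pi * (- 1 / 2 * zeta (- of_int r)
            + 1 / of_nat k * Gamma (1 / of_nat k) * zeta (1 / of_nat k - of_int r) * of_real (x powr (- 1 / real k))
            + R_one_plus k r x + of_real (R_rest k r x))"
proof -
  \<comment> \<open>With this N the left abscissa 1 - c is - (N + 1/2), midway between two poles of
    Gamma, and the margin 1/4 below stays to the right of - (N + 1); the strip contains exactly the
    poles 0, ..., -N of Gamma.\<close>
  define N where "N = nat (\<bar>r\<bar> + 1)"
  have N: "int N = \<bar>r\<bar> + 1" by (simp add: N_def)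
  then have rN: "real N = \<bar>real_of_int r\<bar> + 1" by linarith
  \<comment> \<open>If 1 + r is itself a pole of Gamma, it is counted once, as
    \<open>p2\<close>.\<close>
  define M where "M = {m. m \<le> N \<and> int m \<noteq> - (1 + r)}"
  define p1 p2 where "p1 = (1 / of_nat k :: complex)" and "p2 = (1 + of_int r :: complex)"
  let ?neg = "\<lambda>m. - of_nat m :: complex"
  define P where "P = insert p1 (insert p2 (?neg ` M))"
  define res1 where "res1 = 1 / of_nat k * Gamma (1 / of_nat k) * zeta (1 / of_nat k - of_int r) * of_real (x powr (- 1 / real k))"
  define rr where "rr p = (if p = p1 then res1 else if p = p2 then R_one_plus k r x else neg_residue k r x (nat \<lfloor>- Re p\<rfloor>))" for p
  have finM: "finite M" by (simp add: M_def)
  have re1: "Re p1 = 1 / real k"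
    by (metis Re_complex_of_real of_real_1 of_real_divide of_real_of_nat_eq p1_def)
  have re1': "0 < Re p1" "Re p1 \<le> 1" using k re1 by auto
  have ne12: "p1 \<noteq> p2"
    using inverse_of_nat_minus_odd_neq_1[OF k(1) r(1)] by (auto simp: p1_def p2_def)
  have ne1: "?neg m \<noteq> p1" for m
  proof
    assume "?neg m = p1"
    then have "Re p1 = - real m" by (metis Re_complex_of_real of_real_minus of_real_of_nat_eq)
    then show False using re1' by simp
  qed
  have ne2: "?neg m \<noteq> p2" if "int m \<noteq> - (1 + r)" for m
  proof
    assume "?neg m = p2"
    then have "of_int (- int m) = (of_int (1 + r) :: complex)" by (simp add: p2_def)
    then show False using that by (simp only: of_int_eq_iff)
  qed
  have rrneg: "rr (?neg m) = neg_residue k r x m" if "int m \<noteq> - (1 + r)" for m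
    using ne1[of m] ne2[OF that] by (simp add: rr_def)
  obtain C where C: "\<And>s. 1 - c \<le> Re s \<Longrightarrow> Re s \<le> c \<Longrightarrow> 1 \<le> \<bar>Im s\<bar> \<Longrightarrow> norm (Mellin_integrand k r x s) \<le> C * exp (- (1/2) * \<bar>Im s\<bar>)"
    using Mellin_integrand_decay[OF k(1), of "1 - c" c r x] by blast
  have "(\<integral>t. Mellin_integrand k r x (Complex c t) \<partial>lborel) = (\<integral>t. Mellin_integrand k r x (Complex (1 - c) t) \<partial>lborel) + 2 * pi * (\<Sum>p\<in>P. rr p)"
  proof (rule vertical_line_shift(3)[where a' = "1 - c - 1/4" and b' = "c + 1" and \<epsilon> = "1/2" and B = 1 and C = C])
    show "1 - c - 1/4 < 1 - c" "1 - c < c" "c < c + 1" "(1/2::real) > 0" by (auto simp: c_def)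
    show "finite P" using finM by (simp add: P_def)
    show "1 - c < Re p \<and> Re p < c" if "p \<in> P" for p
    proof -
      consider "p = p1" | "p = p2" | m where "m \<in> M" "p = ?neg m" using \<open>p \<in> P\<close> by (auto simp: P_def)
      then show ?thesis
      proof cases
        case 1
        then show ?thesis using re1' by (auto simp: c_def)
      next
        case 2
        then show ?thesis by (auto simp: c_def p2_def)
      next
        case 3
        then show ?thesis using rN by (auto simp: c_def M_def)
      qed
    qed
    show "Mellin_integrand k r x holomorphic_on {s. 1 - c - 1/4 < Re s \<and> Re s < c + 1} - P" (is "_ holomorphic_on ?A")
    proof -
      have "s \<notin> \<int>\<^sub>\<le>\<^sub>0" if s: "s \<in> ?A" for s
      proof
        assume "s \<in> \<int>\<^sub>\<le>\<^sub>0"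
        then obtain m where m: "s = ?neg m" by (elim nonpos_Ints_cases')
        have "real m < real N + 1" using s rN by (simp add: m c_def)
        then have "m \<le> N" by linarith
        moreover have "int m \<noteq> - (1 + r)"
        proof
          assume "int m = - (1 + r)"
          then have "of_int (- int m) = (of_int (1 + r) :: complex)" by simp
          then have "s = p2" by (simp add: m p2_def)
          then show False using s by (simp add: P_def)
        qed
        ultimately have "s \<in> P" by (simp add: P_def M_def m)
        then show False using s by blast
      qed
      then have G: "Gamma holomorphic_on ?A" by (intro holomorphic_Gamma) auto
      have z1: "(\<lambda>s. zeta (s - of_int r)) holomorphic_on ?A"
      proof (intro holomorphic_zeta' holomorphic_intros)
        fix s assume s: "s \<in> ?A"
        show "s - of_int r \<noteq> 1"
        proof
          assume "s - of_int r = 1"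
          then have "s = p2" by (simp add: p2_def eq_diff_eq diff_eq_eq)
          then show False using s by (simp add: P_def)
        qed
      qed
      have z2: "(\<lambda>s. zeta (of_nat k * s)) holomorphic_on ?A"
      proof (intro holomorphic_zeta' holomorphic_intros)
        fix s assume s: "s \<in> ?A"
        show "of_nat k * s \<noteq> 1"
        proof
          assume "of_nat k * s = 1"
          then have "s = p1" using k by (simp add: p1_def field_simps)
          then show False using s by (simp add: P_def)
        qed
      qed
      show ?thesis unfolding Mellin_integrand_def[abs_def]
        by (rule holomorphic_on_mult[OF holomorphic_on_mult[OF holomorphic_on_mult[OF G z1] z2]]) (intro holomorphic_intros)
    qed
    show "((\<lambda>s. Mellin_integrand k r x s * (s - p)) \<longlongrightarrow> rr p) (at p)" if "p \<in> P" for p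
    proof -
      consider "p = p1" | "p = p2" | m where "m \<in> M" "p = ?neg m" using \<open>p \<in> P\<close> by (auto simp: P_def)
      then show ?thesis
      proof cases
        case 1
        then show ?thesis using residue_inverse_of_nat[OF k(1) r(1) x] by (simp add: rr_def res1_def p1_def)
      next
        case 2
        then show ?thesis using residue_one_plus[OF k(1) r x] ne12 by (simp add: rr_def p2_def)
      next
        case 3
        then have "int m \<noteq> - (1 + r)" by (simp add: M_def)
        then show ?thesis using residue_neg_nat[OF k(1) _ x, of m r] rrneg[of m] unfolding 3(2) by simp
      qed
    qed
  qed (use C in auto)
  also have "(\<Sum>p\<in>P. rr p) = rr p1 + (rr p2 + (\<Sum>p\<in>?neg ` M. rr p))"
    unfolding P_def using finM ne12 ne1 ne2 by (subst sum.insert; (subst sum.insert)?) (auto simp: M_def)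
  also have "(\<Sum>p\<in>?neg ` M. rr p) = (\<Sum>m\<in>M. neg_residue k r x m)"
    by (subst sum.reindex) (auto simp: inj_on_def M_def rrneg)
  also have "\<dots> = - 1 / 2 * zeta (- of_int r) + of_real (R_rest k r x)"
    unfolding M_def by (rule sum_neg_residues[OF k r]) (use N in simp)
  also have "rr p1 = res1" by (simp add: rr_def)
  also have "rr p2 = R_one_plus k r x" using ne12 by (simp add: rr_def)
  also have "res1 + (R_one_plus k r x + (- 1 / 2 * zeta (- of_int r) + of_real (R_rest k r x))) =
     - 1 / 2 * zeta (- of_int r) + res1 + R_one_plus k r x + of_real (R_rest k r x)" by simp
  finally show ?thesis unfolding res1_def .
qed

text \<open>The summability conjunct guards the inner \<open>suminf\<close>, whose value would be
  meaningless for a divergent series; for the outer series \<open>sums\<close> asserts convergence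
  and value together.\<close>

theorem theorem3p7:
  fixes k :: nat and r :: int and x :: real
  assumes "k \<ge> 1" and "odd k" and "odd r" and "r \<noteq> - 1" and "x > 0"
  shows "(\<forall>j\<in>j_range k. summable (\<lambda>n. of_real (S_fun k r (Suc n)) *
            meijer_G (G_params k r) (X_abs k x (Suc n)) (X_arg (- j)))) \<and>
         (\<lambda>n. complex_of_real (D_fun k r (Suc n) * exp (- real (Suc n) * x))) sums
           (- 1 / 2 * zeta (- of_int r)
            + 1 / of_nat k * Gamma (1 / of_nat k) * zeta (1 / of_nat k - of_int r)
              * of_real (x powr (- 1 / real k))
            + R_one_plus k r x
            + of_real (R_rest k r x)
            + (- 1) powi ((2 * int k + r - 1) div 2)
              * of_real ((2 * pi) powr ((real k + 1 - 2 * of_int r) / 2)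
                  / (x * real k powr ((2 * real k - 1) / 2)))
              * (\<Sum>j\<in>j_range k. \<i> powi j *
                  (\<Sum>n. of_real (S_fun k r (Suc n)) *
                     meijer_G (G_params k r) (X_abs k x (Suc n)) (X_arg (- j)))))"
proof -
  \<comment> \<open>The offset 5/2 puts Re s = c and Re w = c into the regions of absolute
    convergence of both Dirichlet series, and c is half an odd integer, so the line avoids the zeros
    of sin (pi w).\<close>
  define c where "c = \<bar>real_of_int r\<bar> + 5/2"
  have c: "c > 1" "c - of_int r > 1" "c + of_int r > 1" by (auto simp: c_def)
  define h where "h j w = meijer_integrand (G_params k r) (X_abs k x 1) (X_arg (- j)) w *
      (zeta (w + of_int r) * zeta (of_nat k * w - of_nat k + 1))" for j w
  define J where "J j = (\<integral>t. h j (Complex c t) \<partial>lborel)" for j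
  define Res where "Res = - 1 / 2 * zeta (- of_int r)
            + 1 / of_nat k * Gamma (1 / of_nat k) * zeta (1 / of_nat k - of_int r) * of_real (x powr (- 1 / real k))
            + R_one_plus k r x + of_real (R_rest k r x)"
  have hi: "integrable lborel (\<lambda>t. h j (Complex c t))"
    and hs: "(\<lambda>n. of_real (S_fun k r (Suc n)) * meijer_G (G_params k r) (X_abs k x (Suc n)) (X_arg (- j))) sums (1 / (2 * of_real pi) * J j)"
    if "j \<in> j_range k" for j
    using S_meijer_sums[OF assms(1,5) c(1,3) that] unfolding h_def J_def by auto
  \<comment> \<open>The reflection w = 1 - s sends 1 - c + i t to c - i t; flipping the sign of t
    restores the upward line Re w = c.\<close>
  have "(\<integral>t. Mellin_integrand k r x (Complex (1 - c) t) \<partial>lborel) = (\<integral>t. Mellin_integrand k r x (Complex (1 - c) (0 + (-1) * t)) \<partial>lborel)"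
    by (subst lborel_integral_real_affine[of "-1" _ 0]) auto
  also have "\<dots> = (\<integral>t. voronoi_const k r x * (\<Sum>j\<in>j_range k. \<i> powi j * h j (Complex c t)) \<partial>lborel)"
  proof (intro Bochner_Integration.integral_cong refl)
    fix t
    let ?w = "Complex c t"
    have w: "Complex (1 - c) (0 + (-1) * t) = 1 - ?w" by (simp add: complex_eq_iff)
    have sin: "sin (of_real pi * ?w) \<noteq> 0"
    proof
      assume "sin (of_real pi * ?w) = 0"
      then obtain n where "of_real pi * ?w = of_real (real_of_int n * pi)"
        unfolding sin_eq_0 by (auto simp: mult.commute)
      then have "?w = of_int n" by simp
      then have "c = of_int n" by (simp add: complex_eq_iff)
      then have "2 * \<bar>r\<bar> + 5 = 2 * n" unfolding c_def by linarith
      then show False by presburger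
    qed
    have "Mellin_integrand k r x (1 - ?w) = voronoi_const k r x * (\<Sum>j\<in>j_range k. \<i> powi j * h j ?w)"
      unfolding Mellin_integrand_def h_def meijer_integrand_def
      using transformed_integrand[OF assms(1,2,3,5) _ _ sin] c by simp
    then show "Mellin_integrand k r x (Complex (1 - c) (0 + (-1) * t)) = voronoi_const k r x * (\<Sum>j\<in>j_range k. \<i> powi j * h j ?w)"
      by (simp only: w)
  qed
  also have "\<dots> = voronoi_const k r x * (\<Sum>j\<in>j_range k. \<i> powi j * J j)"
  proof -
    have "(\<integral>t. (\<Sum>j\<in>j_range k. \<i> powi j * h j (Complex c t)) \<partial>lborel) = (\<Sum>j\<in>j_range k. (\<integral>t. \<i> powi j * h j (Complex c t) \<partial>lborel))"
      by (rule Bochner_Integration.integral_sum) (intro integrable_mult_right hi)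
    then show ?thesis unfolding J_def by (simp only: integral_mult_right_zero)
  qed
  finally have left: "(\<integral>t. Mellin_integrand k r x (Complex (1 - c) t) \<partial>lborel) = voronoi_const k r x * (\<Sum>j\<in>j_range k. \<i> powi j * J j)" .
  have "(\<lambda>n. complex_of_real (D_fun k r (Suc n) * exp (- real (Suc n) * x))) sums
     (1 / (2 * of_real pi) * (\<integral>t. Mellin_integrand k r x (Complex c t) \<partial>lborel))"
    by (rule D_exp_sums_Mellin[OF assms(1,5) c(1,2)])
  also have "(\<integral>t. Mellin_integrand k r x (Complex c t) \<partial>lborel) = voronoi_const k r x * (\<Sum>j\<in>j_range k. \<i> powi j * J j) + 2 * of_real pi * Res"
    unfolding left[symmetric] Res_def c_def using Mellin_integrand_shift[OF assms] by simp
  also have "1 / (2 * of_real pi) * (voronoi_const k r x * (\<Sum>j\<in>j_range k. \<i> powi j * J j) + 2 * of_real pi * Res) =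
     Res + voronoi_const k r x * (\<Sum>j\<in>j_range k. \<i> powi j * (1 / (2 * of_real pi) * J j))"
    by (simp add: distrib_left sum_distrib_left mult_ac)
  also have "(\<Sum>j\<in>j_range k. \<i> powi j * (1 / (2 * of_real pi) * J j)) =
     (\<Sum>j\<in>j_range k. \<i> powi j * (\<Sum>n. of_real (S_fun k r (Suc n)) * meijer_G (G_params k r) (X_abs k x (Suc n)) (X_arg (- j))))"
    by (intro sum.cong refl) (simp only: sums_unique[OF hs])
  finally have "(\<lambda>n. complex_of_real (D_fun k r (Suc n) * exp (- real (Suc n) * x))) sums
     (Res + voronoi_const k r x * (\<Sum>j\<in>j_range k. \<i> powi j *
        (\<Sum>n. of_real (S_fun k r (Suc n)) * meijer_G (G_params k r) (X_abs k x (Suc n)) (X_arg (- j)))))" .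
  moreover have "\<forall>j\<in>j_range k. summable (\<lambda>n. of_real (S_fun k r (Suc n)) * meijer_G (G_params k r) (X_abs k x (Suc n)) (X_arg (- j)))"
    using hs by (auto simp: sums_iff)
  ultimately show ?thesis unfolding Res_def voronoi_const_def by blast
qed

end
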